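(* Let $K_L,K_R>0$. Then, almost surely, $$\dim_H\big(T_1^{-}(K_L)\cap T_1^{+}(K_R)\big)\le 1-p(K_L)-p(K_R),$$ where $$T_1^{-}(K_L)\cap T_1^{+}(K_R)=\{\tau\in[0,\infty): -1-K_L\sqrt t\le S_0^\tau(t)\le 1+K_R\sqrt t\ \text{ for all } t\ge 0\}.$$ So, for every $K>0$, the set $T_1^{\pm}(K):=\{\tau\in[0,\infty): |S_0^\tau(t)|\le 1+K\sqrt t\ \text{ for all } t\ge 0\}$ satisfies, almost surely, $$\dim_H(T_1^{\pm}(K))\le 1-2p(K).$$
   Context: $\dim_H$ is Hausdorff dimension. For $K>0$, $p(K)\in(0,1)$ denotes the solution $p$ of $f(p,K)=1$, where $$f(p,K):=\frac{\sin(\pi p/2)\,\Gamma(1+p/2)}{\pi}\sum_{n=1}^{\infty}\frac{(\sqrt2 K)^n}{n!}\,\Gamma\!\left(\frac{n-p}{2}\right).$$ (The function $p$ is continuous and decreasing on $(0,\infty)$, tending to $1$ as $K\to0$ and to $0$ as $K\to\infty$.) By ergodicity in $\tau$ of the dynamical discrete web, the Hausdorff dimensions of these random sets are almost surely constant. Separately from the present statement, it is known from earlier work of Fontes, Newman, Ravishankar and Schertzer that $T_1^{-}(K_L)\cap T_1^{+}(K_R)$ is empty when $p(K_L)+p(K_R)>1$, i.e. when the right-hand side of the first bound is negative. Here $T_1^{-}(K):=\{\tau\in[0,\infty): S_0^\tau(t)\ge -1-K\sqrt t\ \text{ for all } t\}$ and $T_1^{+}(K):=\{\tau\in[0,\infty):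 S_0^\tau(t)\le 1+K\sqrt t\ \text{ for all } t\}$. Dynamical discrete web (DyDW): let $\mathbb{Z}^2_{\mathrm{even}}=\{(x,t)\in\mathbb{Z}^2: x+t \text{ even}\}$, where $x$ is space and $t$ is (random walk) time. To each $z\in\mathbb{Z}^2_{\mathrm{even}}$ assign, independently over $z$, a right-continuous process $(\xi_z^\tau)_{\tau\ge 0}$ with values in $\{-1,+1\}$: $\xi_z^0$ is uniform on $\{\pm1\}$, and at each ring of a rate one Poisson clock attached to $z$ the value is replaced by a fresh independent uniform $\pm1$ variable (which may agree with the old value). All clocks, initial values and resampled values are independent. The parameter $\tau$ is called dynamical time. For fixed $\tau$, draw an arrow from each $(x,t)\in\mathbb{Z}^2_{\mathrm{even}}$ to $(x+\xi_{(x,t)}^\tau,t+1)$; $S_{z}^{\tau}(\cdot)$ denotes the path that starts at $z$ and follows the arrows at dynamical time $\tau$. $S_0^\tau:=S_{(0,0)}^\tau$ is the path from the origin. *)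

theory Defs
  imports "HOL-Probability.Probability"
begin

section \<open>Hausdorff dimension\<close>

text \<open>The convention \<open>0\<^sup>0 = 1\<close> for nonempty sets makes the zero-dimensional
  measure the counting measure.  Note that \<open>0 powr 0 = 0\<close> in the library.\<close>

definition hausdorff_gauge :: "real \<Rightarrow> 'a::metric_space set \<Rightarrow> ennreal" where
  "hausdorff_gauge s U =
     (if U = {} then 0 else if s = 0 then 1 else ennreal (diameter U powr s))"

text \<open>Boundedness is required of the covering sets because \<^const>\<open>diameter\<close> is
  meaningless on unbounded sets.\<close>

definition hausdorff_premeasure :: "real \<Rightarrow> real \<Rightarrow> 'a::metric_space set \<Rightarrow> ennreal" where
  "hausdorff_premeasure s \<delta> A =
     (INF U \<in> {U :: nat \<Rightarrow> 'a set.
                A \<subseteq> (\<Union>i. U i) \<and> (\<forall>i. bounded (U i) \<and> diameter (U i) \<le> \<delta>)}.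
        \<Sum>i. hausdorff_gauge s (U i))"

definition hausdorff_measure :: "real \<Rightarrow> 'a::metric_space set \<Rightarrow> ennreal" where
  "hausdorff_measure s A = (SUP \<delta> \<in> {0<..}. hausdorff_premeasure s \<delta> A)"

text \<open>The empty set has dimension \<open>- \<infinity>\<close>, so that a negative upper bound on the
  dimension asserts emptiness.\<close>

definition hausdorff_dim :: "'a::metric_space set \<Rightarrow> ereal" where
  "hausdorff_dim A =
     (if A = {} then - \<infinity> else Inf (ereal ` {s. 0 \<le> s \<and> hausdorff_measure s A = 0}))"


section \<open>The exponent\<close>

text \<open>The series over \<open>n \<ge> 1\<close> is indexed by \<open>Suc n\<close>.\<close>

definition exponent_fun :: "real \<Rightarrow> real \<Rightarrow> real" where
  "exponent_fun p K = sin (pi * p / 2) * Gamma (1 + p / 2) / pi *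
     (\<Sum>n. (sqrt 2 * K) ^ Suc n / fact (Suc n) * Gamma ((real (Suc n) - p) / 2))"

definition exponent :: "real \<Rightarrow> real" where
  "exponent K = (THE p. 0 < p \<and> p < 1 \<and> exponent_fun p K = 1)"


section \<open>Paths following a field of arrows\<close>

definition even_sites :: "(int \<times> int) set" where
  "even_sites = {(x, t). even (x + t)}"

primrec web_site :: "(int \<times> int \<Rightarrow> int) \<Rightarrow> int \<times> int \<Rightarrow> nat \<Rightarrow> int \<times> int" where
  "web_site a z 0 = z"
| "web_site a z (Suc n) = (let (x, t) = web_site a z n in (x + a (x, t), t + 1))"

text \<open>Position at real time \<open>t\<close> (for \<open>t \<ge> snd z\<close>) of the path started at \<open>z\<close>; the arrows
  are traversed at unit speed.  For the barriers below only integer times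
  matter, as \<open>web_path_lower_iff\<close> and \<open>web_path_upper_iff\<close> show.\<close>

definition web_path :: "(int \<times> int \<Rightarrow> int) \<Rightarrow> int \<times> int \<Rightarrow> real \<Rightarrow> real" where
  "web_path a z t =
     (let u = t - of_int (snd z); s = web_site a z (nat \<lfloor>u\<rfloor>)
      in of_int (fst s) + frac u * of_int (a s))"

lemma web_path_origin_nat: "web_path a (0, 0) (real n) = of_int (fst (web_site a (0, 0) n))"
  by (simp add: web_path_def Let_def)

lemma web_path_origin_between:
  assumes "0 \<le> f" "f < 1"
  shows "web_path a (0, 0) (real n + f) =
    (1 - f) * web_path a (0, 0) (real n) + f * web_path a (0, 0) (real (Suc n))"
proof -
  have fl: "\<lfloor>real n + f\<rfloor> = int n" using assms by linarith
  then have fr: "frac (real n + f) = f" by (simp add: frac_def)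
  obtain x t where s: "web_site a (0, 0) n = (x, t)" by fastforce
  show ?thesis
    unfolding web_path_origin_nat
    unfolding web_path_def Let_def by (simp add: fl fr s) (simp add: algebra_simps)
qed

lemma sqrt_between:
  assumes "0 \<le> f" "f < 1"
  shows "(1 - f) * sqrt (real n) + f * sqrt (real (Suc n)) \<le> sqrt (real n + f)"
proof (rule real_le_rsqrt)
  define p q where "p = sqrt (real n)" and "q = sqrt (real (Suc n))"
  have pq: "p\<^sup>2 = real n" "q\<^sup>2 = real n + 1" by (simp_all add: p_def q_def)
  have "0 \<le> f * (1 - f) * (p - q)\<^sup>2" using assms by simp
  also have "\<dots> = (1 - f) * p\<^sup>2 + f * q\<^sup>2 - ((1 - f) * p + f * q)\<^sup>2"
    by (simp add: power2_eq_square algebra_simps)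
  also have "(1 - f) * p\<^sup>2 + f * q\<^sup>2 = real n + f" by (simp add: pq algebra_simps)
  finally show "((1 - f) * sqrt (real n) + f * sqrt (real (Suc n)))\<^sup>2 \<le> real n + f"
    by (simp add: p_def q_def)
qed

lemma nonneg_real_split:
  assumes "0 \<le> (t::real)"
  obtains n f where "t = real n + f" "0 \<le> f" "f < 1"
proof
  show "t = real (nat \<lfloor>t\<rfloor>) + frac t" using assms by (simp add: frac_def)
qed (simp_all add: frac_lt_1)

lemma web_path_upper_iff:
  assumes "0 \<le> K"
  shows "(\<forall>t\<ge>0. web_path a (0, 0) t \<le> 1 + K * sqrt t) \<longleftrightarrow>
    (\<forall>n. of_int (fst (web_site a (0, 0) n)) \<le> 1 + K * sqrt (real n))"
proof (intro iffI allI impI)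
  fix t :: real
  assume H: "\<forall>n. of_int (fst (web_site a (0, 0) n)) \<le> 1 + K * sqrt (real n)" and "0 \<le> t"
  then obtain n f where t: "t = real n + f" "0 \<le> f" "f < 1" by (auto elim: nonneg_real_split)
  have "web_path a (0, 0) t =
      (1 - f) * web_path a (0, 0) (real n) + f * web_path a (0, 0) (real (Suc n))"
    using web_path_origin_between[OF t(2,3)] t(1) by simp
  also have "\<dots> \<le> (1 - f) * (1 + K * sqrt (real n)) + f * (1 + K * sqrt (real (Suc n)))"
    unfolding web_path_origin_nat
    using H[rule_format, of n] H[rule_format, of "Suc n"] t(2,3)
    by (intro add_mono mult_left_mono) auto
  also have "\<dots> = 1 + K * ((1 - f) * sqrt (real n) + f * sqrt (real (Suc n)))"
    by (simp add: algebra_simps)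
  also have "\<dots> \<le> 1 + K * sqrt t"
    using mult_left_mono[OF sqrt_between[OF t(2,3), of n] assms] t(1) by simp
  finally show "web_path a (0, 0) t \<le> 1 + K * sqrt t" .
next
  fix n
  assume "\<forall>t\<ge>0. web_path a (0, 0) t \<le> 1 + K * sqrt t"
  then show "of_int (fst (web_site a (0, 0) n)) \<le> 1 + K * sqrt (real n)"
    unfolding web_path_origin_nat[symmetric] by simp
qed

lemma web_path_lower_iff:
  assumes "0 \<le> K"
  shows "(\<forall>t\<ge>0. - 1 - K * sqrt t \<le> web_path a (0, 0) t) \<longleftrightarrow>
    (\<forall>n. - 1 - K * sqrt (real n) \<le> of_int (fst (web_site a (0, 0) n)))"
proof (intro iffI allI impI)
  fix t :: real
  assume H: "\<forall>n. - 1 - K * sqrt (real n) \<le> of_int (fst (web_site a (0, 0) n))" and "0 \<le> t"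
  then obtain n f where t: "t = real n + f" "0 \<le> f" "f < 1" by (auto elim: nonneg_real_split)
  have "- 1 - K * sqrt t \<le> - 1 - K * ((1 - f) * sqrt (real n) + f * sqrt (real (Suc n)))"
    using mult_left_mono[OF sqrt_between[OF t(2,3), of n] assms] t(1) by simp
  also have "\<dots> = (1 - f) * (- 1 - K * sqrt (real n)) + f * (- 1 - K * sqrt (real (Suc n)))"
    by (simp add: algebra_simps)
  also have "\<dots> \<le> (1 - f) * web_path a (0, 0) (real n) + f * web_path a (0, 0) (real (Suc n))"
    unfolding web_path_origin_nat
    using H[rule_format, of n] H[rule_format, of "Suc n"] t(2,3)
    by (intro add_mono mult_left_mono) auto
  also have "\<dots> = web_path a (0, 0) t"
    using web_path_origin_between[OF t(2,3)] t(1) by simp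
  finally show "- 1 - K * sqrt t \<le> web_path a (0, 0) t" .
next
  fix n
  assume "\<forall>t\<ge>0. - 1 - K * sqrt t \<le> web_path a (0, 0) t"
  then show "- 1 - K * sqrt (real n) \<le> of_int (fst (web_site a (0, 0) n))"
    unfolding web_path_origin_nat[symmetric] by simp
qed


section \<open>The dynamical discrete web\<close>

text \<open>At each even site \<open>z\<close>, \<open>X z 0\<close> is the initial value, \<open>X z k\<close> for \<open>k \<ge> 1\<close> is the
  value sampled at the \<open>k\<close>-th ring of the clock, and \<open>W z k\<close> is the waiting time between
  the \<open>k\<close>-th ring (time \<open>0\<close> if \<open>k = 0\<close>) and the next one: a rate one Poisson clock has
  independent exponential waiting times of parameter one.\<close>

locale dynamical_discrete_web = prob_space M
  for M :: "'w measure" +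
  fixes X :: "int \<times> int \<Rightarrow> nat \<Rightarrow> 'w \<Rightarrow> int"
    and W :: "int \<times> int \<Rightarrow> nat \<Rightarrow> 'w \<Rightarrow> real"
  assumes X_measurable:
    "\<And>z k. z \<in> even_sites \<Longrightarrow> X z k \<in> measurable M (count_space UNIV)"
  and X_uniform:
    "\<And>z k. z \<in> even_sites \<Longrightarrow>
       distr M (count_space UNIV) (X z k) = measure_pmf (pmf_of_set {-1, 1})"
  and W_exponential:
    "\<And>z k. z \<in> even_sites \<Longrightarrow> distributed M lborel (W z k) (exponential_density 1)"
  and all_independent:
    "indep_vars (\<lambda>_. borel)
       (case_sum (\<lambda>(z, k) \<omega>. real_of_int (X z k \<omega>)) (\<lambda>(z, k). W z k))
       ((even_sites \<times> UNIV) <+> (even_sites \<times> UNIV))"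

definition ring_time :: "(nat \<Rightarrow> real) \<Rightarrow> nat \<Rightarrow> real" where
  "ring_time w k = (\<Sum>j\<le>k. w j)"

definition rings_until :: "(nat \<Rightarrow> real) \<Rightarrow> real \<Rightarrow> nat" where
  "rings_until w \<tau> = card {k. ring_time w k \<le> \<tau>}"

definition arrow :: "(int \<times> int \<Rightarrow> nat \<Rightarrow> 'w \<Rightarrow> int) \<Rightarrow> (int \<times> int \<Rightarrow> nat \<Rightarrow> 'w \<Rightarrow> real)
    \<Rightarrow> 'w \<Rightarrow> real \<Rightarrow> int \<times> int \<Rightarrow> int" where
  "arrow X W \<omega> \<tau> z = X z (rings_until (\<lambda>k. W z k \<omega>) \<tau>) \<omega>"

text \<open>The sets of exceptional dynamical times, for a realization
  \<open>\<xi> :: real \<Rightarrow> int \<times> int \<Rightarrow> int\<close> of the arrows at all dynamical times.\<close>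

definition T1_minus :: "(real \<Rightarrow> int \<times> int \<Rightarrow> int) \<Rightarrow> real \<Rightarrow> real set" where
  "T1_minus \<xi> K = {\<tau>. 0 \<le> \<tau> \<and> (\<forall>t\<ge>0. web_path (\<xi> \<tau>) (0, 0) t \<ge> - 1 - K * sqrt t)}"

definition T1_plus :: "(real \<Rightarrow> int \<times> int \<Rightarrow> int) \<Rightarrow> real \<Rightarrow> real set" where
  "T1_plus \<xi> K = {\<tau>. 0 \<le> \<tau> \<and> (\<forall>t\<ge>0. web_path (\<xi> \<tau>) (0, 0) t \<le> 1 + K * sqrt t)}"

definition T1_plusminus :: "(real \<Rightarrow> int \<times> int \<Rightarrow> int) \<Rightarrow> real \<Rightarrow> real set" where
  "T1_plusminus \<xi> K = {\<tau>. 0 \<le> \<tau> \<and> (\<forall>t\<ge>0. \<bar>web_path (\<xi> \<tau>) (0, 0) t\<bar> \<le> 1 + K * sqrt t)}"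

end

(*
Fix a dynamical time interval of length 1/k. At each site let the arrow be undecided if the clock
rings during the interval. Sending undecided arrows to the right (left) gives a path R (L) that
dominates from the right (left) every path S_0^tau with tau in the interval, so such a tau lies
in T_1^-(K_L) and T_1^+(K_R) only if R respects the lower and L the upper barrier. The first event is
increasing and the second decreasing in the field, whose values are ordered as
left < undecided < right, so Harris' inequality bounds the probability by a product: this is why
the exponents p(K_L) and p(K_R) add up.

R is a random walk of drift O(1/k); up to time k^2 the drift costs only an arbitrarily small
loss in the exponent (Hoelder). For the driftless walk, mixing the exponential martingales with
the weight s^(-a-1) gives a space-time harmonic function of size n^a on the region above the
barrier -K sqrt n, provided the scaling limit integral is positive on the barrier. That integral
vanishes exactly at a = p(K)/2 and is positive for smaller a. Hence each interval is hit with
probability at most k^(-q) for every q < p(K_L) + p(K_R), and a first moment count of dyadic intervals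
bounds the dimension, or shows emptiness when p(K_L) + p(K_R) > 1.
*)

theory Submission
  imports Defs "HOL-Real_Asymp.Real_Asymp"
begin

section \<open>The exponent as the root of an integral equation\<close>

text \<open>With p = 2a, the range 0 < p < 1 is the range of a in which the integral against
  s^(-a-1) converges. Expanding exp(K sqrt(2s)) in the integrand produces Gamma integrals, and the
  reflection formula simplifies the prefactor of \<open>exponent_fun\<close>; this is why the series
  equation is the vanishing of \<open>bm_integral\<close>.

  The drift cannot simply be dropped: over k^2 steps a drift of order 1/k displaces the walk by
  order k, which is the size of its fluctuations. For the power 1 - 1/m of the harmonic function the
  loss per step is a factor exp(m delta^2 / 2), of second order in the drift delta, so k^2 steps
  cost a bounded factor. The price is the exponent 1 - 1/m, and m is free.

  The harmonic function must also be controlled one unit below the barrier, since a walk that has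
  survived so far may step there.

  The random set itself is never measured. Outside a null set each of its points forces the
  finite-box events \<open>near_event\<close>, and only these are shown measurable and
  estimated.\<close>

definition pow_weight :: "real \<Rightarrow> real \<Rightarrow> real" where
  "pow_weight a s = indicator {0<..} s * s powr (- a - 1)"

lemma pow_weight_measurable [measurable]: "pow_weight a \<in> borel_measurable borel"
  unfolding pow_weight_def by measurable

lemma pow_weight_nonneg [simp]: "0 \<le> pow_weight a s"
  by (simp add: pow_weight_def)

text \<open>\<open>min (sqrt s) 1\<close> is the common shape of all majorants below. Integrability
  at 0 asks for a < 1/2, at infinity for 0 < a.\<close>

lemma integrable_pow_weight_dominating:
  assumes "0 < a" "a < 1/2"
  shows "integrable lborel (\<lambda>s. pow_weight a s * min (sqrt s) 1)"
proof -
  have 1: "set_integrable lebesgue {0..1::real} (\<lambda>s. s powr (-a - 1/2))"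
    using has_integral_powr_from_0[of "-a - 1/2" 1] assms
    by (intro nonnegative_absolutely_integrable_1) (auto intro: has_integral_integrable)
  then have 1: "set_integrable lborel {0..1::real} (\<lambda>s. s powr (-a - 1/2))"
    unfolding set_integrable_def by (subst (asm) integrable_completion) measurable
  have 2: "set_integrable lebesgue {1..} (\<lambda>s::real. s powr (-a - 1))"
    using has_integral_powr_to_inf[of "-a - 1" 1] assms
    by (intro nonnegative_absolutely_integrable_1) (auto intro: has_integral_integrable)
  then have 2: "set_integrable lborel {1..} (\<lambda>s::real. s powr (-a - 1))"
    unfolding set_integrable_def by (subst (asm) integrable_completion) measurable
  have "integrable lborel (\<lambda>s::real. indicator {0..1} s *\<^sub>R s powr (-a - 1/2)
      + indicator {1..} s *\<^sub>R s powr (-a - 1))"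
    using 1 2 unfolding set_integrable_def by (rule Bochner_Integration.integrable_add)
  then show ?thesis
  proof (rule Bochner_Integration.integrable_bound)
    show "AE s in lborel. norm (pow_weight a s * min (sqrt s) 1)
      \<le> norm (indicator {0..1} s *\<^sub>R s powr (-a - 1/2) + indicator {1..} s *\<^sub>R s powr (-a - 1))"
    proof (rule AE_I2)
      fix s :: real
      have "s powr (-a - 1) * sqrt s = s powr (-a - 1/2)" if "0 < s"
        using that by (simp add: powr_half_sqrt[symmetric] powr_add[symmetric] algebra_simps)
      then show "norm (pow_weight a s * min (sqrt s) 1)
        \<le> norm (indicator {0..1} s *\<^sub>R s powr (-a - 1/2) + indicator {1..} s *\<^sub>R s powr (-a - 1))"
        by (auto simp: pow_weight_def indicator_def min_def abs_mult)
    qed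
  qed measurable
qed

lemma integrable_pow_weight:
  assumes "0 < a" "a < 1/2" and [measurable]: "g \<in> borel_measurable borel"
    and "\<And>s. 0 < s \<Longrightarrow> \<bar>g s\<bar> \<le> A * min (sqrt s) 1"
  shows "integrable lborel (\<lambda>s. pow_weight a s * g s)"
proof (rule Bochner_Integration.integrable_bound)
  show "integrable lborel (\<lambda>s. A * (pow_weight a s * min (sqrt s) 1))"
    using integrable_pow_weight_dominating[OF assms(1,2)] by simp
  show "AE s in lborel. norm (pow_weight a s * g s)
      \<le> norm (A * (pow_weight a s * min (sqrt s) 1))"
  proof (rule AE_I2)
    fix s :: real
    show "norm (pow_weight a s * g s) \<le> norm (A * (pow_weight a s * min (sqrt s) 1))"
    proof (cases "0 < s")
      case True
      have "pow_weight a s * \<bar>g s\<bar> \<le> pow_weight a s * (A * min (sqrt s) 1)"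
        by (intro mult_left_mono assms(4) True) simp
      then show ?thesis by (simp add: abs_mult algebra_simps abs_le_iff) (metis abs_ge_self abs_mult
            mult.left_commute order_trans pow_weight_nonneg abs_of_nonneg)
    qed (simp add: pow_weight_def)
  qed
qed measurable

lemma abs_one_minus_exp_le: "\<bar>1 - exp (y::real)\<bar> \<le> \<bar>y\<bar> * exp \<bar>y\<bar>"
proof (cases "0 \<le> y")
  case True
  have "exp y * (1 - y) \<le> exp y * exp (- y)"
    using exp_ge_add_one_self[of "-y"] by (intro mult_left_mono) auto
  then have "exp y - 1 \<le> y * exp y" by (simp add: algebra_simps flip: exp_add)
  moreover have "1 \<le> exp y" using True by simp
  ultimately show ?thesis using True by simp
next
  case False
  then have "exp y \<le> 1" by simp
  moreover have "1 - exp y \<le> - y" using exp_ge_add_one_self[of y] by linarith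
  moreover have "- y * 1 \<le> - y * exp (- y)" using False by (intro mult_left_mono) auto
  ultimately have "1 - exp y \<le> - y * exp (- y)" by linarith
  then show ?thesis using False \<open>exp y \<le> 1\<close> by simp
qed

text \<open>The substitution \<open>s = u\<^sup>2 / 2\<close> turns \<open>bm_integral a K\<close> below into a multiple of
  the integral of \<open>u powr (- 2 * a - 1) * (1 - exp (K * u - u\<^sup>2 / 2))\<close>, the profile at \<open>x = - K\<close> of the
  space-time harmonic function of Brownian motion of the form \<open>t powr a * h (x / sqrt t)\<close>.\<close>

definition bm_defect :: "real \<Rightarrow> real \<Rightarrow> real" where
  "bm_defect K s = 1 - exp (K * sqrt (2 * s) - s)"

lemma bm_defect_measurable [measurable]: "bm_defect K \<in> borel_measurable borel"
  unfolding bm_defect_def by measurable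

text \<open>The coefficient 1/4 is what \<open>cosh_ge_exp_min\<close> leaves for the walk; the
  Brownian defect, with v = sqrt(2s), would allow 1/2.\<close>

lemma square_completion: "K * v - v\<^sup>2 / 4 \<le> K\<^sup>2" for K v :: real
proof -
  have "0 \<le> (v/2 - K)\<^sup>2" by simp
  then show ?thesis by (simp add: power2_eq_square field_simps)
qed

lemma bm_defect_bound:
  assumes "0 < K"
  obtains A where "\<And>s. 0 < s \<Longrightarrow> \<bar>bm_defect K s\<bar> \<le> A * min (sqrt s) 1"
proof
  \<comment> \<open>For s at most 1 the exponent is bounded by C sqrt s: the 2 comes from sqrt 2 <
    2, the 1 from s \<le> sqrt s.\<close>
  define C where "C = 2 * K + 1"
  fix s :: real assume s: "0 < s"
  have sq2: "sqrt (2 * s) \<le> 2 * sqrt s" 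
    using s by (simp add: real_sqrt_mult sqrt2_less_2 less_imp_le)
  show "\<bar>bm_defect K s\<bar> \<le> (C * exp C + exp (K\<^sup>2) + 1) * min (sqrt s) 1"
  proof (cases "s \<le> 1")
    case True
    have "s \<le> sqrt s" using True s by (simp add: real_le_rsqrt power2_eq_square mult_left_le)
    moreover have "\<bar>K * sqrt (2 * s) - s\<bar> \<le> K * sqrt (2 * s) + s"
      using s assms by (simp add: abs_le_iff)
    moreover have "K * sqrt (2 * s) \<le> K * (2 * sqrt s)" using sq2 assms by simp
    ultimately have *: "\<bar>K * sqrt (2 * s) - s\<bar> \<le> C * sqrt s" by (simp add: C_def algebra_simps)
    have sq1: "sqrt s \<le> 1" using True by simp
    have "C * sqrt s \<le> C" using sq1 assms by (intro mult_left_le) (auto simp: C_def)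
    then have "\<bar>bm_defect K s\<bar> \<le> C * sqrt s * exp C"
      unfolding bm_defect_def using * s assms order_trans[OF *, of C]
      by (intro order_trans[OF abs_one_minus_exp_le] mult_mono) (auto simp: C_def)
    also have "\<dots> \<le> (C * exp C + exp (K\<^sup>2) + 1) * sqrt s" using s by (simp add: algebra_simps)
    finally show ?thesis using sq1 by (simp add: min_absorb1)
  next
    case False
    have "K * sqrt (2 * s) - s \<le> K\<^sup>2"
      using square_completion[of K "sqrt (2 * s)"] s by simp
    then have "exp (K * sqrt (2 * s) - s) \<le> exp (K\<^sup>2)" by simp
    then have "\<bar>bm_defect K s\<bar> \<le> exp (K\<^sup>2) + 1" unfolding bm_defect_def
      using exp_ge_zero[of "K * sqrt (2 * s) - s"] by linarith
    moreover have "0 \<le> C * exp C" using assms by (simp add: C_def)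
    moreover have "min (sqrt s) 1 = 1" using False by simp
    ultimately show ?thesis by simp
  qed
qed

definition bm_integral :: "real \<Rightarrow> real \<Rightarrow> real" where
  "bm_integral a K = (\<integral>s. pow_weight a s * bm_defect K s \<partial>lborel)"

lemma bm_integrable:
  assumes "0 < a" "a < 1/2" "0 < K"
  shows "integrable lborel (\<lambda>s. pow_weight a s * bm_defect K s)"
  using assms by (metis bm_defect_bound bm_defect_measurable integrable_pow_weight)

text \<open>The integrand changes sign only at \<open>s = 2 * K\<^sup>2\<close>, whence the normalization.\<close>

lemma bm_integral_strict_decreasing:
  assumes "0 < a" "a < b" "b < 1/2" "0 < K"
  shows "(2 * K\<^sup>2) powr b * bm_integral b K < (2 * K\<^sup>2) powr a * bm_integral a K"
proof -
  define c where "c = 2 * K\<^sup>2"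
  have c: "0 < c" using assms by (simp add: c_def)
  define D where "D = (\<lambda>s. (c powr a * pow_weight a s - c powr b * pow_weight b s) * bm_defect K s)"
  \<comment> \<open>The difference of the weights, once normalized, changes sign at s = c, just as
    the defect does, so the product is positive on both sides.\<close>
  have sgn: "0 < D s" if s: "0 < s" "s \<noteq> c" for s
  proof -
    have e: "c powr x * pow_weight x s = (c / s) powr x / s" for x
      using s c by (simp add: pow_weight_def powr_divide powr_diff powr_minus field_simps)
    have y: "K * sqrt (2 * s) - s = sqrt s * (sqrt c - sqrt s)"
      using s assms by (simp add: c_def real_sqrt_mult algebra_simps)
    show ?thesis
    proof (cases "s < c")
      case True
      then have "(c / s) powr a < (c / s) powr b" using assms s by (intro powr_less_mono) auto
      then have "(c / s) powr a / s < (c / s) powr b / s" using s by (simp add: divide_strict_right_mono)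
      moreover have "bm_defect K s < 0" using True s by (simp add: bm_defect_def y)
      ultimately show ?thesis unfolding D_def e by (intro mult_neg_neg) auto
    next
      case False
      then have "(c / s) powr b < (c / s) powr a" using assms s c
        by (intro powr_less_mono') auto
      then have "(c / s) powr b / s < (c / s) powr a / s" using s by (simp add: divide_strict_right_mono)
      moreover have "bm_defect K s > 0" using False s by (simp add: bm_defect_def y mult_pos_neg)
      ultimately show ?thesis unfolding D_def e by (intro mult_pos_pos) auto
    qed
  qed
  have D0: "D s = 0" if "s \<le> 0" for s using that by (simp add: D_def pow_weight_def)
  have Dn: "0 \<le> D s" for s
  proof -
    have "K * sqrt (2 * c) = c"
      using assms by (simp add: c_def real_sqrt_mult power2_eq_square)
    then have "D c = 0" by (simp add: D_def bm_defect_def)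
    then show ?thesis using sgn[of s] D0[of s] by (cases "s = c") force+
  qed
  have int: "integrable lborel D"
  proof -
    have "integrable lborel (\<lambda>s. c powr a * (pow_weight a s * bm_defect K s)
       - c powr b * (pow_weight b s * bm_defect K s))"
      using bm_integrable[of a K] bm_integrable[of b K] assms by simp
    then show ?thesis by (simp add: D_def algebra_simps)
  qed
  have "integral\<^sup>L lborel D = c powr a * bm_integral a K - c powr b * bm_integral b K"
    using bm_integrable[of a K] bm_integrable[of b K] assms
    by (simp add: D_def bm_integral_def left_diff_distrib mult.assoc)
  moreover have "integral\<^sup>L lborel D \<noteq> 0"
  proof
    assume "integral\<^sup>L lborel D = 0"
    then have "AE s in lborel. D s = 0"
      using integral_nonneg_eq_0_iff_AE[OF int] Dn by simp
    moreover have "AE s in lborel. s \<noteq> c" by (rule AE_lborel_singleton)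
    ultimately have "AE s in lborel. s \<notin> {0<..<1::real}"
    proof eventually_elim
      fix s assume "D s = 0" "s \<noteq> c"
      then show "s \<notin> {0<..<1}" using sgn[of s] by auto
    qed
    then have "emeasure lborel {0<..<1::real} = 0"
      by (subst (asm) AE_iff_measurable[OF _ refl]) (auto simp: Int_def greaterThanLessThan_def)
    then show False by simp
  qed
  moreover have "0 \<le> integral\<^sup>L lborel D" using Dn by simp
  ultimately show ?thesis by (simp add: c_def)
qed

section \<open>The defining series as an expansion of the integral\<close>

lemma Gamma_has_bochner_integral:
  assumes "0 < x"
  shows "has_bochner_integral lborel (\<lambda>s. pow_weight (- x) s * exp (- s)) (Gamma x)"
proof (rule has_bochner_integral_nn_integral)
  have "(\<integral>\<^sup>+ s. ennreal (pow_weight (- x) s * exp (- s)) \<partial>lborel)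
      = (\<integral>\<^sup>+ s. ennreal (indicator {0..} s * s powr (x - 1) / exp s) \<partial>lborel)"
    by (intro nn_integral_cong_AE AE_I[where N="{0}"])
       (auto simp: pow_weight_def exp_minus field_simps split: split_indicator)
  then show "(\<integral>\<^sup>+ s. ennreal (pow_weight (- x) s * exp (- s)) \<partial>lborel) = ennreal (Gamma x)"
    by (simp add: Gamma_conv_nn_integral_real[OF assms])
qed (use assms Gamma_real_pos in \<open>auto intro: less_imp_le\<close>)

lemma one_minus_exp_integrable:
  assumes "0 < a" "a < 1/2"
  shows "integrable lborel (\<lambda>s. pow_weight a s * (1 - exp (- s)))"
proof (rule integrable_pow_weight[where A=1])
  fix s :: real assume s: "0 < s"
  have 1: "1 - exp (- s) \<le> s" using exp_ge_add_one_self[of "-s"] by linarith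
  have "s \<le> sqrt s" if "s \<le> 1" using that s by (simp add: real_le_rsqrt power2_eq_square mult_left_le)
  moreover have "1 \<le> sqrt s" if "\<not> s \<le> 1" using that by simp
  ultimately have "1 - exp (- s) \<le> min (sqrt s) 1" using 1 s by (cases "s \<le> 1") (auto simp: min_def)
  then show "\<bar>1 - exp (- s)\<bar> \<le> 1 * min (sqrt s) 1" using s by simp
qed (use assms in auto)

text \<open>Integration by parts with antiderivative \<open>F\<close>; the boundary terms behave
  like s^(1-a) at 0 and s^(-a) at infinity. The value is - Gamma(-a): it stands in for the divergent
  term of index 0 in the expansion below.\<close>

lemma one_minus_exp_integral:
  assumes a: "0 < a" "a < 1/2"
  shows "(\<integral>s. pow_weight a s * (1 - exp (- s)) \<partial>lborel) = Gamma (1 - a) / a"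
proof -
  define f where "f = (\<lambda>s::real. s powr (- a - 1) * (1 - exp (- s)) - s powr (- a) * exp (- s) / a)"
  define F where "F = (\<lambda>s::real. - (s powr (- a) * (1 - exp (- s)) / a))"
  note G = Gamma_has_bochner_integral[of "1 - a"]
  have eq: "indicator {0<..} s *\<^sub>R f s
      = pow_weight a s * (1 - exp (- s)) - pow_weight (- (1 - a)) s * exp (- s) / a" for s
    by (simp add: f_def pow_weight_def right_diff_distrib)
  have intf: "set_integrable lborel {0<..} f"
    unfolding set_integrable_def eq
    using one_minus_exp_integrable[OF a] G a by (auto simp: has_bochner_integral_iff)
  have "(LBINT s=0..\<infinity>. f s) = 0 - 0"
  proof (rule interval_integral_FTC_integrable)
    have a_nz: "a \<noteq> 0" using a by simp
    fix s :: real assume "0 < ereal s"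
    then have s: "0 < s" by simp
    show "(F has_vector_derivative f s) (at s)"
      unfolding has_real_derivative_iff_has_vector_derivative[symmetric] F_def f_def
      using s a_nz by (auto intro!: derivative_eq_intros simp: diff_divide_distrib algebra_simps)
    show "isCont f s" unfolding f_def using s a_nz by (intro continuous_intros) auto
  next
    show "set_integrable lborel (einterval 0 \<infinity>) f"
      using intf by (simp add: zero_ereal_def)
    have "((\<lambda>s::real. s powr (-a) * (1 - exp (- s))) \<longlongrightarrow> 0) (at_right 0)"
      using a by real_asymp
    from tendsto_minus[OF tendsto_divide[OF this tendsto_const[of a]]] a 
    have "(F \<longlongrightarrow> 0) (at_right 0)" unfolding F_def by simp
    then show "((F \<circ> real_of_ereal) \<longlongrightarrow> 0) (at_right 0)" 
      by (simp add: zero_ereal_def ereal_tendsto_simps)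
    have "((\<lambda>s::real. s powr (-a) * (1 - exp (- s))) \<longlongrightarrow> 0) at_top"
      using a by real_asymp
    from tendsto_minus[OF tendsto_divide[OF this tendsto_const[of a]]] a 
    have "(F \<longlongrightarrow> 0) at_top" unfolding F_def by simp
    then show "((F \<circ> real_of_ereal) \<longlongrightarrow> 0) (at_left \<infinity>)"
      by (simp add: ereal_tendsto_simps)
  qed simp
  then have "(\<integral>s. indicator {0<..} s *\<^sub>R f s \<partial>lborel) = 0"
    by (simp add: interval_lebesgue_integral_0_infty set_lebesgue_integral_def)
  moreover have "(\<integral>s. indicator {0<..} s *\<^sub>R f s \<partial>lborel)
      = (\<integral>s. pow_weight a s * (1 - exp (- s)) \<partial>lborel) - Gamma (1 - a) / a"
    unfolding eq using one_minus_exp_integrable[OF a] G a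
    by (simp add: has_bochner_integral_iff)
  ultimately show ?thesis by simp
qed

text \<open>Write the defect as (1 - exp(-s)) - exp(-s) (exp(K sqrt(2s)) - 1) and expand the last
  exponential. Its powers start at 1, so every Gamma argument is positive because a < 1/2. All terms
  are nonnegative, which justifies the interchange of sum and integral.\<close>

lemma exponent_series_sums:
  assumes a: "0 < a" "a < 1/2" and K: "0 < K"
  shows "(\<lambda>n. (sqrt 2 * K) ^ Suc n / fact (Suc n) * Gamma (real (Suc n) / 2 - a))
    sums (Gamma (1 - a) / a - bm_integral a K)"
proof -
  define c where "c = (\<lambda>n. (sqrt 2 * K) ^ Suc n / fact (Suc n) * Gamma (real (Suc n) / 2 - a))"
  define f where "f = (\<lambda>n s. pow_weight a s * exp (- s) * ((K * sqrt (2 * s)) ^ Suc n / fact (Suc n)))"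
  define J where "J = (\<lambda>s. pow_weight a s * exp (- s) * (exp (K * sqrt (2 * s)) - 1))"
  have f_eq: "f n s = (sqrt 2 * K) ^ Suc n / fact (Suc n) *
      (pow_weight (- (real (Suc n) / 2 - a)) s * exp (- s))" for n s
  proof (cases "0 < s")
    case True
    have "sqrt s ^ Suc n = s powr (real (Suc n) / 2)"
      using True by (simp add: powr_half_sqrt[symmetric] powr_powr powr_add[symmetric] add_divide_distrib
          flip: powr_realpow)
    then have "(K * sqrt (2 * s)) ^ Suc n = (sqrt 2 * K) ^ Suc n * s powr (real (Suc n) / 2)"
      by (simp only: real_sqrt_mult power_mult_distrib) (simp add: algebra_simps)
    moreover have "s powr (- a - 1) * s powr (real (Suc n) / 2)
        = s powr (- (- (real (Suc n) / 2 - a)) - 1)"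
      by (simp add: powr_add[symmetric] algebra_simps)
    ultimately show ?thesis using True unfolding f_def pow_weight_def 
      by (simp add: mult_ac del: power_Suc)
  qed (simp add: f_def pow_weight_def)
  have c0: "0 \<le> c n" for n
  proof -
    have "0 < Gamma (real (Suc n) / 2 - a)" using a by (intro Gamma_real_pos) (simp add: field_simps)
    then show ?thesis using K unfolding c_def by (intro mult_nonneg_nonneg) auto
  qed
  have hf: "has_bochner_integral lborel (f n) (c n)" for n
    unfolding f_eq c_def using a
    by (intro has_bochner_integral_mult_right Gamma_has_bochner_integral) (simp add: field_simps)
  have f0: "0 \<le> f n s" for n s using K
    unfolding f_def by (cases "0 < s") (auto simp: pow_weight_def)
  have fs: "(\<lambda>n. f n s) sums J s" for s
  proof -
    have "(\<lambda>n. (K * sqrt (2 * s)) ^ n / fact n) sums exp (K * sqrt (2 * s))"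
      using exp_converges[of "K * sqrt (2 * s)"] by (simp add: divide_inverse mult.commute)
    then have "(\<lambda>n. (K * sqrt (2 * s)) ^ Suc n / fact (Suc n)) sums (exp (K * sqrt (2 * s)) - 1)"
      by (subst sums_Suc_iff) simp
    then show ?thesis unfolding f_def J_def by (rule sums_mult)
  qed
  have J0: "0 \<le> J s" for s using sums_le[OF _ sums_zero fs[of s]] f0 by simp
  have J_eq: "J s = pow_weight a s * (1 - exp (- s)) - pow_weight a s * bm_defect K s" for s
  proof -
    have "exp (K * sqrt (2 * s) - s) = exp (- s) * exp (K * sqrt (2 * s))" by (simp flip: exp_add)
    then show ?thesis unfolding J_def bm_defect_def by (simp add: algebra_simps)
  qed
  have iJ: "integrable lborel J"
    unfolding J_eq using one_minus_exp_integrable[OF a] bm_integrable[OF a K] by simp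
  have J: "integral\<^sup>L lborel J = Gamma (1 - a) / a - bm_integral a K"
    unfolding J_eq bm_integral_def
    using one_minus_exp_integrable[OF a] bm_integrable[OF a K] one_minus_exp_integral[OF a] by simp
  have fm: "f n \<in> borel_measurable lborel" for n using hf[of n] by (auto simp: has_bochner_integral_iff)
  have "(\<Sum>n. ennreal (c n)) = (\<Sum>n. \<integral>\<^sup>+s. ennreal (f n s) \<partial>lborel)"
    using hf f0 by (intro suminf_cong, subst nn_integral_eq_integral) (auto simp: has_bochner_integral_iff)
  also have "\<dots> = (\<integral>\<^sup>+s. (\<Sum>n. ennreal (f n s)) \<partial>lborel)"
    using fm by (subst nn_integral_suminf) auto
  also have "\<dots> = (\<integral>\<^sup>+s. ennreal (J s) \<partial>lborel)"
    using fs f0 J0 by (intro nn_integral_cong sums_unique[symmetric]) simp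
  also have "\<dots> = ennreal (integral\<^sup>L lborel J)"
    using iJ J0 by (intro nn_integral_eq_integral) auto
  finally have "(\<lambda>n. ennreal (c n)) sums ennreal (integral\<^sup>L lborel J)"
    by (metis summableI summable_sums)
  moreover have "0 \<le> integral\<^sup>L lborel J" using J0 by simp
  ultimately have "c sums integral\<^sup>L lborel J" using c0 by simp
  then show ?thesis unfolding J c_def .
qed

text \<open>By the reflection formula and Gamma(1+a) = a Gamma(a) the prefactor is a / Gamma(1-a).
  It cancels the constant term of the series to 1 and leaves a positive multiple of the integral as
  the deviation from 1.\<close>

lemma exponent_fun_eq_1_iff:
  assumes p: "0 < p" "p < 1" and K: "0 < K"
  shows "exponent_fun p K = 1 \<longleftrightarrow> bm_integral (p / 2) K = 0"
proof -
  define a where "a = p / 2"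
  have a: "0 < a" "a < 1/2" using p by (auto simp: a_def)
  define S where "S = Gamma (1 - a) / a - bm_integral a K"
  have "(\<Sum>n. (sqrt 2 * K) ^ Suc n / fact (Suc n) * Gamma ((real (Suc n) - p) / 2)) = S"
    using sums_unique[OF exponent_series_sums[OF a K]] by (simp add: a_def S_def diff_divide_distrib)
  then have e: "exponent_fun p K = sin (pi * a) * Gamma (1 + a) / pi * S"
    by (simp add: exponent_fun_def a_def)
  have "Gamma (complex_of_real a) = of_real (Gamma a)" by (rule Gamma_complex_of_real)
  moreover have "Gamma (1 - complex_of_real a) = of_real (Gamma (1 - a))"
    using Gamma_complex_of_real[of "1 - a"] by simp
  moreover have "sin (of_real pi * of_real a) = complex_of_real (sin (pi * a))"
    by (metis of_real_mult sin_of_real)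
  ultimately have "complex_of_real (Gamma a * Gamma (1 - a)) = complex_of_real (pi / sin (pi * a))"
    using Gamma_reflection_complex[of "of_real a"] by simp
  then have refl: "Gamma a * Gamma (1 - a) = pi / sin (pi * a)"
    using of_real_eq_iff by blast
  have sin: "0 < sin (pi * a)" using a by (intro sin_gt_zero) auto
  have Gp: "0 < Gamma a" "0 < Gamma (1 - a)" using a by (auto intro: Gamma_real_pos)
  have "a \<notin> \<int>\<^sub>\<le>\<^sub>0" using a by (auto elim: nonpos_Ints_cases)
  then have "Gamma (1 + a) = a * Gamma a" using Gamma_plus1[of a] by (simp add: add.commute)
  then have "sin (pi * a) * Gamma (1 + a) / pi = a / Gamma (1 - a)"
    using refl sin Gp by (simp add: field_simps)
  then have "exponent_fun p K = 1 - a / Gamma (1 - a) * bm_integral a K"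
    unfolding e S_def using less_imp_neq[OF Gp(2)] a by (simp only: right_diff_distrib) simp
  then show ?thesis using less_imp_neq[OF Gp(2)] a unfolding a_def[symmetric] by auto
qed

section \<open>Signs of the integral at both ends of the range of a, and its root\<close>

text \<open>This quantity blows up as a tends to 1/2 and the one of
  \<open>pow_weight_upper_part\<close> as a tends to 0; the other one stays bounded. So behaviour
  near s = 0, respectively for large s, decides the sign at the two ends.\<close>

lemma pow_weight_lower_part:
  assumes "a < 1/2" "0 \<le> c"
  shows "has_bochner_integral lborel (\<lambda>s. pow_weight a s * (indicator {0..c} s * sqrt s))
    (c powr (1/2 - a) / (1/2 - a))"
proof -
  have "((\<lambda>s. s powr (-a - 1/2)) has_integral c powr (1/2 - a) / (1/2 - a)) {0..c}"
    using has_integral_powr_from_0[of "-a - 1/2" c] assms by (simp add: algebra_simps)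
  then have "(\<integral>\<^sup>+s. ennreal (indicator {0..c} s * s powr (-a - 1/2)) \<partial>lborel)
      = ennreal (c powr (1/2 - a) / (1/2 - a))"
    by (intro nn_integral_has_integral_lebesgue) auto
  moreover have "s powr (-a - 1) * sqrt s = s powr (-a - 1/2)" if "0 < s" for s
    using that by (simp add: powr_half_sqrt[symmetric] powr_add[symmetric] algebra_simps)
  then have "(\<integral>\<^sup>+s. ennreal (pow_weight a s * (indicator {0..c} s * sqrt s)) \<partial>lborel)
      = (\<integral>\<^sup>+s. ennreal (indicator {0..c} s * s powr (-a - 1/2)) \<partial>lborel)"
    by (intro nn_integral_cong) (auto simp: pow_weight_def indicator_def)
  ultimately show ?thesis using assms
    by (intro has_bochner_integral_nn_integral) (auto split: split_indicator simp: pow_weight_def)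
qed

lemma pow_weight_upper_part:
  assumes "0 < a" "0 < c"
  shows "has_bochner_integral lborel (\<lambda>s. pow_weight a s * indicator {c..} s) (c powr (- a) / a)"
proof -
  have "((\<lambda>s. s powr (-a - 1)) has_integral c powr (- a) / a) {c..}"
    using has_integral_powr_to_inf[of "-a - 1" c] assms by simp
  then have "(\<integral>\<^sup>+s. ennreal (indicator {c..} s * s powr (-a - 1)) \<partial>lborel) = ennreal (c powr (- a) / a)"
    by (intro nn_integral_has_integral_lebesgue) auto
  moreover have "(\<integral>\<^sup>+s. ennreal (pow_weight a s * indicator {c..} s) \<partial>lborel)
      = (\<integral>\<^sup>+s. ennreal (indicator {c..} s * s powr (-a - 1)) \<partial>lborel)"
    using assms by (intro nn_integral_cong) (auto simp: pow_weight_def indicator_def)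
  ultimately show ?thesis using assms
    by (intro has_bochner_integral_nn_integral) auto
qed

text \<open>For small a the mass at large s dominates, where the defect is close to 1.\<close>

lemma bm_integral_pos_near_0:
  assumes K: "0 < K"
  shows "eventually (\<lambda>a. 0 < bm_integral a K) (at_right 0)"
proof -
  obtain A where A: "\<And>s. 0 < s \<Longrightarrow> \<bar>bm_defect K s\<bar> \<le> A * min (sqrt s) 1"
    using bm_defect_bound[OF K] by blast
  have "0 \<le> A" using A[of 1] by (simp add: order_trans[OF abs_ge_zero])
  \<comment> \<open>For s at least 8 K^2 one has K sqrt(2s) \<le> s/2, so the defect is at least 1 -
    exp(-c/2).\<close>
  define c where "c = 8 * K\<^sup>2"
  define \<eta> where "\<eta> = 1 - exp (- c / 2)"
  have c: "0 < c" and \<eta>: "0 < \<eta>" using K by (auto simp: c_def \<eta>_def)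
  have low: "\<eta> * indicator {c..} s - A * (indicator {0..c} s * sqrt s) \<le> bm_defect K s"
    if s: "0 < s" for s
  proof (cases "c \<le> s")
    case True
    have "K * sqrt (2 * s) \<le> s / 2"
    proof -
      have "2 * K \<le> sqrt (s / 2)" using True K 
        by (intro real_le_rsqrt) (simp add: c_def power_mult_distrib)
      then have "2 * K * sqrt (2 * s) \<le> sqrt (s / 2) * sqrt (2 * s)" using s by (intro mult_right_mono) auto
      also have "\<dots> = s" using s by (simp flip: real_sqrt_mult)
      finally show ?thesis by simp
    qed
    then have "K * sqrt (2 * s) - s \<le> - c / 2" using True by linarith
    then have "\<eta> \<le> bm_defect K s" by (simp add: \<eta>_def bm_defect_def)
    moreover have "0 \<le> A * (indicator {0..c} s * sqrt s)" using \<open>0 \<le> A\<close> s by simp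
    moreover have "\<eta> * indicator {c..} s = \<eta>" using True by simp
    ultimately show ?thesis by linarith
  next
    case False
    have "\<bar>bm_defect K s\<bar> \<le> A * sqrt s"
      using A[OF s] \<open>0 \<le> A\<close> mult_left_mono[of "min (sqrt s) 1" "sqrt s" A] by simp
    then show ?thesis using False s by simp
  qed
  have bd: "\<eta> * (c powr (- a) / a) - A * (c powr (1/2 - a) / (1/2 - a)) \<le> bm_integral a K"
    if a: "0 < a" "a < 1/2" for a
  proof -
    note 1 = pow_weight_lower_part[of a c] and 2 = pow_weight_upper_part[of a c]
    have "has_bochner_integral lborel (\<lambda>s. \<eta> * (pow_weight a s * indicator {c..} s)
        - A * (pow_weight a s * (indicator {0..c} s * sqrt s)))
        (\<eta> * (c powr (- a) / a) - A * (c powr (1/2 - a) / (1/2 - a)))"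
      using 1 2 a c by (intro has_bochner_integral_diff has_bochner_integral_mult_right) auto
    moreover have "\<eta> * (pow_weight a s * indicator {c..} s)
        - A * (pow_weight a s * (indicator {0..c} s * sqrt s)) \<le> pow_weight a s * bm_defect K s" for s
    proof (cases "0 < s")
      case True
      from mult_left_mono[OF low[OF this], of "pow_weight a s"] show ?thesis by (simp add: algebra_simps)
    qed (simp add: pow_weight_def)
    ultimately show ?thesis using bm_integrable[OF a K] unfolding bm_integral_def
      by (auto simp only: has_bochner_integral_iff dest!: sym[where s="integral\<^sup>L _ _"] intro!: integral_mono)
  qed
  have "eventually (\<lambda>a. 0 < \<eta> * (c powr (- a) / a) - A * (c powr (1/2 - a) / (1/2 - a))) (at_right 0)"
    using c \<eta> by real_asymp
  moreover have "eventually (\<lambda>a::real. 0 < a \<and> a < 1/2) (at_right 0)"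
    using eventually_at_right_real[of 0 "1/2"] by simp
  ultimately show ?thesis
  proof eventually_elim
    case (elim a)
    then show ?case using bd[of a] by linarith
  qed
qed

text \<open>For a near 1/2 the mass at small s dominates, where the defect is about - K
  sqrt(2s).\<close>

lemma bm_integral_neg_near_half:
  assumes K: "0 < K"
  shows "eventually (\<lambda>a. bm_integral a K < 0) (at_left (1/2))"
proof -
  define c where "c = min (K\<^sup>2) 1 / 4"
  have c: "0 < c" "c \<le> K\<^sup>2 / 4" using K by (auto simp: c_def)
  \<comment> \<open>Below K^2/4 the term s is at most half of K sqrt s. The point c is excluded
    because both indicators are 1 there.\<close>
  have up: "bm_defect K s \<le> indicator {c..} s - K / 2 * (indicator {0..c} s * sqrt s)"
    if s: "0 < s" "s \<noteq> c" for s
  proof (cases "c < s")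
    case True
    then show ?thesis by (simp add: bm_defect_def)
  next
    case False
    have "sqrt s \<le> K / 2" using False s c K by (intro real_le_lsqrt) (auto simp: power_divide)
    then have "sqrt s * sqrt s \<le> K / 2 * sqrt s" using s by (intro mult_right_mono) auto
    then have "s \<le> K / 2 * sqrt s" using s by simp
    moreover have "K * sqrt s \<le> K * sqrt (2 * s)" using s K by simp
    moreover have "bm_defect K s \<le> - (K * sqrt (2 * s) - s)"
      unfolding bm_defect_def using exp_ge_add_one_self[of "K * sqrt (2 * s) - s"] by linarith
    ultimately have "bm_defect K s \<le> - (K / 2 * sqrt s)" by argo
    then show ?thesis using False s by simp
  qed
  have bd: "bm_integral a K \<le> c powr (- a) / a - K / 2 * (c powr (1/2 - a) / (1/2 - a))"
    if a: "0 < a" "a < 1/2" for a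
  proof -
    note 1 = pow_weight_lower_part[of a c] and 2 = pow_weight_upper_part[of a c]
    have "has_bochner_integral lborel (\<lambda>s. (pow_weight a s * indicator {c..} s)
        - K / 2 * (pow_weight a s * (indicator {0..c} s * sqrt s)))
        ((c powr (- a) / a) - K / 2 * (c powr (1/2 - a) / (1/2 - a)))"
      using 1 2 a c by (intro has_bochner_integral_diff has_bochner_integral_mult_right) auto
    moreover have "AE s in lborel. pow_weight a s * bm_defect K s \<le> (pow_weight a s * indicator {c..} s)
        - K / 2 * (pow_weight a s * (indicator {0..c} s * sqrt s))"
      using AE_lborel_singleton[of c]
    proof eventually_elim
      fix s assume "s \<noteq> c"
      then have "pow_weight a s * bm_defect K s \<le>
        pow_weight a s * (indicator {c..} s - K / 2 * (indicator {0..c} s * sqrt s))"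
      proof (cases "0 < s")
        case True
        with up[OF this \<open>s \<noteq> c\<close>] show ?thesis by (intro mult_left_mono) auto
      qed (simp add: pow_weight_def)
      then show "pow_weight a s * bm_defect K s \<le> (pow_weight a s * indicator {c..} s)
        - K / 2 * (pow_weight a s * (indicator {0..c} s * sqrt s))" by (simp add: algebra_simps)
    qed
    ultimately show ?thesis using bm_integrable[OF a K] unfolding bm_integral_def
      by (auto simp only: has_bochner_integral_iff dest!: sym[where s="integral\<^sup>L _ _"] intro!: integral_mono_AE)
  qed
  have "eventually (\<lambda>a. c powr (- a) / a - K / 2 * (c powr (1/2 - a) / (1/2 - a)) < 0) (at_left (1/2))"
    using c K by real_asymp
  moreover have "eventually (\<lambda>a::real. 0 < a \<and> a < 1/2) (at_left (1/2))"
    using eventually_at_left_real[of 0 "1/2"] by simp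
  ultimately show ?thesis
  proof eventually_elim
    case (elim a)
    then show ?case using bd[of a] by linarith
  qed
qed

text \<open>Dominated convergence: on [l, u] the weight is largest at u for s \<le> 1 and at l for s
  > 1, so the sum of the two end weights is a majorant.\<close>

lemma bm_integral_continuous:
  assumes l: "0 < l" "u < 1/2" and K: "0 < K"
  shows "continuous_on {l..u} (\<lambda>a. bm_integral a K)"
  unfolding continuous_on_sequentially
proof (intro allI ballI impI, elim conjE)
  fix x a assume a: "a \<in> {l..u}" and x: "\<forall>n. x n \<in> {l..u}" "x \<longlonglongrightarrow> a"
  have "(\<lambda>n. \<integral>s. pow_weight (x n) s * bm_defect K s \<partial>lborel) \<longlonglongrightarrow> (\<integral>s. pow_weight a s * bm_defect K s \<partial>lborel)"
  proof (rule integral_dominated_convergence)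
    have "l \<le> u" using a by simp
    then have "integrable lborel (\<lambda>s. \<bar>pow_weight l s * bm_defect K s\<bar> + \<bar>pow_weight u s * bm_defect K s\<bar>)"
      using l K by (intro Bochner_Integration.integrable_add integrable_abs bm_integrable) auto
    then show "integrable lborel (\<lambda>s. (pow_weight l s + pow_weight u s) * \<bar>bm_defect K s\<bar>)"
      by (simp add: abs_mult algebra_simps)
    show "AE s in lborel. (\<lambda>n. pow_weight (x n) s * bm_defect K s) \<longlonglongrightarrow> pow_weight a s * bm_defect K s"
    proof (rule AE_I2)
      fix s :: real
      show "(\<lambda>n. pow_weight (x n) s * bm_defect K s) \<longlonglongrightarrow> pow_weight a s * bm_defect K s"
      proof (cases "0 < s")
        case True
        then show ?thesis unfolding pow_weight_def using x(2) by (intro tendsto_intros) auto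
      qed (simp add: pow_weight_def)
    qed
    fix n
    show "AE s in lborel. norm (pow_weight (x n) s * bm_defect K s)
        \<le> (pow_weight l s + pow_weight u s) * \<bar>bm_defect K s\<bar>"
    proof (rule AE_I2)
      fix s :: real
      have b: "l \<le> x n" "x n \<le> u" using x(1) by auto
      have "pow_weight (x n) s \<le> pow_weight l s + pow_weight u s"
      proof (cases "0 < s")
        case True
        show ?thesis
        proof (cases "s \<le> 1")
          case True
          then have "pow_weight (x n) s \<le> pow_weight u s" using b \<open>0 < s\<close>
            by (auto simp: pow_weight_def intro!: powr_mono')
          then show ?thesis by (simp add: add_increasing)
        next
          case False
          then have "pow_weight (x n) s \<le> pow_weight l s" using b \<open>0 < s\<close>
            by (auto simp: pow_weight_def intro!: powr_mono)
          then show ?thesis by (simp add: add_increasing2)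
        qed
      qed (simp add: pow_weight_def)
      then show "norm (pow_weight (x n) s * bm_defect K s)
        \<le> (pow_weight l s + pow_weight u s) * \<bar>bm_defect K s\<bar>"
        by (simp add: abs_mult mult_right_mono)
    qed
  qed measurable
  then show "((\<lambda>a. bm_integral a K) \<circ> x) \<longlonglongrightarrow> bm_integral a K"
    by (simp add: o_def bm_integral_def)
qed

text \<open>Monotonicity is known only for the normalized integral, but its positive factor does not
  affect signs.\<close>

lemma bm_integral_sign_mono:
  assumes "0 < a" "a < b" "b < 1/2" "0 < K" "bm_integral b K = 0"
  shows "0 < bm_integral a K"
  using bm_integral_strict_decreasing[OF assms(1-4)] assms
  by (simp add: zero_less_mult_iff)

lemma bm_integral_root:
  assumes K: "0 < K"
  shows "\<exists>!p. 0 < p \<and> p < 1 \<and> bm_integral (p / 2) K = 0"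
proof -
  have "eventually (\<lambda>a. 0 < bm_integral a K \<and> 0 < a \<and> a < 1/4) (at_right (0::real))"
    using bm_integral_pos_near_0[OF K] eventually_at_right_real[of 0 "1/4"]
    by (simp add: eventually_conj_iff)
  then obtain l where l: "0 < bm_integral l K" "0 < l" "l < 1/4"
    by (auto dest!: eventually_happens)
  have "eventually (\<lambda>a. bm_integral a K < 0 \<and> 1/4 < a \<and> a < 1/2) (at_left (1/2::real))"
    using bm_integral_neg_near_half[OF K] eventually_at_left_real[of "1/4" "1/2"]
    by (simp add: eventually_conj_iff)
  then obtain u where u: "bm_integral u K < 0" "1/4 < u" "u < 1/2"
    by (auto dest!: eventually_happens)
  obtain a where a: "l \<le> a" "a \<le> u" "bm_integral a K = 0"
    using IVT2'[of "\<lambda>a. bm_integral a K" u 0 l] l u bm_integral_continuous[of l u K] K by force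
  show ?thesis
  proof (rule ex1I[of _ "2 * a"])
    show "0 < 2 * a \<and> 2 * a < 1 \<and> bm_integral (2 * a / 2) K = 0" using a l u by simp
    fix p assume p: "0 < p \<and> p < 1 \<and> bm_integral (p / 2) K = 0"
    show "p = 2 * a"
      using bm_integral_sign_mono[of "p / 2" a K] bm_integral_sign_mono[of a "p / 2" K] p a l u K
      by (cases "p / 2" a rule: linorder_cases) auto
  qed
qed

text \<open>These three facts are all that the probabilistic part uses about
  \<open>exponent\<close>.\<close>

lemma exponent_properties:
  assumes K: "0 < K"
  shows "0 < exponent K" "exponent K < 1"
    and "\<And>q. 0 < q \<Longrightarrow> q < exponent K \<Longrightarrow> 0 < bm_integral (q / 2) K"
proof -
  have "exponent K = (THE p. 0 < p \<and> p < 1 \<and> bm_integral (p / 2) K = 0)"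
    unfolding exponent_def using exponent_fun_eq_1_iff[OF _ _ K] by (intro arg_cong[where f=The] ext) auto
  with theI'[OF bm_integral_root[OF K]]
  have e: "0 < exponent K" "exponent K < 1" "bm_integral (exponent K / 2) K = 0" by auto
  show "0 < exponent K" "exponent K < 1" by fact+
  show "0 < bm_integral (q / 2) K" if "0 < q" "q < exponent K" for q
    using bm_integral_sign_mono[of "q / 2" "exponent K / 2" K] that e K by simp
qed

section \<open>A space-time harmonic function for simple random walk\<close>

lemma cosh_lower: "1 + u\<^sup>2 / 2 \<le> cosh (u::real)"
proof -
  have 1: "u\<^sup>2 / 4 \<le> (sinh (u / 2))\<^sup>2"
  proof -
    have "\<bar>u / 2\<bar> \<le> \<bar>sinh (u / 2)\<bar>" 
      using real_le_abs_sinh[of "u / 2"] by (simp add: sinh_field_def exp_minus)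
    then have "(u / 2)\<^sup>2 \<le> (sinh (u / 2))\<^sup>2" by (simp only: abs_le_square_iff)
    then show ?thesis by (simp add: power_divide)
  qed
  have "cosh u = cosh (2 * (u / 2))" by simp
  also have "\<dots> = 1 + 2 * (sinh (u / 2))\<^sup>2" by (simp only: cosh_double cosh_square_eq)
  finally show ?thesis using 1 by simp
qed

text \<open>Termwise comparison of power series through 2^n n! \<le> (2n)!.\<close>

lemma cosh_upper: "cosh (u::real) \<le> exp (u\<^sup>2 / 2)"
proof -
  have 1: "(\<lambda>n. if even n then u ^ n /\<^sub>R fact n else 0) sums cosh u" by (rule cosh_converges)
  have "(\<lambda>n. (\<lambda>n. if even n then u ^ n /\<^sub>R fact n else 0) (2 * n)) sums cosh u"
  proof (rule sums_mono_reindex[THEN iffD2, OF _ _ 1])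
    show "strict_mono (\<lambda>n::nat. 2 * n)" by (simp add: strict_mono_def)
    fix n :: nat assume "n \<notin> range (\<lambda>n. 2 * n)"
    then have "odd n" by (metis dvd_mult_div_cancel rangeI)
    then show "(if even n then u ^ n /\<^sub>R fact n else 0) = 0" by simp
  qed
  then have 1: "(\<lambda>n. u ^ (2 * n) / fact (2 * n)) sums cosh u" by (simp add: divide_inverse mult.commute)
  have 2: "(\<lambda>n. (u\<^sup>2 / 2) ^ n / fact n) sums exp (u\<^sup>2 / 2)"
    using exp_converges[of "u\<^sup>2 / 2"] by (simp only: real_scaleR_def divide_inverse mult.commute)
  show ?thesis
  proof (rule sums_le[OF _ 1 2])
    fix n
    have "2 ^ n * fact n \<le> (fact (2 * n) :: real)"
    proof (induction n)
      case (Suc n)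
      have "2 ^ Suc n * fact (Suc n) = (2 * (1 + real n)) * (2 ^ n * fact n)" by simp
      also have "\<dots> \<le> (2 * (1 + real n)) * fact (2 * n)" by (intro mult_left_mono Suc) auto
      also have "\<dots> \<le> (2 * (1 + real n)) * ((2 * real n + 1) * fact (2 * n))"
        using mult_right_mono[of 1 "2 * real n + 1" "fact (2 * n)"] by (intro mult_left_mono) auto
      also have "\<dots> = fact (2 * Suc n)" by (simp add: algebra_simps)
      finally show ?case .
    qed simp
    then have "u ^ (2 * n) / fact (2 * n) \<le> u ^ (2 * n) / (2 ^ n * fact n)"
      by (intro divide_left_mono) auto
    then show "u ^ (2 * n) / fact (2 * n) \<le> (u\<^sup>2 / 2) ^ n / fact n"
      by (simp add: power_divide power_mult)
  qed
qed

text \<open>A Gaussian lower bound must fail for large u, where cosh grows only exponentially; hence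
  the minimum.\<close>

lemma cosh_ge_exp_min:
  assumes "0 \<le> (u::real)"
  shows "exp (min u (u\<^sup>2) / 4) \<le> cosh u"
proof (cases "u \<le> 1")
  case True
  have "exp (u\<^sup>2 / 4) \<le> 1 + u\<^sup>2 / 4 + (u\<^sup>2 / 4)\<^sup>2" using True assms
    by (intro exp_bound) (auto simp: power_le_one_iff intro: order_trans[of _ 1])
  also have "\<dots> \<le> 1 + u\<^sup>2 / 2"
  proof -
    have "u\<^sup>2 \<le> 1" using True assms by (simp add: power_le_one_iff)
    then have "u\<^sup>2 * u\<^sup>2 \<le> u\<^sup>2" by (intro mult_left_le) auto
    moreover have "(u\<^sup>2 / 4)\<^sup>2 = u\<^sup>2 * u\<^sup>2 / 16" by (simp add: power2_eq_square)
    ultimately show ?thesis using zero_le_power2[of u] by linarith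
  qed
  also have "\<dots> \<le> cosh u" by (rule cosh_lower)
  finally have "exp (u\<^sup>2 / 4) \<le> cosh u" .
  moreover have "u\<^sup>2 \<le> u" using True assms by (simp add: power2_eq_square mult_left_le)
  ultimately show ?thesis by (simp add: min_absorb2)
next
  case False
  have "exp (u / 4) \<le> exp u / 2"
  proof -
    \<comment> \<open>This shows exp(3/4) \<ge> 2 by Bernoulli-type factors: 8 times 3/32 is
      3/4.\<close>
    have "2 \<le> (1 + 3/32 :: real) ^ 8" by (simp add: power_divide)
    also have "\<dots> \<le> exp (3/32) ^ 8" by (intro power_mono exp_ge_add_one_self) auto
    also have "\<dots> = exp (8 * (3/32))" by (simp flip: exp_of_nat_mult)
    also have "\<dots> \<le> exp (3 * u / 4)" using False by simp
    finally have "2 * exp (u / 4) \<le> exp (3 * u / 4) * exp (u / 4)" by simp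
    also have "\<dots> = exp u" by (simp flip: exp_add)
    finally show ?thesis by simp
  qed
  also have "\<dots> \<le> cosh u" by (simp add: cosh_field_def)
  finally have "exp (u / 4) \<le> cosh u" .
  moreover have "u \<le> u\<^sup>2" using False by (simp add: power2_eq_square)
  ultimately show ?thesis by (simp add: min_absorb1)
qed

text \<open>Averaging the exponential martingales \<open>exp (- u S\<^sub>n) / cosh u ^ n\<close> of simple random
  walk over \<open>u = sqrt (2 s)\<close> gives a space-time harmonic function.\<close>

definition rw_defect :: "nat \<Rightarrow> real \<Rightarrow> real \<Rightarrow> real" where
  "rw_defect n x s = 1 - exp (- (sqrt (2 * s) * x)) / cosh (sqrt (2 * s)) ^ n"

definition rw_harmonic :: "real \<Rightarrow> nat \<Rightarrow> real \<Rightarrow> real" where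
  "rw_harmonic a n x = (\<integral>s. pow_weight a s * rw_defect n x s \<partial>lborel)"

lemma cosh_measurable [measurable]: "(cosh :: real \<Rightarrow> real) \<in> borel_measurable borel"
  by (intro borel_measurable_continuous_onI continuous_intros)

lemma rw_defect_measurable [measurable]: "rw_defect n x \<in> borel_measurable borel"
  unfolding rw_defect_def by measurable

text \<open>At time n the walk is at -n or above, and there exp(-ux) \<le> exp(un) \<le> (2 cosh
  u)^n, so the defect stays bounded as s grows. Near 0 the exponent is of order sqrt s. The constant
  may depend on n and x here.\<close>

lemma rw_defect_bound:
  assumes "- real n \<le> x"
  obtains A where "\<And>s. 0 < s \<Longrightarrow> \<bar>rw_defect n x s\<bar> \<le> A * min (sqrt s) 1"
proof
  define C where "C = 2 * \<bar>x\<bar> + real n"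
  fix s :: real assume s: "0 < s"
  define u where "u = sqrt (2 * s)"
  have u: "0 < u" "u\<^sup>2 = 2 * s" using s by (auto simp: u_def)
  have sq2: "u \<le> 2 * sqrt s" 
    using s by (simp add: u_def real_sqrt_mult sqrt2_less_2 less_imp_le)
  show "\<bar>rw_defect n x s\<bar> \<le> (C * exp C + 2 ^ n + 1) * min (sqrt s) 1"
  proof (cases "s \<le> 1")
    case True
    define y where "y = - (u * x) - real n * ln (cosh u)"
    have y: "rw_defect n x s = 1 - exp y"
      by (simp add: rw_defect_def y_def exp_diff u_def[symmetric] exp_of_nat_mult)
    have "ln (cosh u) \<le> s" using cosh_upper[of u] by (simp add: u(2) ln_le_cancel_iff[symmetric] del: ln_le_cancel_iff)
    moreover have "0 \<le> ln (cosh u)" by (simp add: ln_ge_zero cosh_real_ge_1)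
    moreover have "s \<le> sqrt s" using True s by (simp add: real_le_rsqrt power2_eq_square mult_left_le)
    ultimately have "real n * ln (cosh u) \<le> real n * sqrt s" "0 \<le> real n * ln (cosh u)"
      by (auto intro: mult_left_mono)
    moreover have "\<bar>- (u * x)\<bar> \<le> 2 * sqrt s * \<bar>x\<bar>" using sq2 u by (simp add: abs_mult mult_right_mono)
    ultimately have *: "\<bar>y\<bar> \<le> C * sqrt s" unfolding y_def C_def by (simp add: algebra_simps abs_le_iff)
    have sq1: "sqrt s \<le> 1" using True by simp
    have "C * sqrt s \<le> C" using sq1 by (intro mult_left_le) (auto simp: C_def)
    then have "\<bar>rw_defect n x s\<bar> \<le> C * sqrt s * exp C"
      unfolding y using * s order_trans[OF *, of C]
      by (intro order_trans[OF abs_one_minus_exp_le] mult_mono) (auto simp: C_def)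
    also have "\<dots> \<le> (C * exp C + 2 ^ n + 1) * sqrt s" using s by (simp add: algebra_simps)
    finally show ?thesis using sq1 by (simp add: min_absorb1)
  next
    case False
    have "exp (- (u * x)) \<le> exp (u * real n)" using assms u mult_left_mono[of "-x" "real n" u] by simp
    also have "\<dots> = exp u ^ n" by (metis exp_of_nat_mult mult.commute)
    also have "\<dots> \<le> (2 * cosh u) ^ n" by (intro power_mono) (auto simp: cosh_field_def)
    finally have "exp (- (u * x)) / cosh u ^ n \<le> 2 ^ n"
      by (simp add: power_mult_distrib divide_le_eq)
    moreover have "0 \<le> exp (- (u * x)) / cosh u ^ n" by simp
    ultimately have "\<bar>rw_defect n x s\<bar> \<le> 2 ^ n + 1" unfolding rw_defect_def u_def[symmetric] by linarith
    moreover have "0 \<le> C * exp C" by (simp add: C_def)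
    moreover have "min (sqrt s) 1 = 1" using False by simp
    ultimately show ?thesis by simp
  qed
qed

lemma rw_integrable:
  assumes "0 < a" "a < 1/2" "- real n \<le> x"
  shows "integrable lborel (\<lambda>s. pow_weight a s * rw_defect n x s)"
proof -
  obtain A where "\<And>s. 0 < s \<Longrightarrow> \<bar>rw_defect n x s\<bar> \<le> A * min (sqrt s) 1"
    using rw_defect_bound[OF assms(3)] by blast
  then show ?thesis by (intro integrable_pow_weight assms) auto
qed

text \<open>The identity holds under the integral, since the two shifted exponentials add up to 2
  cosh u times the original. The lower bound on x is inherited by both neighbours at time n + 1, so
  all integrals exist.\<close>

lemma rw_harmonic_step:
  assumes "0 < a" "a < 1/2" "- real n \<le> x"
  shows "rw_harmonic a n x = (rw_harmonic a (Suc n) (x + 1) + rw_harmonic a (Suc n) (x - 1)) / 2"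
proof -
  have "rw_defect n x s = (rw_defect (Suc n) (x + 1) s + rw_defect (Suc n) (x - 1) s) / 2" for s
  proof -
    define u where "u = sqrt (2 * s)"
    have "exp (- (u * (x + 1))) = exp (- (u * x)) * exp (- u)"
      "exp (- (u * (x - 1))) = exp (- (u * x)) * exp u"
      unfolding exp_add[symmetric] by (simp_all add: algebra_simps)
    then have "exp (- (u * (x + 1))) + exp (- (u * (x - 1))) = 2 * cosh u * exp (- (u * x))"
      by (simp add: cosh_field_def algebra_simps)
    then have "exp (- (u * x)) / cosh u ^ n
        = (exp (- (u * (x + 1))) + exp (- (u * (x - 1)))) / (2 * cosh u ^ Suc n)"
      by simp
    then show ?thesis unfolding rw_defect_def u_def[symmetric]
      by (simp only: add_divide_distrib) (simp add: diff_divide_distrib)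
  qed
  then have "rw_harmonic a n x = (\<integral>s. (pow_weight a s * rw_defect (Suc n) (x + 1) s
      + pow_weight a s * rw_defect (Suc n) (x - 1) s) / 2 \<partial>lborel)"
    by (simp add: rw_harmonic_def algebra_simps add_divide_distrib)
  also have "\<dots> = (rw_harmonic a (Suc n) (x + 1) + rw_harmonic a (Suc n) (x - 1)) / 2"
    using rw_integrable[of a "Suc n" "x + 1"] rw_integrable[of a "Suc n" "x - 1"] assms
    by (simp add: rw_harmonic_def)
  finally show ?thesis .
qed

lemma rw_harmonic_mono:
  assumes "0 < a" "a < 1/2" "- real n \<le> x" "x \<le> y"
  shows "rw_harmonic a n x \<le> rw_harmonic a n y"
  unfolding rw_harmonic_def
proof (rule integral_mono)
  fix s :: real
  show "pow_weight a s * rw_defect n x s \<le> pow_weight a s * rw_defect n y s"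
  proof (cases "0 < s")
    case True
    then have "exp (- (sqrt (2 * s) * y)) \<le> exp (- (sqrt (2 * s) * x))" using assms by simp
    then have "rw_defect n x s \<le> rw_defect n y s"
      by (simp add: rw_defect_def divide_right_mono)
    then show ?thesis by (simp add: mult_left_mono)
  qed (simp add: pow_weight_def)
qed (use assms in \<open>auto intro!: rw_integrable\<close>)

text \<open>The substitution of s/n for s extracts n^a from the weight. What remains tends to the
  Brownian integral, because cosh(sqrt(2s/n))^n tends to exp(s).\<close>

lemma rw_harmonic_scaling:
  assumes n: "0 < n"
  shows "rw_harmonic a n (- (sqrt n * \<kappa>)) = real n powr a * (\<integral>s. pow_weight a s *
      (1 - exp (\<kappa> * sqrt (2 * s)) / cosh (sqrt (2 * s / real n)) ^ n) \<partial>lborel)"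
proof -
  have "rw_harmonic a n (- (sqrt n * \<kappa>)) = \<bar>1 / real n\<bar> *\<^sub>R (\<integral>s. pow_weight a (0 + 1 / real n * s)
      * rw_defect n (- (sqrt n * \<kappa>)) (0 + 1 / real n * s) \<partial>lborel)"
    unfolding rw_harmonic_def using n by (intro lborel_integral_real_affine) auto
  also have "\<dots> = (\<integral>s. real n powr a * (pow_weight a s *
      (1 - exp (\<kappa> * sqrt (2 * s)) / cosh (sqrt (2 * s / real n)) ^ n)) \<partial>lborel)"
  proof -
    have "1 / real n * (pow_weight a (s / real n) * rw_defect n (- (sqrt n * \<kappa>)) (s / real n))
      = real n powr a * (pow_weight a s *
      (1 - exp (\<kappa> * sqrt (2 * s)) / cosh (sqrt (2 * s / real n)) ^ n))" for s
    proof (cases "0 < s")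
      case True
      have "1 / real n * (s / real n) powr (- a - 1) = real n powr a * s powr (- a - 1)"
        using n True by (simp add: powr_divide powr_diff powr_minus field_simps)
      moreover have "rw_defect n (- (sqrt n * \<kappa>)) (s / real n)
        = 1 - exp (\<kappa> * sqrt (2 * s)) / cosh (sqrt (2 * s / real n)) ^ n"
        using n by (simp add: rw_defect_def real_sqrt_divide)
      ultimately show ?thesis using True n unfolding pow_weight_def by (simp flip: mult.assoc)
    qed (use n in \<open>simp add: pow_weight_def zero_less_divide_iff\<close>)
    then show ?thesis by (simp flip: integral_mult_right_zero) 
  qed
  finally show ?thesis by simp
qed

text \<open>A majorant uniform in n. For s > 1, \<open>cosh_ge_exp_min\<close> gives two regimes: if
  the minimum is u^2, n u^2 / 4 = v^2 / 4 and completing the square gives B^2; if it is u, n u / 4 =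
  sqrt n v / 4 absorbs B v, which is what the lower bound on n is for.\<close>

lemma rw_scaled_bound:
  assumes \<kappa>: "0 \<le> \<kappa>" "\<kappa> \<le> B" and n: "0 < n" "4 * B \<le> sqrt (real n)" and s: "0 < s"
  shows "\<bar>1 - exp (\<kappa> * sqrt (2 * s)) / cosh (sqrt (2 * s / real n)) ^ n\<bar>
    \<le> ((2 * B + 1) * exp (2 * B + 1) + exp (B\<^sup>2) + 1) * min (sqrt s) 1"
proof -
  define C where "C = 2 * B + 1"
  define u where "u = sqrt (2 * s / real n)"
  define v where "v = sqrt (2 * s)"
  define e where "e = exp (\<kappa> * v) / cosh u ^ n"
  have u: "0 < u" "u\<^sup>2 = 2 * s / real n" using s n by (auto simp: u_def)
  have v: "0 < v" "v\<^sup>2 = 2 * s" using s by (auto simp: v_def)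
  have uv: "u = v / sqrt (real n)" by (simp add: u_def v_def real_sqrt_divide)
  have sq2: "v \<le> 2 * sqrt s" 
    using s by (simp add: v_def real_sqrt_mult sqrt2_less_2 less_imp_le)
  have "\<bar>1 - e\<bar> \<le> (C * exp C + exp (B\<^sup>2) + 1) * min (sqrt s) 1"
  proof (cases "s \<le> 1")
    case True
    define y where "y = \<kappa> * v - real n * ln (cosh u)"
    have y: "e = exp y"
      by (simp add: e_def y_def exp_diff exp_of_nat_mult)
    have "ln (cosh u) \<le> u\<^sup>2 / 2" using cosh_upper[of u] by (simp add: ln_le_cancel_iff[symmetric] del: ln_le_cancel_iff)
    then have "real n * ln (cosh u) \<le> real n * (u\<^sup>2 / 2)" by (intro mult_left_mono) auto
    also have "\<dots> = s" using n by (simp add: u(2))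
    also have "s \<le> sqrt s" using True s by (simp add: real_le_rsqrt power2_eq_square mult_left_le)
    finally have 1: "real n * ln (cosh u) \<le> sqrt s" .
    have 2: "0 \<le> real n * ln (cosh u)" by (simp add: ln_ge_zero cosh_real_ge_1)
    have "\<kappa> * v \<le> B * (2 * sqrt s)" using sq2 v \<kappa> by (intro mult_mono) auto
    moreover have "0 \<le> \<kappa> * v" using \<kappa> v by simp
    ultimately have *: "\<bar>y\<bar> \<le> C * sqrt s" using 1 2 unfolding y_def C_def by (simp add: algebra_simps abs_le_iff)
    have sq1: "sqrt s \<le> 1" using True by simp
    have "C * sqrt s \<le> C" using sq1 \<kappa> by (intro mult_left_le) (auto simp: C_def)
    then have "\<bar>1 - e\<bar> \<le> C * sqrt s * exp C"
      unfolding y using * s order_trans[OF *, of C] \<kappa>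
      by (intro order_trans[OF abs_one_minus_exp_le] mult_mono) (auto simp: C_def)
    also have "\<dots> \<le> (C * exp C + exp (B\<^sup>2) + 1) * sqrt s" using s by (simp add: algebra_simps)
    finally show ?thesis using sq1 by (simp add: min_absorb1)
  next
    case False
    have "exp (real n * (min u (u\<^sup>2) / 4)) = exp (min u (u\<^sup>2) / 4) ^ n" by (rule exp_of_nat_mult)
    also have "\<dots> \<le> cosh u ^ n" using u by (intro power_mono cosh_ge_exp_min) auto
    finally have "e \<le> exp (\<kappa> * v) / exp (real n * (min u (u\<^sup>2) / 4))"
      unfolding e_def by (intro divide_left_mono) auto
    also have "\<dots> = exp (\<kappa> * v - real n * (min u (u\<^sup>2) / 4))" by (simp add: exp_diff)
    also have "\<dots> \<le> exp (B\<^sup>2)"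
    proof -
      have "\<kappa> * v \<le> B * v" using \<kappa> v by simp
      moreover have "B * v \<le> sqrt n / 4 * v" using n v by (intro mult_right_mono) auto
      moreover have "real n * u = sqrt n * v" using n by (simp add: uv field_simps)
      moreover have "real n * u\<^sup>2 = v\<^sup>2" using n by (simp add: u v)
      moreover have "B * v - v\<^sup>2 / 4 \<le> B\<^sup>2" by (rule square_completion)
      moreover have "0 \<le> B\<^sup>2" by simp
      ultimately have "\<kappa> * v - real n * (min u (u\<^sup>2) / 4) \<le> B\<^sup>2"
        by (cases "u \<le> u\<^sup>2"; simp only: min_def if_True if_False times_divide_eq_right)
      then show ?thesis by simp
    qed
    finally have "e \<le> exp (B\<^sup>2)" .
    moreover have "0 \<le> e" by (simp add: e_def)
    ultimately have "\<bar>1 - e\<bar> \<le> exp (B\<^sup>2) + 1" by linarith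
    moreover have "0 \<le> C * exp C" using \<kappa> by (simp add: C_def)
    moreover have "min (sqrt s) 1 = 1" using False by simp
    ultimately show ?thesis by simp
  qed
  then show ?thesis by (simp add: e_def C_def u_def v_def)
qed

lemma cosh_scaled_limit:
  assumes s: "0 < s"
  shows "(\<lambda>n. cosh (sqrt (2 * s / real n)) ^ n) \<longlonglongrightarrow> exp s"
proof (rule tendsto_sandwich)
  show "(\<lambda>n. (1 + s / real n) ^ n) \<longlonglongrightarrow> exp s" by (rule tendsto_exp_limit_sequentially)
  show "(\<lambda>n. exp s) \<longlonglongrightarrow> exp s" by simp
  have "eventually (\<lambda>n::nat. 0 < n) sequentially" by (rule eventually_gt_at_top)
  then show "\<forall>\<^sub>F n in sequentially. (1 + s / real n) ^ n \<le> cosh (sqrt (2 * s / real n)) ^ n"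
  proof eventually_elim
    case (elim n)
    then show ?case using s cosh_lower[of "sqrt (2 * s / real n)"] by (intro power_mono) auto
  qed
  have "eventually (\<lambda>n::nat. 0 < n) sequentially" by (rule eventually_gt_at_top)
  then show "\<forall>\<^sub>F n in sequentially. cosh (sqrt (2 * s / real n)) ^ n \<le> exp s"
  proof eventually_elim
    case (elim n)
    have "cosh (sqrt (2 * s / real n)) ^ n \<le> exp (s / real n) ^ n"
      using s elim cosh_upper[of "sqrt (2 * s / real n)"] by (intro power_mono) auto
    also have "\<dots> = exp s" using elim by (simp flip: exp_of_nat_mult)
    finally show ?case .
  qed
qed

text \<open>The allowance 2 instead of 1 covers positions just below the barrier. By monotonicity in
  x only the lowest point matters, and on it the scaling limit is the positive number
  \<open>bm_integral a K\<close>.\<close>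

lemma rw_harmonic_lower:
  assumes a: "0 < a" "a < 1/2" and K: "0 < K" and pos: "0 < bm_integral a K"
  obtains c n0 where "0 < c" "0 < n0"
    "\<And>n x. n0 \<le> n \<Longrightarrow> - K * sqrt (real n) - 2 \<le> x \<Longrightarrow> c * real n powr a \<le> rw_harmonic a n x"
    "\<And>n x. n0 \<le> n \<Longrightarrow> - K * sqrt (real n) - 2 \<le> x \<Longrightarrow> - real n \<le> x"
proof -
  define B where "B = K + 2"
  \<comment> \<open>The lowest point - K sqrt n - 2 is - sqrt n times this slope, which tends to K
    and is at most B once sqrt n \<ge> 1.\<close>
  define \<kappa> where "\<kappa> = (\<lambda>n. K + 2 / sqrt (real n))"
  define g where "g = (\<lambda>n s. 1 - exp (\<kappa> n * sqrt (2 * s)) / cosh (sqrt (2 * s / real n)) ^ n)"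
  have "filterlim (\<lambda>n. sqrt (real n)) at_top sequentially" by real_asymp
  then have "eventually (\<lambda>n. 4 * B \<le> sqrt (real n)) sequentially" by (simp add: filterlim_at_top)
  then obtain n1 where n1: "\<And>n. n1 \<le> n \<Longrightarrow> 4 * B \<le> sqrt (real n)"
    by (auto simp: eventually_sequentially)
  have n1': "1 \<le> sqrt (real n)" "0 < n" "0 \<le> \<kappa> n" "\<kappa> n \<le> B" if "n1 \<le> n" for n
  proof -
    have "1 \<le> 4 * B" using K by (simp add: B_def)
    then show 1: "1 \<le> sqrt (real n)" using n1[OF that] by (rule order_trans)
    then show "0 < n" by (cases "n = 0") auto
    show "0 \<le> \<kappa> n" using K by (simp add: \<kappa>_def)
    show "\<kappa> n \<le> B" using 1 by (simp add: \<kappa>_def B_def divide_le_eq)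
  qed
  \<comment> \<open>The sequence is shifted by \<open>n1\<close> because the majorant holds only
    from there on.\<close>
  have "(\<lambda>i. \<integral>s. pow_weight a s * g (i + n1) s \<partial>lborel) \<longlonglongrightarrow> (\<integral>s. pow_weight a s * bm_defect K s \<partial>lborel)"
  proof (rule integral_dominated_convergence)
    let ?A = "(2 * B + 1) * exp (2 * B + 1) + exp (B\<^sup>2) + 1"
    show "integrable lborel (\<lambda>s. ?A * (pow_weight a s * min (sqrt s) 1))"
      using integrable_pow_weight_dominating[OF a] by simp
    show "AE s in lborel. (\<lambda>i. pow_weight a s * g (i + n1) s) \<longlonglongrightarrow> pow_weight a s * bm_defect K s"
    proof (rule AE_I2)
      fix s :: real
      show "(\<lambda>i. pow_weight a s * g (i + n1) s) \<longlonglongrightarrow> pow_weight a s * bm_defect K s"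
      proof (cases "0 < s")
        case True
        have "(\<lambda>n. 2 / sqrt (real n)) \<longlonglongrightarrow> 0" by real_asymp
        then have "\<kappa> \<longlonglongrightarrow> K + 0" unfolding \<kappa>_def by (intro tendsto_intros)
        then have "(\<lambda>n. g n s) \<longlonglongrightarrow> 1 - exp ((K + 0) * sqrt (2 * s)) / exp s"
          unfolding g_def by (intro tendsto_intros cosh_scaled_limit True) auto
        then have "(\<lambda>n. g n s) \<longlonglongrightarrow> bm_defect K s" by (simp add: bm_defect_def exp_diff)
        then show ?thesis by (intro tendsto_intros) (rule LIMSEQ_ignore_initial_segment)
      qed (simp add: pow_weight_def)
    qed
    fix i
    show "AE s in lborel. norm (pow_weight a s * g (i + n1) s) \<le> ?A * (pow_weight a s * min (sqrt s) 1)"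
    proof (rule AE_I2)
      fix s :: real
      show "norm (pow_weight a s * g (i + n1) s) \<le> ?A * (pow_weight a s * min (sqrt s) 1)"
      proof (cases "0 < s")
        case True
        have "\<bar>g (i + n1) s\<bar> \<le> ?A * min (sqrt s) 1"
          unfolding g_def by (intro rw_scaled_bound n1' n1 True) auto
        then have "pow_weight a s * \<bar>g (i + n1) s\<bar> \<le> pow_weight a s * (?A * min (sqrt s) 1)"
          by (intro mult_left_mono) auto
        then show ?thesis by (simp only: real_norm_def abs_mult) (simp add: mult_ac)
      qed (simp add: pow_weight_def)
    qed
  next
    show "(\<lambda>s. pow_weight a s * g (i + n1) s) \<in> borel_measurable lborel" for i
      unfolding g_def by measurable
  qed measurable
  then have "(\<lambda>n. \<integral>s. pow_weight a s * g n s \<partial>lborel) \<longlonglongrightarrow> bm_integral a K"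
    unfolding bm_integral_def by (rule LIMSEQ_offset)
  moreover have "bm_integral a K / 2 < bm_integral a K" using pos by simp
  ultimately have "eventually (\<lambda>n. bm_integral a K / 2 < (\<integral>s. pow_weight a s * g n s \<partial>lborel)) sequentially"
    by (rule order_tendstoD)
  moreover have "eventually (\<lambda>n. K * sqrt (real n) + 2 \<le> real n) sequentially"
    using K by real_asymp
  moreover have "eventually (\<lambda>n. n1 + 1 \<le> n) sequentially" by (rule eventually_ge_at_top)
  ultimately have "eventually (\<lambda>n. bm_integral a K / 2 < (\<integral>s. pow_weight a s * g n s \<partial>lborel)
      \<and> K * sqrt (real n) + 2 \<le> real n \<and> n1 + 1 \<le> n) sequentially"
    by eventually_elim auto
  then obtain n0 where n0: "\<And>n. n0 \<le> n \<Longrightarrow> bm_integral a K / 2 < (\<integral>s. pow_weight a s * g n s \<partial>lborel)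
      \<and> K * sqrt (real n) + 2 \<le> real n \<and> n1 + 1 \<le> n"
    by (auto simp: eventually_sequentially)
  show ?thesis
  proof (rule that[of "bm_integral a K / 2" n0])
    show "0 < bm_integral a K / 2" using pos by simp
    show "0 < n0" using n0[of n0] by auto
    fix n and x :: real assume n: "n0 \<le> n" and x: "- K * sqrt (real n) - 2 \<le> x"
    note n0 = n0[OF n]
    show "- real n \<le> x" using n0 x by linarith
    have "0 < n" using n0 by simp
    then have e: "- (sqrt n * \<kappa> n) = - K * sqrt (real n) - 2"
      by (simp add: \<kappa>_def field_simps)
    have "bm_integral a K / 2 * real n powr a \<le> real n powr a * (\<integral>s. pow_weight a s * g n s \<partial>lborel)"
      using n0 by (simp add: mult.commute mult_left_mono)
    also have "\<dots> = rw_harmonic a n (- K * sqrt (real n) - 2)"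
      unfolding g_def rw_harmonic_scaling[OF \<open>0 < n\<close>, symmetric] e ..
    also have "\<dots> \<le> rw_harmonic a n x" using n0 x by (intro rw_harmonic_mono a) auto
    finally show "bm_integral a K / 2 * real n powr a \<le> rw_harmonic a n x" .
  qed
qed

section \<open>Survival of a slightly drifted walk\<close>

text \<open>Hoelder with exponents m and 1/r. The factor from 1 + \<delta> and 1 - \<delta> is the
  m-th root of the mean of their m-th powers, and that mean is at most cosh(m \<delta>): averaging
  cancels the first order in \<delta>.\<close>

lemma two_point_Hoelder:
  fixes A B :: real and m :: nat
  assumes AB: "0 \<le> A" "0 \<le> B" and \<delta>: "0 \<le> \<delta>" "\<delta> \<le> 1" and m: "2 \<le> m"
  defines "r \<equiv> 1 - 1 / real m"
  shows "((1 + \<delta>) * A powr r + (1 - \<delta>) * B powr r) / 2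
    \<le> ((A + B) / 2) powr r * exp (real m * \<delta>\<^sup>2 / 2)"
proof (cases "A + B = 0")
  case True
  then have "A = 0" "B = 0" using AB by auto
  then show ?thesis by simp
next
  case False
  define S where "S = (A + B) / 2"
  define E where "E = exp ((real m * \<delta>)\<^sup>2 / 2)"
  have S: "0 < S" using False AB by (simp add: S_def)
  have E: "0 < E" by (simp add: E_def)
  have Er: "E powr (1 / real m) = exp (real m * \<delta>\<^sup>2 / 2)"
    using m by (simp add: E_def powr_def power2_eq_square)
  \<comment> \<open>Young's inequality, normalized by S and E. Averaged over the two points its
    right-hand sides give at most r + 1/m = 1.\<close>
  have young: "c * D powr r \<le> S powr r * E powr (1 / real m) * (r * (D / S) + c ^ m / (real m * E))"
    if cD: "0 \<le> c" "0 \<le> D" for c D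
  proof (cases "c = 0 \<or> D = 0")
    case True
    then have "c * D powr r = 0" by auto
    moreover have "0 \<le> r * (D / S) + c ^ m / (real m * E)"
      using cD S E m by (simp add: r_def)
    then have "0 \<le> S powr r * E powr (1 / real m) * (r * (D / S) + c ^ m / (real m * E))"
      by (intro mult_nonneg_nonneg) auto
    ultimately show ?thesis by linarith
  next
    case False
    then have c: "0 < c" "0 < D" using cD by auto
    have "(D / S) powr r * (c ^ m / E) powr (1 / real m) \<le> r * (D / S) + 1 / real m * (c ^ m / E)"
      using c S E m by (intro Youngs_inequality_0) (auto simp: r_def)
    moreover have "(c ^ m) powr (1 / real m) = c"
      using c m by (simp add: powr_powr flip: powr_realpow)
    then have "(D / S) powr r * (c ^ m / E) powr (1 / real m)
        = c * D powr r / (S powr r * E powr (1 / real m))"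
      using c S E by (simp add: powr_divide)
    ultimately have "c * D powr r / (S powr r * E powr (1 / real m)) \<le> r * (D / S) + c ^ m / (real m * E)"
      by simp
    then show ?thesis using S E by (subst (asm) pos_divide_le_eq) (auto simp: mult_ac)
  qed
  have avg: "((1 + \<delta>) ^ m + (1 - \<delta>) ^ m) / 2 \<le> E"
  proof -
    have "(1 + \<delta>) ^ m \<le> exp \<delta> ^ m" using \<delta> by (intro power_mono) auto
    moreover have "(1 - \<delta>) ^ m \<le> exp (- \<delta>) ^ m"
      using \<delta> exp_ge_add_one_self[of "- \<delta>"] by (intro power_mono) auto
    moreover have "(exp \<delta> ^ m + exp (- \<delta>) ^ m) / 2 = cosh (real m * \<delta>)"
      by (simp add: cosh_field_def flip: exp_of_nat_mult)
    moreover have "cosh (real m * \<delta>) \<le> E" unfolding E_def by (rule cosh_upper)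
    ultimately show ?thesis by (smt (verit) divide_right_mono)
  qed
  have "((1 + \<delta>) * A powr r + (1 - \<delta>) * B powr r) / 2
    \<le> (S powr r * E powr (1 / real m) * (r * (A / S) + (1 + \<delta>) ^ m / (real m * E))
      + S powr r * E powr (1 / real m) * (r * (B / S) + (1 - \<delta>) ^ m / (real m * E))) / 2"
    using AB \<delta> by (intro divide_right_mono add_mono young) auto
  also have "\<dots> = S powr r * E powr (1 / real m) * (r * ((A + B) / 2 / S)
      + ((1 + \<delta>) ^ m + (1 - \<delta>) ^ m) / 2 / (real m * E))"
    by (simp add: add_divide_distrib distrib_left)
  also have "\<dots> \<le> S powr r * E powr (1 / real m) * 1"
  proof (intro mult_left_mono)
    have "((1 + \<delta>) ^ m + (1 - \<delta>) ^ m) / 2 / (real m * E) \<le> E / (real m * E)"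
      using avg E m by (intro divide_right_mono) auto
    also have "\<dots> = 1 / real m" using E by simp
    finally show "r * ((A + B) / 2 / S) + ((1 + \<delta>) ^ m + (1 - \<delta>) ^ m) / 2 / (real m * E) \<le> 1"
      using S unfolding S_def[symmetric] r_def by simp
  qed simp
  finally show ?thesis by (simp add: S_def Er)
qed

text \<open>\<open>u n x\<close> stands for the probability that a walk at x at time n, stepping up
  with probability (1 + \<delta>)/2, respects the barrier up to N. An inequality on the sites
  reachable from the origin is enough, and this is what averages over a finite box of sites
  satisfy.\<close>

definition drifted_survival :: "real \<Rightarrow> real \<Rightarrow> nat \<Rightarrow> (nat \<Rightarrow> int \<Rightarrow> real) \<Rightarrow> bool" where
  "drifted_survival K \<delta> N u \<longleftrightarrow>
    (\<forall>n x. 0 \<le> u n x \<and> u n x \<le> 1 \<and> (real_of_int x < - 1 - K * sqrt (real n) \<longrightarrow> u n x = 0)) \<and>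
    (\<forall>n x. n < N \<longrightarrow> \<bar>x\<bar> \<le> int n \<longrightarrow> even (x + int n) \<longrightarrow>
      u n x \<le> ((1 + \<delta>) * u (Suc n) (x + 1) + (1 - \<delta>) * u (Suc n) (x - 1)) / 2)"

text \<open>Backward induction from time N, where the normalization makes the comparison function at
  least 1 above the barrier. The harmonic function is read at time n + n0 so that its lower bound is
  available from time 0 on; the region above the barrier only grows with this shift.\<close>

lemma drifted_survival_harmonic_bound:
  fixes m :: nat
  assumes surv: "drifted_survival K \<delta> N u" and K: "0 < K"
    and a: "0 < a" "a < 1/2" and c: "0 < c"
    and low: "\<And>n x. n0 \<le> n \<Longrightarrow> - K * sqrt (real n) - 2 \<le> x \<Longrightarrow> c * real n powr a \<le> rw_harmonic a n x"
      "\<And>n x. n0 \<le> n \<Longrightarrow> - K * sqrt (real n) - 2 \<le> x \<Longrightarrow> - real n \<le> x"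
    and n0: "0 < n0" and \<delta>: "0 \<le> \<delta>" "\<delta> \<le> 1" and m: "2 \<le> m"
  defines "r \<equiv> 1 - 1 / real m"
  shows "n \<le> N \<Longrightarrow> \<bar>x\<bar> \<le> int n \<Longrightarrow> even (x + int n) \<Longrightarrow> - K * sqrt (real n) - 2 \<le> real_of_int x \<Longrightarrow>
    u n x \<le> (rw_harmonic a (n + n0) x / (c * real (N + n0) powr a)) powr r
      * exp (real m * \<delta>\<^sup>2 / 2) ^ (N - n)"
proof (induction "N - n" arbitrary: n x)
  case 0
  then have n: "n = N" by simp
  show ?case
  proof (cases "real_of_int x < - 1 - K * sqrt (real n)")
    case True
    then have "u n x = 0" using surv by (simp add: drifted_survival_def)
    then show ?thesis by simp
  next
    case False
    have "K * sqrt (real n) \<le> K * sqrt (real (n + n0))" using K by simp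
    then have "c * real (N + n0) powr a \<le> rw_harmonic a (n + n0) x"
      using False unfolding n by (intro low) auto
    moreover have "0 < c * real (N + n0) powr a" using c n0 by simp
    ultimately have "1 \<le> rw_harmonic a (n + n0) x / (c * real (N + n0) powr a)" by simp
    then have "1 powr r \<le> (rw_harmonic a (n + n0) x / (c * real (N + n0) powr a)) powr r"
      using m by (intro powr_mono2) (auto simp: r_def)
    moreover have "u n x \<le> 1" using surv by (simp add: drifted_survival_def)
    ultimately show ?thesis by (simp add: n)
  qed
next
  case (Suc d)
  then have n: "n < N" "d = N - Suc n" by auto
  define h where "h = (\<lambda>n x. rw_harmonic a (n + n0) x / (c * real (N + n0) powr a))"
  define e where "e = exp (real m * \<delta>\<^sup>2 / 2)"
  have h0: "0 \<le> h n x" if "- K * sqrt (real n) - 2 \<le> x" for n x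
  proof -
    have "K * sqrt (real n) \<le> K * sqrt (real (n + n0))" using K by simp
    then have "c * real (n + n0) powr a \<le> rw_harmonic a (n + n0) x" using that by (intro low) auto
    moreover have "0 \<le> c * real (n + n0) powr a" using c by simp
    ultimately have "0 \<le> rw_harmonic a (n + n0) x" by linarith
    then show ?thesis unfolding h_def using c by (intro divide_nonneg_nonneg) auto
  qed
  show ?case
  proof (cases "real_of_int x < - 1 - K * sqrt (real n)")
    case True
    then have "u n x = 0" using surv by (simp add: drifted_survival_def)
    then show ?thesis by simp
  next
    case False
    have mono: "K * sqrt (real n) \<le> K * sqrt (real (Suc n))" using K by simp
    \<comment> \<open>From a point above the barrier one step goes at most one unit below it, so
      both neighbours remain where the harmonic function is nonnegative.\<close>
    have nb: "- K * sqrt (real (Suc n)) - 2 \<le> real_of_int (x + 1)"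
       "- K * sqrt (real (Suc n)) - 2 \<le> real_of_int (x - 1)" using False mono by simp_all
    have ih: "u (Suc n) y \<le> h (Suc n) (real_of_int y) powr r * e ^ d"
      if "\<bar>y\<bar> \<le> int (Suc n)" "even (y + int (Suc n))" "- K * sqrt (real (Suc n)) - 2 \<le> real_of_int y" for y
      unfolding h_def e_def by (subst n(2), rule Suc.hyps(1)[OF n(2) _ that]) (use n in simp)
    have ih: "u (Suc n) (x + 1) \<le> h (Suc n) (real_of_int (x + 1)) powr r * e ^ d"
      "u (Suc n) (x - 1) \<le> h (Suc n) (real_of_int (x - 1)) powr r * e ^ d"
      using Suc.prems nb by (auto intro!: ih simp del: of_int_add of_int_diff of_nat_Suc)
    have "u n x \<le> ((1 + \<delta>) * u (Suc n) (x + 1) + (1 - \<delta>) * u (Suc n) (x - 1)) / 2"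
      using surv n Suc.prems by (simp add: drifted_survival_def)
    also have "\<dots> \<le> ((1 + \<delta>) * (h (Suc n) (real_of_int (x + 1)) powr r * e ^ d)
        + (1 - \<delta>) * (h (Suc n) (real_of_int (x - 1)) powr r * e ^ d)) / 2"
      using ih \<delta> by (intro divide_right_mono add_mono mult_left_mono) auto
    also have "\<dots> = ((1 + \<delta>) * h (Suc n) (real_of_int (x + 1)) powr r
        + (1 - \<delta>) * h (Suc n) (real_of_int (x - 1)) powr r) / 2 * e ^ d"
      by (simp add: algebra_simps)
    also have "\<dots> \<le> ((h (Suc n) (real_of_int (x + 1)) + h (Suc n) (real_of_int (x - 1))) / 2) powr r
        * exp (real m * \<delta>\<^sup>2 / 2) * e ^ d"
      unfolding r_def using h0 nb \<delta> m by (intro mult_right_mono two_point_Hoelder) (auto simp: e_def)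
    also have "(h (Suc n) (real_of_int (x + 1)) + h (Suc n) (real_of_int (x - 1))) / 2 = h n x"
    proof -
      have "K * sqrt (real n) \<le> K * sqrt (real (n + n0))" using K by simp
      then have "- real (n + n0) \<le> real_of_int x" using Suc.prems by (intro low) auto
      from rw_harmonic_step[OF a this] show ?thesis by (simp add: h_def add_divide_distrib)
    qed
    finally show ?thesis using n unfolding h_def e_def
      by (simp add: mult.assoc Suc_diff_Suc flip: power_Suc)
  qed
qed

text \<open>With 4^i steps and drift at most 2^(-i) the accumulated Hoelder factor is at most
  exp(m/2), and (4^i)^(-ar) = 2^(-q'ri) for a = q'/2.\<close>

lemma drifted_survival_decay:
  assumes K: "0 < K" and q: "0 < q" "q < exponent K"
  obtains C where "0 \<le> C"
    "\<And>i \<delta> u. drifted_survival K \<delta> (4 ^ i) u \<Longrightarrow> 0 \<le> \<delta> \<Longrightarrow> \<delta> \<le> 1 / 2 ^ i \<Longrightarrow>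
      u 0 0 \<le> C * 2 powr (- q * real i)"
proof -
  \<comment> \<open>The room between q and q' pays for the loss from q' to q' r.\<close>
  define q' where "q' = (q + exponent K) / 2"
  have q': "q < q'" "q' < exponent K" "q' < 1" using q exponent_properties[OF K] by (auto simp: q'_def)
  define a where "a = q' / 2"
  have a: "0 < a" "a < 1/2" using q q' by (auto simp: a_def)
  have pos: "0 < bm_integral a K"
    unfolding a_def using q q' by (intro exponent_properties(3)[OF K]) auto
  obtain c n0 where c: "0 < c" "0 < n0"
    and low: "\<And>n x. n0 \<le> n \<Longrightarrow> - K * sqrt (real n) - 2 \<le> x \<Longrightarrow> c * real n powr a \<le> rw_harmonic a n x"
      "\<And>n x. n0 \<le> n \<Longrightarrow> - K * sqrt (real n) - 2 \<le> x \<Longrightarrow> - real n \<le> x"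
    using rw_harmonic_lower[OF a K pos] by blast
  \<comment> \<open>This size of m is equivalent to q < q' (1 - 1/m).\<close>
  obtain m0 :: nat where "q' / (q' - q) < real m0" using reals_Archimedean2 by blast
  define m where "m = m0 + 2"
  have m: "2 \<le> m" by (simp add: m_def)
  define r where "r = 1 - 1 / real m"
  have r: "0 < r" using m by (simp add: r_def)
  have "q' / (q' - q) < real m" using \<open>_ < real m0\<close> by (simp add: m_def)
  then have qr: "q \<le> q' * r" using q' m by (simp add: r_def field_simps)
  define H where "H = rw_harmonic a n0 0"
  have H: "0 \<le> H"
  proof -
    have "0 \<le> K * sqrt (real n0)" using K by simp
    then have "c * real n0 powr a \<le> H" unfolding H_def by (intro low) auto
    then show ?thesis using c by (meson order_trans less_imp_le mult_nonneg_nonneg powr_ge_zero)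
  qed
  show ?thesis
  proof (rule that[of "(H / c) powr r * exp (real m / 2)"])
    fix i :: nat and \<delta> u
    assume u: "drifted_survival K \<delta> (4 ^ i) u" and \<delta>: "0 \<le> \<delta>" "\<delta> \<le> 1 / 2 ^ i"
    define N :: nat where "N = 4 ^ i"
    have "\<delta> \<le> 1" using \<delta>(2) by (rule order_trans) simp
    have "u 0 0 \<le> (H / (c * real (N + n0) powr a)) powr r * exp (real m * \<delta>\<^sup>2 / 2) ^ N"
      using drifted_survival_harmonic_bound[OF u K a c(1) low c(2) \<delta>(1) \<open>\<delta> \<le> 1\<close> m, of 0 0]
      by (simp add: H_def r_def N_def)
    also have "\<dots> \<le> (H / (c * real N powr a)) powr r * exp (real m / 2)"
    proof (intro mult_mono)
      have "real N powr a \<le> real (N + n0) powr a" using a by (intro powr_mono2) auto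
      then have "H / (c * real (N + n0) powr a) \<le> H / (c * real N powr a)"
        using c H by (intro divide_left_mono mult_left_mono mult_pos_pos) (auto simp: N_def)
      then show "(H / (c * real (N + n0) powr a)) powr r \<le> (H / (c * real N powr a)) powr r"
        using r H c by (intro powr_mono2) auto
      have "\<delta>\<^sup>2 \<le> (1 / 2 ^ i)\<^sup>2" using \<delta> by (intro power_mono)
      also have "\<dots> = 1 / real N" by (simp add: N_def power_divide power2_eq_square flip: power_mult_distrib)
      finally have "real N * \<delta>\<^sup>2 \<le> 1" by (simp add: N_def field_simps)
      then have "real m * (real N * \<delta>\<^sup>2) \<le> real m * 1" by (intro mult_left_mono) auto
      then show "exp (real m * \<delta>\<^sup>2 / 2) ^ N \<le> exp (real m / 2)"
        by (simp add: mult_ac flip: exp_of_nat_mult)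
    qed auto
    also have "(H / (c * real N powr a)) powr r = (H / c) powr r * real N powr (- a * r)"
    proof -
      have "H / (c * real N powr a) = H / c * real N powr (- a)" by (simp add: powr_minus divide_inverse)
      then show ?thesis using H c by (simp only: powr_mult powr_powr)
    qed
    also have "real N powr (- a * r) = 2 powr (- (q' * r) * real i)"
    proof -
      have "real N = 2 powr (2 * real i)" by (simp add: N_def powr_mult powr_realpow powr_powr[symmetric])
      then show ?thesis by (simp add: powr_powr a_def algebra_simps)
    qed
    also have "(H / c) powr r * 2 powr (- (q' * r) * real i) * exp (real m / 2)
        \<le> (H / c) powr r * 2 powr (- q * real i) * exp (real m / 2)"
      using qr by (intro mult_right_mono mult_left_mono powr_mono) (auto intro: mult_right_mono)
    finally show "u 0 0 \<le> (H / c) powr r * exp (real m / 2) * 2 powr (- q * real i)"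
      by (simp add: mult_ac)
  qed simp
qed

section \<open>Fields of arrows with undecided sites\<close>

type_synonym site = "int \<times> int"

definition trits :: "int set" where "trits = {-1, 0, 1}"

text \<open>Expectation of a function of a field whose values at the listed sites are independent
  with weights \<open>w\<close> on \<open>{-1, 0, 1}\<close>; the field vanishes elsewhere.\<close>

primrec field_avg :: "(int \<Rightarrow> real) \<Rightarrow> site list \<Rightarrow> ((site \<Rightarrow> int) \<Rightarrow> real) \<Rightarrow> real" where
  "field_avg w [] f = f (\<lambda>_. 0)"
| "field_avg w (z # zs) f = (\<Sum>v\<in>trits. w v * field_avg w zs (\<lambda>y. f (y(z := v))))"

locale trit_weights =
  fixes w :: "int \<Rightarrow> real"
  assumes nonneg: "\<And>v. 0 \<le> w v" and sum_1: "(\<Sum>v\<in>trits. w v) = 1"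
begin

lemma field_avg_mono: "(\<And>y. f y \<le> g y) \<Longrightarrow> field_avg w zs f \<le> field_avg w zs g"
  by (induction zs arbitrary: f g) (auto intro!: sum_mono mult_left_mono nonneg)

lemma field_avg_const: "field_avg w zs (\<lambda>_. c) = c"
  by (induction zs) (simp_all add: sum_1 flip: sum_distrib_right)

lemma field_avg_bounds:
  assumes "\<And>y. 0 \<le> f y" "\<And>y. f y \<le> 1"
  shows "0 \<le> field_avg w zs f" "field_avg w zs f \<le> 1"
  using field_avg_mono[of "\<lambda>_. 0" f zs] field_avg_mono[of f "\<lambda>_. 1" zs] assms
  by (simp_all add: field_avg_const)

text \<open>Any listed site may be averaged first. The head of the list overrides later occurrences,
  so repetitions do no harm.\<close>

lemma field_avg_resample:
  "z \<in> set zs \<Longrightarrow> field_avg w zs f = (\<Sum>v\<in>trits. w v * field_avg w zs (\<lambda>y. f (y(z := v))))"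
proof (induction zs arbitrary: f)
  case (Cons x zs)
  show ?case
  proof (cases "x = z")
    case True
    have e: "field_avg w (x # zs) (\<lambda>y. f (y(z := v))) = field_avg w zs (\<lambda>y. f (y(z := v)))" for v
      unfolding True field_avg.simps fun_upd_upd sum_distrib_right[symmetric] sum_1 by simp
    show ?thesis unfolding e by (simp only: True field_avg.simps)
  next
    case False
    then have IH: "field_avg w zs (\<lambda>y. f (y(x := v)))
        = (\<Sum>v'\<in>trits. w v' * field_avg w zs (\<lambda>y. f (y(z := v', x := v))))" for v
      using Cons.prems by (intro Cons.IH) auto
    have "field_avg w (x # zs) f
        = (\<Sum>v\<in>trits. w v * (\<Sum>v'\<in>trits. w v' * field_avg w zs (\<lambda>y. f (y(z := v', x := v)))))"
      by (simp only: field_avg.simps IH)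
    also have "\<dots> = (\<Sum>v'\<in>trits. w v' * (\<Sum>v\<in>trits. w v * field_avg w zs (\<lambda>y. f (y(z := v', x := v)))))"
      unfolding sum_distrib_left by (subst sum.swap) (simp add: mult_ac)
    finally have "field_avg w (x # zs) f = \<dots>" .
    moreover have "y(z := v', x := v) = y(x := v, z := v')" for y :: "site \<Rightarrow> int" and v v'
      using False by (rule fun_upd_twist[symmetric])
    ultimately show ?thesis by (simp only: field_avg.simps)
  qed
qed simp

text \<open>The difference is the sum over pairs of values of the product of their weights with the
  increments of a and b, which have opposite signs.\<close>

lemma Chebyshev_three:
  fixes a b :: "int \<Rightarrow> real"
  assumes "a (-1) \<le> a 0" "a 0 \<le> a 1" "b 0 \<le> b (-1)" "b 1 \<le> b 0"
  shows "(\<Sum>v\<in>trits. w v * (a v * b v)) \<le> (\<Sum>v\<in>trits. w v * a v) * (\<Sum>v\<in>trits. w v * b v)"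
proof -
  have "(\<Sum>v\<in>trits. w v * a v) * (\<Sum>v\<in>trits. w v * b v) - (\<Sum>v\<in>trits. w v) * (\<Sum>v\<in>trits. w v * (a v * b v))
    = w (-1) * w 0 * ((a 0 - a (-1)) * (b (-1) - b 0)) + w 0 * w 1 * ((a 1 - a 0) * (b 0 - b 1))
      + w (-1) * w 1 * ((a 1 - a (-1)) * (b (-1) - b 1))"
    by (simp add: trits_def algebra_simps)
  also have "\<dots> \<ge> 0"
    using assms nonneg by (intro add_nonneg_nonneg mult_nonneg_nonneg) auto
  finally show ?thesis by (simp add: sum_1)
qed

lemma Harris:
  "mono f \<Longrightarrow> antimono g \<Longrightarrow>
    field_avg w zs (\<lambda>y. f y * g y) \<le> field_avg w zs f * field_avg w zs g"
proof (induction zs arbitrary: f g)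
  case (Cons z zs)
  let ?f = "\<lambda>v. field_avg w zs (\<lambda>y. f (y(z := v)))" and ?g = "\<lambda>v. field_avg w zs (\<lambda>y. g (y(z := v)))"
  have mono: "mono (\<lambda>y. f (y(z := v)))" "antimono (\<lambda>y. g (y(z := v)))" for v
  proof -
    have "y(z := v) \<le> y'(z := v)" if "y \<le> y'" for y y' :: "site \<Rightarrow> int"
      using that by (simp add: le_fun_def)
    then show "mono (\<lambda>y. f (y(z := v)))" "antimono (\<lambda>y. g (y(z := v)))"
      using Cons.prems by (simp_all add: mono_def antimono_def)
  qed
  \<comment> \<open>The induction hypothesis applies for each fixed value at z; the resulting
    averages are monotone in that value in opposite senses, so the one-site inequality
    finishes.\<close>
  have "field_avg w (z # zs) (\<lambda>y. f y * g y) \<le> (\<Sum>v\<in>trits. w v * (?f v * ?g v))"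
    unfolding field_avg.simps by (intro sum_mono mult_left_mono nonneg Cons.IH mono)
  also have "\<dots> \<le> (\<Sum>v\<in>trits. w v * ?f v) * (\<Sum>v\<in>trits. w v * ?g v)"
    by (intro Chebyshev_three field_avg_mono monoD[OF Cons.prems(1)] antimonoD[OF Cons.prems(2)])
      (auto simp: le_fun_def)
  finally show ?case by simp
qed simp

lemma field_avg_vanishing:
  "field_avg w zs f = field_avg w zs (\<lambda>\<eta>. f (\<lambda>z. if z \<in> set zs then \<eta> z else 0))"
proof (induction zs arbitrary: f)
  case (Cons x zs)
  have e: "(\<lambda>z. if z \<in> set zs then \<eta> z else 0)(x := v)
      = (\<lambda>z. if z \<in> set (x # zs) then (\<eta>(x := v)) z else 0)" for \<eta> :: "site \<Rightarrow> int" and v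
    by auto
  show ?case unfolding field_avg.simps Cons[of "\<lambda>y. f (y(x := _))"] e ..
qed simp

end

text \<open>Taking the most favourable value at undecided sites: for \<open>\<sigma> = 1\<close> the rightmost field
  compatible with \<open>y\<close>, for \<open>\<sigma> = - 1\<close> the leftmost one.\<close>

definition extreme_field :: "int \<Rightarrow> (site \<Rightarrow> int) \<Rightarrow> site \<Rightarrow> int" where
  "extreme_field \<sigma> y z = (if \<sigma> * y z \<le> - 1 then - \<sigma> else \<sigma>)"

text \<open>For \<sigma> = - 1 the path is reflected, so the upper barrier becomes a lower one and a
  single estimate serves both sides.\<close>

definition survives :: "int \<Rightarrow> real \<Rightarrow> nat \<Rightarrow> nat \<Rightarrow> int \<Rightarrow> (site \<Rightarrow> int) \<Rightarrow> bool" where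
  "survives \<sigma> K N n x a \<longleftrightarrow> (\<forall>j\<le>N - n. - 1 - K * sqrt (real (n + j))
     \<le> real_of_int (\<sigma> * fst (web_site a (x, int n) j)))"

section \<open>Order preservation for paths\<close>

lemma web_site_snd: "snd (web_site a z n) = snd z + int n"
  by (induction n) (auto simp: Let_def case_prod_beta)

lemma web_site_Suc_shift: "web_site a z (Suc n) = web_site a (fst z + a z, snd z + 1) n"
proof (induction n)
  case 0
  then show ?case by (cases z) simp
next
  case (Suc n)
  have "web_site a z (Suc (Suc n)) = (let (x, t) = web_site a z (Suc n) in (x + a (x, t), t + 1))"
    by (rule web_site.simps(2))
  then show ?case unfolding Suc by simp
qed

lemma web_site_cong:
  "(\<And>z'. snd z \<le> snd z' \<Longrightarrow> a z' = b z') \<Longrightarrow> web_site a z n = web_site b z n"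
proof (induction n)
  case (Suc n)
  have "snd (web_site b z n) = snd z + int n" by (rule web_site_snd)
  with Suc show ?case by (auto simp: Let_def case_prod_beta)
qed simp

lemma web_site_parity:
  assumes "\<And>z. z \<in> even_sites \<Longrightarrow> a z \<in> {-1, 1}"
  shows "even (fst (web_site a (0, 0) n) + int n)"
proof (induction n)
  case (Suc n)
  have "snd (web_site a (0, 0) n) = int n" using web_site_snd[where a=a and z="(0,0)" and n=n] by simp
  then have "web_site a (0, 0) n \<in> even_sites"
    using Suc by (simp add: even_sites_def case_prod_beta)
  then have "a (web_site a (0, 0) n) = -1 \<or> a (web_site a (0, 0) n) = 1" using assms by blast
  then show ?case using Suc by (auto simp: Let_def case_prod_beta)
qed simp

text \<open>At a common time both positions have the same parity, so they agree or differ by at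
  least 2; a single step then cannot make the paths cross.\<close>

lemma web_site_mono:
  assumes a: "\<And>z. z \<in> even_sites \<Longrightarrow> a z \<in> {-1, 1}" and b: "\<And>z. z \<in> even_sites \<Longrightarrow> b z \<in> {-1, 1}"
    and le: "\<And>z. z \<in> even_sites \<Longrightarrow> a z \<le> b z"
  shows "fst (web_site a (0, 0) n) \<le> fst (web_site b (0, 0) n)"
proof (induction n)
  case (Suc n)
  define p q where "p = fst (web_site a (0, 0) n)" and "q = fst (web_site b (0, 0) n)"
  have pq: "web_site a (0, 0) n = (p, int n)" "web_site b (0, 0) n = (q, int n)"
    using web_site_snd[where a=a and z="(0,0)" and n=n] web_site_snd[where a=b and z="(0,0)" and n=n]
    by (auto simp: p_def q_def prod_eq_iff)
  have "even (p + int n)" "even (q + int n)"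
    unfolding p_def q_def by (intro web_site_parity a b; assumption)+
  then have par: "(p, int n) \<in> even_sites" "(q, int n) \<in> even_sites" "even (q - p)"
    by (auto simp: even_sites_def)
  have "p \<le> q" using Suc by (simp add: p_def q_def)
  moreover have "a (p, int n) \<le> b (q, int n)" if "p = q" using le[OF par(1)] that by simp
  moreover have "a (p, int n) \<in> {-1, 1}" "b (q, int n) \<in> {-1, 1}" using a b par by blast+
  moreover have "p \<noteq> q \<Longrightarrow> p + 2 \<le> q" using \<open>p \<le> q\<close> par(3) by presburger
  ultimately have "p + a (p, int n) \<le> q + b (q, int n)" by (cases "p = q") auto
  then show ?case by (simp add: pq)
qed simp

lemma extreme_field_range: "\<sigma> \<in> {-1, 1} \<Longrightarrow> extreme_field \<sigma> y z \<in> {-1, 1}"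
  by (auto simp: extreme_field_def)

lemma survives_right_mono:
  "mono (\<lambda>y. of_bool (survives 1 K N 0 0 (extreme_field 1 y)) :: real)"
proof (rule monoI)
  fix y y' :: "site \<Rightarrow> int" assume "y \<le> y'"
  then have "y z \<le> y' z" for z by (rule le_funD)
  then have "extreme_field 1 y z \<le> extreme_field 1 y' z" for z
    using order_trans[of "y z" "y' z" "-1"] order_trans[of 1 "y z" "y' z"] by (auto simp: extreme_field_def)
  then have "fst (web_site (extreme_field 1 y) (0, 0) n) \<le> fst (web_site (extreme_field 1 y') (0, 0) n)" for n
    by (intro web_site_mono extreme_field_range) auto
  then have "real_of_int (fst (web_site (extreme_field 1 y) (0, 0) n))
      \<le> real_of_int (fst (web_site (extreme_field 1 y') (0, 0) n))" for n by simp
  then show "of_bool (survives 1 K N 0 0 (extreme_field 1 y)) \<le> (of_bool (survives 1 K N 0 0 (extreme_field 1 y')) :: real)"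
    unfolding survives_def by (auto simp: of_bool_def intro: order_trans)
qed

text \<open>Both extreme fields increase with y, hence so do their paths, but here survival means
  staying low. This opposite monotonicity is what Harris' inequality needs.\<close>

lemma survives_left_antimono:
  "antimono (\<lambda>y. of_bool (survives (-1) K N 0 0 (extreme_field (-1) y)) :: real)"
proof (rule antimonoI)
  fix y y' :: "site \<Rightarrow> int" assume "y \<le> y'"
  then have "y z \<le> y' z" for z by (rule le_funD)
  then have "extreme_field (-1) y z \<le> extreme_field (-1) y' z" for z
    using order_trans[of "y z" "y' z" "-1"] order_trans[of 1 "y z" "y' z"] by (auto simp: extreme_field_def)
  then have "fst (web_site (extreme_field (-1) y) (0, 0) n) \<le> fst (web_site (extreme_field (-1) y') (0, 0) n)" for n
    by (intro web_site_mono extreme_field_range) auto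
  then have "- real_of_int (fst (web_site (extreme_field (-1) y') (0, 0) n))
      \<le> - real_of_int (fst (web_site (extreme_field (-1) y) (0, 0) n))" for n by simp
  then show "of_bool (survives (-1) K N 0 0 (extreme_field (-1) y')) \<le> (of_bool (survives (-1) K N 0 0 (extreme_field (-1) y)) :: real)"
    unfolding survives_def by (auto simp: of_bool_def intro: order_trans)
qed

definition space_time_box :: "nat \<Rightarrow> site set" where
  "space_time_box N = {(x, t). 0 \<le> t \<and> t < int N \<and> \<bar>x\<bar> \<le> t \<and> even (x + t)}"

lemma finite_space_time_box: "finite (space_time_box N)"
  by (rule finite_subset[of _ "{- int N..int N} \<times> {0..int N}"]) (auto simp: space_time_box_def)

text \<open>Resampling the site currently occupied gives the one-step recursion. In reflected
  coordinates the same drift \<delta> favours survival for either sign \<sigma>.\<close>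

lemma (in trit_weights) field_avg_drifted_survival:
  assumes \<sigma>: "\<sigma> \<in> {-1, 1}" and w: "w (-1) = (1 - \<delta>) / 2" "w 1 = (1 - \<delta>) / 2"
    and zs: "set zs = space_time_box N"
  shows "drifted_survival K \<delta> N (\<lambda>n x. field_avg w zs (\<lambda>y. of_bool (survives \<sigma> K N n (\<sigma> * x) (extreme_field \<sigma> y))))"
  unfolding drifted_survival_def
proof (intro conjI allI impI)
  fix n :: nat and x :: int
  show "0 \<le> field_avg w zs (\<lambda>y. of_bool (survives \<sigma> K N n (\<sigma> * x) (extreme_field \<sigma> y)))"
    "field_avg w zs (\<lambda>y. of_bool (survives \<sigma> K N n (\<sigma> * x) (extreme_field \<sigma> y))) \<le> 1"
    by (auto intro: field_avg_bounds)
  have sq: "\<sigma> * (\<sigma> * k) = k" for k using \<sigma> by auto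
  show "field_avg w zs (\<lambda>y. of_bool (survives \<sigma> K N n (\<sigma> * x) (extreme_field \<sigma> y))) = 0"
    if "real_of_int x < - 1 - K * sqrt (real n)"
  proof -
    have "\<not> survives \<sigma> K N n (\<sigma> * x) a" for a
    proof
      assume "survives \<sigma> K N n (\<sigma> * x) a"
      then have "- 1 - K * sqrt (real (n + 0)) \<le> real_of_int (\<sigma> * fst (web_site a (\<sigma> * x, int n) 0))"
        unfolding survives_def by blast
      also have "\<dots> = real_of_int x" by (simp only: web_site.simps fst_conv sq)
      finally show False using that by simp
    qed
    then show ?thesis by (simp add: field_avg_const)
  qed
  assume n: "n < N" and x: "\<bar>x\<bar> \<le> int n" "even (x + int n)"
  define z where "z = (\<sigma> * x, int n)"
  have "z \<in> set zs" unfolding zs using n x \<sigma> by (auto simp: z_def space_time_box_def)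
  define s where "s = (\<lambda>v::int. if \<sigma> * v \<le> -1 then -1 else 1 :: int)"
  define U where "U = (\<lambda>n x. field_avg w zs (\<lambda>y. of_bool (survives \<sigma> K N n (\<sigma> * x) (extreme_field \<sigma> y))))"
  have step: "survives \<sigma> K N (Suc n) (\<sigma> * (x + s v)) (extreme_field \<sigma> y)"
    if "survives \<sigma> K N n (\<sigma> * x) (extreme_field \<sigma> (y(z := v)))" for v y
    unfolding survives_def
  proof (intro allI impI)
    fix j assume j: "j \<le> N - Suc n"
    let ?b = "extreme_field \<sigma> (y(z := v))"
    have "web_site ?b (\<sigma> * x, int n) (Suc j) = web_site ?b (\<sigma> * (x + s v), int (Suc n)) j"
    proof -
      have "?b z = \<sigma> * s v" using \<sigma> by (auto simp: extreme_field_def s_def)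
      then show ?thesis unfolding web_site_Suc_shift z_def by (simp add: algebra_simps)
    qed
    \<comment> \<open>After the first step only later times are visited, so the value at z is no
      longer read.\<close>
    also have "\<dots> = web_site (extreme_field \<sigma> y) (\<sigma> * (x + s v), int (Suc n)) j"
      by (rule web_site_cong) (auto simp: extreme_field_def z_def)
    finally have "web_site ?b (\<sigma> * x, int n) (Suc j) = \<dots>" .
    moreover have "- 1 - K * sqrt (real (n + Suc j)) \<le> real_of_int (\<sigma> * fst (web_site ?b (\<sigma> * x, int n) (Suc j)))"
      using that j n unfolding survives_def by (metis Suc_diff_Suc Suc_le_mono)
    ultimately show "- 1 - K * sqrt (real (Suc n + j))
      \<le> real_of_int (\<sigma> * fst (web_site (extreme_field \<sigma> y) (\<sigma> * (x + s v), int (Suc n)) j))"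
      by simp
  qed
  have "U n x = (\<Sum>v\<in>trits. w v * field_avg w zs (\<lambda>y. of_bool (survives \<sigma> K N n (\<sigma> * x) (extreme_field \<sigma> (y(z := v))))))"
    unfolding U_def by (rule field_avg_resample) fact
  also have "\<dots> \<le> (\<Sum>v\<in>trits. w v * U (Suc n) (x + s v))"
    unfolding U_def by (intro sum_mono mult_left_mono field_avg_mono nonneg) (auto intro: step)
  also have "\<dots> = ((1 + \<delta>) * U (Suc n) (x + 1) + (1 - \<delta>) * U (Suc n) (x - 1)) / 2"
  proof -
    \<comment> \<open>Undecided sites step in the favourable direction, whose total weight is
      \<delta> + (1 - \<delta>)/2 = (1 + \<delta>)/2.\<close>
    have "w 0 = \<delta>" using sum_1 w by (simp add: trits_def field_simps)
    then show ?thesis using \<sigma> by (auto simp: w trits_def s_def field_simps)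
  qed
  finally show "U n x \<le> \<dots>" .
qed

definition two_sided_survives :: "real \<Rightarrow> real \<Rightarrow> nat \<Rightarrow> (site \<Rightarrow> int) \<Rightarrow> bool" where
  "two_sided_survives K\<^sub>L K\<^sub>R N y \<longleftrightarrow>
    survives 1 K\<^sub>L N 0 0 (extreme_field 1 y) \<and> survives (-1) K\<^sub>R N 0 0 (extreme_field (-1) y)"

lemma two_sided_survival_decay:
  assumes K: "0 < K\<^sub>L" "0 < K\<^sub>R" and q: "0 < q\<^sub>L" "q\<^sub>L < exponent K\<^sub>L" "0 < q\<^sub>R" "q\<^sub>R < exponent K\<^sub>R"
  obtains C where "0 \<le> C"
    "\<And>i \<delta> w zs. trit_weights w \<Longrightarrow> w (-1) = (1 - \<delta>) / 2 \<Longrightarrow> w 1 = (1 - \<delta>) / 2 \<Longrightarrow>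
      0 \<le> \<delta> \<Longrightarrow> \<delta> \<le> 1 / 2 ^ i \<Longrightarrow> set zs = space_time_box (4 ^ i) \<Longrightarrow>
      field_avg w zs (\<lambda>y. of_bool (two_sided_survives K\<^sub>L K\<^sub>R (4 ^ i) y)) \<le> C * 2 powr (- (q\<^sub>L + q\<^sub>R) * real i)"
proof -
  obtain C where C: "0 \<le> C" "\<And>i \<delta> u. drifted_survival K\<^sub>L \<delta> (4 ^ i) u \<Longrightarrow> 0 \<le> \<delta> \<Longrightarrow> \<delta> \<le> 1 / 2 ^ i \<Longrightarrow>
      u 0 0 \<le> C * 2 powr (- q\<^sub>L * real i)"
    using drifted_survival_decay[OF K(1) q(1,2)] by metis
  obtain D where D: "0 \<le> D" "\<And>i \<delta> u. drifted_survival K\<^sub>R \<delta> (4 ^ i) u \<Longrightarrow> 0 \<le> \<delta> \<Longrightarrow> \<delta> \<le> 1 / 2 ^ i \<Longrightarrow>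
      u 0 0 \<le> D * 2 powr (- q\<^sub>R * real i)"
    using drifted_survival_decay[OF K(2) q(3,4)] by metis
  show ?thesis
  proof (rule that[of "C * D"])
    show "0 \<le> C * D" using C D by simp
    fix i :: nat and \<delta> w zs
    assume w: "trit_weights w" "w (-1) = (1 - \<delta>) / 2" "w 1 = (1 - \<delta>) / 2"
      and \<delta>: "0 \<le> \<delta>" "\<delta> \<le> 1 / 2 ^ i" and zs: "set zs = space_time_box (4 ^ i)"
    interpret trit_weights w by fact
    let ?f = "\<lambda>y. of_bool (survives 1 K\<^sub>L (4 ^ i) 0 0 (extreme_field 1 y)) :: real"
    let ?g = "\<lambda>y. of_bool (survives (-1) K\<^sub>R (4 ^ i) 0 0 (extreme_field (-1) y)) :: real"
    have "field_avg w zs (\<lambda>y. of_bool (two_sided_survives K\<^sub>L K\<^sub>R (4 ^ i) y)) = field_avg w zs (\<lambda>y. ?f y * ?g y)"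
      by (simp add: two_sided_survives_def of_bool_conj)
    also have "\<dots> \<le> field_avg w zs ?f * field_avg w zs ?g"
      by (intro Harris survives_right_mono survives_left_antimono)
    also have "\<dots> \<le> (C * 2 powr (- q\<^sub>L * real i)) * (D * 2 powr (- q\<^sub>R * real i))"
    proof (intro mult_mono)
      show "field_avg w zs ?f \<le> C * 2 powr (- q\<^sub>L * real i)"
        using C(2)[OF field_avg_drifted_survival[of 1, OF _ w(2,3) zs] \<delta>] by simp
      show "field_avg w zs ?g \<le> D * 2 powr (- q\<^sub>R * real i)"
        using D(2)[OF field_avg_drifted_survival[of "-1", OF _ w(2,3) zs] \<delta>] by simp
    qed (use C in \<open>auto intro: field_avg_bounds\<close>)
    also have "\<dots> = C * D * 2 powr (- (q\<^sub>L + q\<^sub>R) * real i)"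
      by (simp add: powr_add[symmetric] algebra_simps)
    finally show "field_avg w zs (\<lambda>y. of_bool (two_sided_survives K\<^sub>L K\<^sub>R (4 ^ i) y)) \<le> C * D * 2 powr (- (q\<^sub>L + q\<^sub>R) * real i)" .
  qed
qed

text \<open>The events at the sites of \<open>J\<close> strengthen the induction on \<open>zs\<close>.\<close>

lemma (in prob_space) field_law:
  fixes Y :: "site \<Rightarrow> 'a \<Rightarrow> int" and P :: "(site \<Rightarrow> int) \<Rightarrow> bool"
  assumes indep: "indep_vars (\<lambda>_. count_space UNIV) Y I"
    and law: "\<And>z v. z \<in> I \<Longrightarrow> v \<in> trits \<Longrightarrow> prob {\<omega> \<in> space M. Y z \<omega> = v} = w v"
    and rng: "\<And>z \<omega>. Y z \<omega> \<in> trits"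
  defines "E \<equiv> \<lambda>J y zs. {\<omega> \<in> space M. (\<forall>z\<in>J. Y z \<omega> = y z) \<and> P (\<lambda>z. if z \<in> set zs then Y z \<omega> else y z)}"
  shows "distinct zs \<Longrightarrow> set zs \<subseteq> I \<Longrightarrow> finite J \<Longrightarrow> J \<subseteq> I \<Longrightarrow> J \<inter> set zs = {} \<Longrightarrow> (\<And>z. z \<in> J \<Longrightarrow> y z \<in> trits) \<Longrightarrow>
    E J y zs \<in> sets M \<and> prob (E J y zs)
      = (\<Prod>z\<in>J. w (y z)) * field_avg w zs (\<lambda>\<eta>. of_bool (P (\<lambda>z. if z \<in> set zs then \<eta> z else y z)))"
proof (induction zs arbitrary: J y)
  case Nil
  have Ym: "z \<in> J \<Longrightarrow> Y z \<in> measurable M (count_space UNIV)" for z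
    using indep Nil by (auto simp: indep_vars_def)
  have ev: "{\<omega> \<in> space M. (\<forall>z\<in>J. Y z \<omega> = y z)} \<in> sets M"
    using Nil(3) Ym by measurable
  have "prob {\<omega> \<in> space M. (\<forall>z\<in>J. Y z \<omega> = y z)} = (\<Prod>z\<in>J. w (y z))"
  proof (cases "J = {}")
    case True
    then show ?thesis by (simp add: prob_space)
  next
    case False
    have "prob (\<Inter>z\<in>J. Y z -` {y z} \<inter> space M) = (\<Prod>z\<in>J. prob (Y z -` {y z} \<inter> space M))"
      using False Nil by (intro indep_varsD[OF indep]) auto
    also have "(\<Inter>z\<in>J. Y z -` {y z} \<inter> space M) = {\<omega> \<in> space M. (\<forall>z\<in>J. Y z \<omega> = y z)}"
      using False by auto
    also have "(\<Prod>z\<in>J. prob (Y z -` {y z} \<inter> space M)) = (\<Prod>z\<in>J. w (y z))"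
    proof (rule prod.cong)
      fix z assume "z \<in> J"
      then have "prob {\<omega> \<in> space M. Y z \<omega> = y z} = w (y z)" using Nil by (intro law) auto
      moreover have "Y z -` {y z} \<inter> space M = {\<omega> \<in> space M. Y z \<omega> = y z}" by auto
      ultimately show "prob (Y z -` {y z} \<inter> space M) = w (y z)" by simp
    qed simp
    finally show ?thesis .
  qed
  then show ?case using ev by (cases "P y") (simp_all add: E_def)
next
  case (Cons x zs)
  have IH: "E (insert x J) (y(x := v)) zs \<in> sets M \<and> prob (E (insert x J) (y(x := v)) zs)
      = (\<Prod>z\<in>insert x J. w ((y(x := v)) z)) * field_avg w zs (\<lambda>\<eta>. of_bool (P (\<lambda>z. if z \<in> set zs then \<eta> z else (y(x := v)) z)))"
    if "v \<in> trits" for v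
    using Cons.prems that by (intro Cons.IH) auto
  have x: "x \<notin> J" "x \<notin> set zs" using Cons.prems by auto
  have E_Un: "E J y (x # zs) = (\<Union>v\<in>trits. E (insert x J) (y(x := v)) zs)"
  proof (rule set_eqI)
    fix \<omega>
    have "(\<forall>z\<in>J. Y z \<omega> = y z) \<longleftrightarrow> (\<forall>z\<in>insert x J. Y z \<omega> = (y(x := Y x \<omega>)) z)" using x by auto
    moreover have "(\<lambda>z. if z \<in> set (x # zs) then Y z \<omega> else y z)
        = (\<lambda>z. if z \<in> set zs then Y z \<omega> else (y(x := Y x \<omega>)) z)" by auto
    ultimately have "\<omega> \<in> E J y (x # zs) \<longleftrightarrow> \<omega> \<in> E (insert x J) (y(x := Y x \<omega>)) zs"
      unfolding E_def by simp
    also have "\<dots> \<longleftrightarrow> (\<exists>v\<in>trits. \<omega> \<in> E (insert x J) (y(x := v)) zs)"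
    proof
      assume "\<omega> \<in> E (insert x J) (y(x := Y x \<omega>)) zs"
      then show "\<exists>v\<in>trits. \<omega> \<in> E (insert x J) (y(x := v)) zs" using rng by blast
    next
      assume "\<exists>v\<in>trits. \<omega> \<in> E (insert x J) (y(x := v)) zs"
      then obtain v where v: "\<omega> \<in> E (insert x J) (y(x := v)) zs" by blast
      then have "Y x \<omega> = v" unfolding E_def by simp
      then show "\<omega> \<in> E (insert x J) (y(x := Y x \<omega>)) zs" using v by simp
    qed
    finally show "\<omega> \<in> E J y (x # zs) \<longleftrightarrow> \<omega> \<in> (\<Union>v\<in>trits. E (insert x J) (y(x := v)) zs)" by simp
  qed
  have disj: "disjoint_family_on (\<lambda>v. E (insert x J) (y(x := v)) zs) trits"
    unfolding disjoint_family_on_def E_def by auto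
  have fin: "finite trits" by (simp add: trits_def)
  have meas: "E J y (x # zs) \<in> sets M" unfolding E_Un using IH fin by auto
  have F: "(\<lambda>z. if z \<in> set zs then \<eta> z else (y(x := v)) z)
      = (\<lambda>z. if z \<in> set (x # zs) then (\<eta>(x := v)) z else y z)" for \<eta> :: "_ \<Rightarrow> int" and v
    using x by auto
  have "prob (E J y (x # zs)) = (\<Sum>v\<in>trits. prob (E (insert x J) (y(x := v)) zs))"
    unfolding E_Un using IH disj fin by (intro finite_measure_finite_Union) auto
  also have "\<dots> = (\<Sum>v\<in>trits. (\<Prod>z\<in>J. w (y z)) * (w v * field_avg w zs
      (\<lambda>\<eta>. of_bool (P (\<lambda>z. if z \<in> set (x # zs) then (\<eta>(x := v)) z else y z)))))"
  proof (rule sum.cong)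
    fix v assume "v \<in> trits"
    moreover have "(\<Prod>z\<in>insert x J. w ((y(x := v)) z)) = w v * (\<Prod>z\<in>J. w (y z))"
      using x Cons.prems by (subst prod.insert) (auto intro!: prod.cong)
    ultimately show "prob (E (insert x J) (y(x := v)) zs) = (\<Prod>z\<in>J. w (y z)) * (w v * field_avg w zs
      (\<lambda>\<eta>. of_bool (P (\<lambda>z. if z \<in> set (x # zs) then (\<eta>(x := v)) z else y z))))"
      using IH unfolding F by (simp add: mult_ac)
  qed simp
  finally show ?case using meas by (simp only: field_avg.simps sum_distrib_left)
qed

section \<open>Poisson clocks\<close>

text \<open>The \<open>k\<close>-th value is in force throughout the dynamical time interval \<open>[t, t + e]\<close>.\<close>

definition undisturbed :: "real \<Rightarrow> real \<Rightarrow> (nat \<Rightarrow> real) \<Rightarrow> nat \<Rightarrow> bool" where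
  "undisturbed t e v k \<longleftrightarrow> (\<forall>j<k. ring_time v j \<le> t) \<and> t + e < ring_time v k"

definition trit :: "real \<Rightarrow> real \<Rightarrow> (nat \<Rightarrow> real) \<Rightarrow> (nat \<Rightarrow> real) \<Rightarrow> int" where
  "trit t e x v = (if \<exists>k. undisturbed t e v k \<and> x k = 1 then 1
     else if \<exists>k. undisturbed t e v k \<and> x k = -1 then - 1 else 0)"

lemma trit_range: "trit t e x v \<in> trits"
  by (simp add: trit_def trits_def)

lemma undisturbed_unique:
  assumes "0 \<le> e" "undisturbed t e v k" "undisturbed t e v k'"
  shows "k = k'"
  using assms unfolding undisturbed_def by (cases k k' rule: linorder_cases) force+

lemma undisturbed_measurable [measurable]:
  assumes [measurable]: "\<And>k. (\<lambda>\<omega>. v \<omega> k) \<in> borel_measurable N"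
  shows "Measurable.pred N (\<lambda>\<omega>. undisturbed t e (v \<omega>) k)"
  unfolding undisturbed_def ring_time_def by measurable

lemma trit_measurable:
  assumes [measurable]: "\<And>k. (\<lambda>\<omega>. v \<omega> k) \<in> borel_measurable N" "\<And>k. (\<lambda>\<omega>. x \<omega> k) \<in> borel_measurable N"
  shows "(\<lambda>\<omega>. trit t e (x \<omega>) (v \<omega>)) \<in> measurable N (count_space UNIV)"
  unfolding trit_def by measurable

lemma undisturbed_value:
  assumes e: "0 \<le> e" and u: "undisturbed t e v k" and v: "\<And>k. 0 \<le> v k" and \<tau>: "t \<le> \<tau>" "\<tau> \<le> t + e"
  shows "rings_until v \<tau> = k"
proof -
  have "{j. ring_time v j \<le> \<tau>} = {..<k}"
  proof (intro set_eqI iffI; simp)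
    fix j assume j: "ring_time v j \<le> \<tau>"
    show "j < k"
    proof (rule ccontr)
      assume "\<not> j < k"
      then have "ring_time v k \<le> ring_time v j"
        unfolding ring_time_def using v by (intro sum_mono2) auto
      then show False using u j \<tau> by (simp add: undisturbed_def)
    qed
  next
    fix j assume "j < k"
    then show "ring_time v j \<le> \<tau>" using u \<tau> by (force simp: undisturbed_def)
  qed
  then show ?thesis by (simp add: rings_until_def)
qed

text \<open>Condition on U by Fubini. On B the level t + d - g(u) is nonnegative, so the exponential
  tail beyond it splits off the factor exp(-d). In the application U collects the earlier waiting
  times, g is their sum, and f(V) is the current one.\<close>

lemma (in prob_space) exponential_memoryless:
  assumes ind: "indep_var N U L V" and V: "distributed M lborel (\<lambda>\<omega>. f (V \<omega>)) (exponential_density 1)"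
    and f[measurable]: "f \<in> borel_measurable L"
    and B: "B \<in> sets N" and g[measurable]: "g \<in> borel_measurable N"
    and gB: "\<And>u. u \<in> B \<Longrightarrow> g u \<le> t" and e: "0 \<le> e"
  shows "prob {\<omega> \<in> space M. U \<omega> \<in> B \<and> t + e < g (U \<omega>) + f (V \<omega>)}
    = exp (- e) * prob {\<omega> \<in> space M. U \<omega> \<in> B \<and> t < g (U \<omega>) + f (V \<omega>)}"
proof -
  have U[measurable]: "U \<in> measurable M N" and Vm[measurable]: "V \<in> measurable M L"
    using ind by (auto simp: indep_var_rv1 indep_var_rv2)
  note [measurable] = B
  interpret DU: prob_space "distr M N U" by (rule prob_space_distr) simp
  interpret DV: prob_space "distr M L V" by (rule prob_space_distr) simp
  define Q where "Q = (\<lambda>d. {p \<in> space (N \<Otimes>\<^sub>M L). fst p \<in> B \<and> t + d < g (fst p) + f (snd p)})"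
  have Q[measurable]: "Q d \<in> sets (N \<Otimes>\<^sub>M L)" for d unfolding Q_def by measurable
  \<comment> \<open>Used for d = e and d = 0; the remaining integral is the same in both.\<close>
  have key: "emeasure M {\<omega> \<in> space M. U \<omega> \<in> B \<and> t + d < g (U \<omega>) + f (V \<omega>)}
      = ennreal (exp (- d)) * (\<integral>\<^sup>+u. indicator B u * ennreal (exp (- (t - g u))) \<partial>distr M N U)"
    if d: "0 \<le> d" for d
  proof -
    have "emeasure M {\<omega> \<in> space M. U \<omega> \<in> B \<and> t + d < g (U \<omega>) + f (V \<omega>)}
        = emeasure (distr M (N \<Otimes>\<^sub>M L) (\<lambda>\<omega>. (U \<omega>, V \<omega>))) (Q d)"
      using measurable_space[OF U] measurable_space[OF Vm] by (subst emeasure_distr) (auto simp: Q_def space_pair_measure intro!: arg_cong[where f="emeasure M"])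
    also have "\<dots> = emeasure (distr M N U \<Otimes>\<^sub>M distr M L V) (Q d)"
      using ind by (simp add: indep_var_distribution_eq)
    also have "\<dots> = (\<integral>\<^sup>+u. emeasure (distr M L V) (Pair u -` Q d) \<partial>distr M N U)"
      by (intro DV.emeasure_pair_measure_alt) simp
    also have "\<dots> = (\<integral>\<^sup>+u. ennreal (exp (- d)) * (indicator B u * ennreal (exp (- (t - g u)))) \<partial>distr M N U)"
    proof (rule nn_integral_cong)
      fix u assume "u \<in> space (distr M N U)"
      then have u: "u \<in> space N" by simp
      show "emeasure (distr M L V) (Pair u -` Q d)
        = ennreal (exp (- d)) * (indicator B u * ennreal (exp (- (t - g u))))"
      proof (cases "u \<in> B")
        case True
        have "Pair u -` Q d = {v \<in> space L. t + d - g u < f v}" using u True by (auto simp: Q_def space_pair_measure)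
        then have "emeasure (distr M L V) (Pair u -` Q d) = emeasure M {\<omega> \<in> space M. t + d - g u < f (V \<omega>)}"
          using measurable_space[OF Vm] by (simp add: emeasure_distr) (auto intro!: arg_cong[where f="emeasure M"])
        also have "\<dots> = ennreal (exp (- (t + d - g u) * 1))"
          unfolding emeasure_eq_measure using gB[OF True] d
          by (subst exponential_distributedD_gt[OF V]) auto
        also have "exp (- (t + d - g u) * 1) = exp (- d) * exp (- (t - g u))"
          by (simp flip: exp_add)
        finally show ?thesis using True by (simp add: ennreal_mult')
      next
        case False
        then have "Pair u -` Q d = {}" by (auto simp: Q_def)
        then show ?thesis using False by simp
      qed
    qed
    also have "\<dots> = ennreal (exp (- d)) * (\<integral>\<^sup>+u. indicator B u * ennreal (exp (- (t - g u))) \<partial>distr M N U)"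
      by (rule nn_integral_cmult) measurable
    finally show ?thesis .
  qed
  have "emeasure M {\<omega> \<in> space M. U \<omega> \<in> B \<and> t + e < g (U \<omega>) + f (V \<omega>)}
    = ennreal (exp (- e)) * emeasure M {\<omega> \<in> space M. U \<omega> \<in> B \<and> t < g (U \<omega>) + f (V \<omega>)}"
    using key[OF e] key[of 0] by simp
  then show ?thesis by (simp add: emeasure_eq_measure ennreal_mult'[symmetric])
qed

section \<open>Law and independence of the site states\<close>

context dynamical_discrete_web
begin

definition driver :: "(site \<times> nat) + (site \<times> nat) \<Rightarrow> 'w \<Rightarrow> real" where
  "driver = case_sum (\<lambda>(z, k) \<omega>. real_of_int (X z k \<omega>)) (\<lambda>(z, k). W z k)"

lemma driver_simps [simp]:
  "driver (Inl (z, k)) \<omega> = real_of_int (X z k \<omega>)" "driver (Inr (z, k)) = W z k"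
  by (simp_all add: driver_def)

lemma driver_indep:
  "indep_vars (\<lambda>_. borel) driver ((even_sites \<times> UNIV) <+> (even_sites \<times> UNIV))"
  using all_independent by (simp add: driver_def)

lemma W_measurable: "z \<in> even_sites \<Longrightarrow> W z k \<in> borel_measurable M"
  using W_exponential[of z k] by (auto simp: distributed_def)

lemma X_real_measurable: "z \<in> even_sites \<Longrightarrow> (\<lambda>\<omega>. real_of_int (X z k \<omega>)) \<in> borel_measurable M"
  using X_measurable[of z k] by measurable

lemma undisturbed_event:
  "z \<in> even_sites \<Longrightarrow> {\<omega> \<in> space M. undisturbed t e (\<lambda>k. W z k \<omega>) k} \<in> sets M"
  using undisturbed_measurable[of "\<lambda>\<omega> k. W z k \<omega>" M t e k] W_measurable by auto

lemma ring_time_split: "ring_time v k = (\<Sum>i<k. v i) + v k"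
  unfolding ring_time_def lessThan_Suc_atMost[symmetric] by simp

text \<open>The factor does not depend on k, so summing over k will need only that the counts of
  rings up to t have total mass 1.\<close>

lemma undisturbed_prob:
  assumes z: "z \<in> even_sites" and e: "0 \<le> e" and t: "0 \<le> t"
  shows "prob {\<omega> \<in> space M. undisturbed t e (\<lambda>k. W z k \<omega>) k}
    = exp (- e) * prob {\<omega> \<in> space M. undisturbed t 0 (\<lambda>k. W z k \<omega>) k}"
proof -
  define A :: "((site \<times> nat) + (site \<times> nat)) set" where "A = Inr ` ({z} \<times> {..<k})"
  define U where "U = (\<lambda>\<omega>. restrict (\<lambda>i. driver i \<omega>) A)"
  define N :: "(((site \<times> nat) + (site \<times> nat)) \<Rightarrow> real) measure" where "N = PiM A (\<lambda>_. borel)"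
  have comp: "(\<lambda>f. f (Inr (z, i))) \<in> borel_measurable N" if "i < k" for i
    unfolding N_def using that by (intro measurable_component_singleton) (auto simp: A_def)
  define V where "V = (\<lambda>\<omega>. restrict (\<lambda>i. driver i \<omega>) {Inr (z, k)})"
  have ind: "indep_var N U (PiM {Inr (z, k)} (\<lambda>_. borel)) V"
    unfolding U_def N_def V_def using z
    by (intro indep_var_restrict[OF driver_indep]) (auto simp: A_def)
  have V: "V \<omega> (Inr (z, k)) = W z k \<omega>" for \<omega> by (simp add: V_def)
  define B where "B = {f \<in> space N. \<forall>j<k. (\<Sum>i\<le>j. f (Inr (z, i))) \<le> t}"
  define g :: "(((site \<times> nat) + (site \<times> nat)) \<Rightarrow> real) \<Rightarrow> real" where "g = (\<lambda>f. \<Sum>i<k. f (Inr (z, i)))"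
  have gm: "g \<in> borel_measurable N" unfolding g_def by (intro borel_measurable_sum comp) auto
  have B_eq: "B = space N \<inter> (\<Inter>j\<in>{..<k}. {f \<in> space N. (\<Sum>i\<le>j. f (Inr (z, i))) \<le> t})"
    by (auto simp: B_def)
  have Bm: "B \<in> sets N"
  proof -
    have "{f \<in> space N. (\<Sum>i\<le>j. f (Inr (z, i))) \<le> t} \<in> sets N" if "j < k" for j
      using that by (intro borel_measurable_le borel_measurable_sum comp borel_measurable_const) auto
    then show ?thesis unfolding B_eq by (cases "k = 0") auto
  qed
  \<comment> \<open>The sum of the first k waiting times is the ring before the current one; for k =
    0 it is the empty sum, and this case rests on t \<ge> 0.\<close>
  have gB: "g f \<le> t" if "f \<in> B" for f
  proof (cases k)
    case 0
    then show ?thesis using t by (simp add: g_def)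
  next
    case (Suc k')
    then show ?thesis using that by (simp add: B_def g_def lessThan_Suc_atMost)
  qed
  have UB: "undisturbed t d (\<lambda>k. W z k \<omega>) k \<longleftrightarrow> U \<omega> \<in> B \<and> t + d < g (U \<omega>) + W z k \<omega>"
    if "\<omega> \<in> space M" for \<omega> d
  proof -
    have "U \<omega> \<in> space N" using that measurable_space[OF indep_var_rv1[OF ind]] by auto
    moreover have "U \<omega> (Inr (z, i)) = W z i \<omega>" if "i < k" for i using that by (simp add: U_def A_def)
    ultimately show ?thesis
      unfolding undisturbed_def ring_time_split[of _ k] unfolding ring_time_def B_def g_def by simp
  qed
  have "prob {\<omega> \<in> space M. U \<omega> \<in> B \<and> t + e < g (U \<omega>) + W z k \<omega>}
    = exp (- e) * prob {\<omega> \<in> space M. U \<omega> \<in> B \<and> t < g (U \<omega>) + W z k \<omega>}"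
    using exponential_memoryless[OF ind, of "\<lambda>f. f (Inr (z, k))", OF _ _ Bm gm gB e]
    by (simp add: V W_exponential[OF z])
  moreover have "{\<omega> \<in> space M. undisturbed t d (\<lambda>k. W z k \<omega>) k}
      = {\<omega> \<in> space M. U \<omega> \<in> B \<and> t + d < g (U \<omega>) + W z k \<omega>}" for d
    using UB by auto
  ultimately show ?thesis by simp
qed

lemma X_prob:
  assumes "z \<in> even_sites" "s \<in> {-1, 1}"
  shows "prob {\<omega> \<in> space M. X z k \<omega> = s} = 1 / 2"
proof -
  have "prob {\<omega> \<in> space M. X z k \<omega> = s} = measure (distr M (count_space UNIV) (X z k)) {s}"
    using X_measurable[OF assms(1)] by (subst measure_distr) (auto intro!: arg_cong[where f=prob])
  also have "\<dots> = pmf (pmf_of_set {-1, 1}) s"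
    unfolding X_uniform[OF assms(1)] by (rule measure_pmf_single)
  also have "\<dots> = 1 / 2" using assms by (subst pmf_of_set) auto
  finally show ?thesis .
qed

text \<open>Whether the k-th value is in force is decided by waiting times alone, and these are
  independent of the value sampled.\<close>

lemma undisturbed_value_prob:
  assumes z: "z \<in> even_sites" and s: "s \<in> {-1, 1}"
  shows "prob {\<omega> \<in> space M. undisturbed t e (\<lambda>k. W z k \<omega>) k \<and> X z k \<omega> = s}
    = prob {\<omega> \<in> space M. undisturbed t e (\<lambda>k. W z k \<omega>) k} / 2"
proof -
  define A :: "((site \<times> nat) + (site \<times> nat)) set" where "A = Inr ` ({z} \<times> {..k})"
  define U where "U = (\<lambda>\<omega>. restrict (\<lambda>i. driver i \<omega>) A)"
  define N :: "(((site \<times> nat) + (site \<times> nat)) \<Rightarrow> real) measure" where "N = PiM A (\<lambda>_. borel)"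
  define V where "V = (\<lambda>\<omega>. restrict (\<lambda>i. driver i \<omega>) {Inl (z, k)})"
  define L :: "(((site \<times> nat) + (site \<times> nat)) \<Rightarrow> real) measure" where "L = PiM {Inl (z, k)} (\<lambda>_. borel)"
  have comp: "(\<lambda>f. f (Inr (z, i))) \<in> borel_measurable N" if "i \<le> k" for i
    unfolding N_def using that by (intro measurable_component_singleton) (auto simp: A_def)
  have ind: "indep_var N U L V"
    unfolding U_def N_def V_def L_def using z
    by (intro indep_var_restrict[OF driver_indep]) (auto simp: A_def)
  define B where "B = {f \<in> space N. (\<forall>j<k. (\<Sum>i\<le>j. f (Inr (z, i))) \<le> t) \<and> t + e < (\<Sum>i\<le>k. f (Inr (z, i)))}"
  have B_eq: "B = {f \<in> space N. t + e < (\<Sum>i\<le>k. f (Inr (z, i)))}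
      \<inter> (space N \<inter> (\<Inter>j\<in>{..<k}. {f \<in> space N. (\<Sum>i\<le>j. f (Inr (z, i))) \<le> t}))"
    by (auto simp: B_def)
  have Bm: "B \<in> sets N"
  proof -
    have "{f \<in> space N. (\<Sum>i\<le>j. f (Inr (z, i))) \<le> t} \<in> sets N" if "j < k" for j
      using that by (intro borel_measurable_le borel_measurable_sum comp borel_measurable_const) auto
    moreover have "{f \<in> space N. t + e < (\<Sum>i\<le>k. f (Inr (z, i)))} \<in> sets N"
      by (intro borel_measurable_less borel_measurable_sum comp borel_measurable_const) auto
    ultimately show ?thesis unfolding B_eq by (cases "k = 0") auto
  qed
  have Cm: "{f \<in> space L. f (Inl (z, k)) = real_of_int s} \<in> sets L" (is "?C \<in> _")
    unfolding L_def by measurable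
  have UV: "U \<omega> \<in> space N" "V \<omega> \<in> space L" if "\<omega> \<in> space M" for \<omega>
    using that measurable_space[OF indep_var_rv1[OF ind]] measurable_space[OF indep_var_rv2[OF ind]] by auto
  have "U \<omega> (Inr (z, i)) = W z i \<omega>" if "i \<le> k" for i \<omega> using that by (simp add: U_def A_def)
  then have UB: "undisturbed t e (\<lambda>k. W z k \<omega>) k \<longleftrightarrow> U \<omega> \<in> B" if "\<omega> \<in> space M" for \<omega>
    using UV[OF that] unfolding undisturbed_def ring_time_def B_def by simp
  have VC: "X z k \<omega> = s \<longleftrightarrow> V \<omega> \<in> ?C" if "\<omega> \<in> space M" for \<omega>
    using UV[OF that] by (simp add: V_def)
  have "prob ((\<lambda>\<omega>. (U \<omega>, V \<omega>)) -` (B \<times> ?C) \<inter> space M) = prob (U -` B \<inter> space M) * prob (V -` ?C \<inter> space M)"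
    by (rule indep_varD[OF ind Bm Cm])
  moreover have "(\<lambda>\<omega>. (U \<omega>, V \<omega>)) -` (B \<times> ?C) \<inter> space M
      = {\<omega> \<in> space M. undisturbed t e (\<lambda>k. W z k \<omega>) k \<and> X z k \<omega> = s}"
    using UB VC by auto
  moreover have "U -` B \<inter> space M = {\<omega> \<in> space M. undisturbed t e (\<lambda>k. W z k \<omega>) k}"
    using UB by auto
  moreover have "V -` ?C \<inter> space M = {\<omega> \<in> space M. X z k \<omega> = s}"
    using VC by auto
  ultimately show ?thesis using X_prob[OF z s] by simp
qed

text \<open>The variables have the right range only up to null sets; countability of the sites and
  indices gives one null set for all.\<close>

lemma AE_regular:
  "AE \<omega> in M. \<forall>z\<in>even_sites. \<forall>k. 0 \<le> W z k \<omega> \<and> X z k \<omega> \<in> {-1, 1}"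
proof -
  have "AE \<omega> in M. 0 \<le> W z k \<omega> \<and> X z k \<omega> \<in> {-1, 1}" if z: "z \<in> even_sites" for z k
  proof -
    have "prob {\<omega> \<in> space M. 0 < W z k \<omega>} = 1"
      using exponential_distributedD_gt[OF W_exponential[OF z], of 0 k] by simp
    then have "AE \<omega> in M. 0 < W z k \<omega>"
      using W_measurable[OF z] by (subst (asm) prob_Collect_eq_1) auto
    moreover have "AE \<omega> in M. X z k \<omega> \<in> {-1, 1}"
    proof -
      have "AE s in distr M (count_space UNIV) (X z k). s \<in> {-1, 1}"
        unfolding X_uniform[OF z] by (simp add: AE_measure_pmf_iff)
      then show ?thesis using X_measurable[OF z] by (subst (asm) AE_distr_iff) auto
    qed
    ultimately show ?thesis by eventually_elim auto
  qed
  then show ?thesis by (intro AE_ball_countable' AE_all_countable[THEN iffD2] allI) auto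
qed

text \<open>For e = 0 the index k counts the rings up to t, so the claim is that the clock does not
  explode. It suffices that some single waiting time exceeds t: n + 1 independent ones all fail to
  with probability (1 - exp(-t))^(n+1).\<close>

lemma undisturbed_0_sums:
  assumes z: "z \<in> even_sites" and t: "0 \<le> t"
  shows "(\<lambda>k. prob {\<omega> \<in> space M. undisturbed t 0 (\<lambda>k. W z k \<omega>) k}) sums 1"
proof -
  define x where "x = 1 - exp (- t)"
  have x: "0 \<le> x" "x < 1" using t by (auto simp: x_def)
  define F where "F = {\<omega> \<in> space M. \<forall>j. W z j \<omega> \<le> t}"
  have Fm: "F \<in> sets M" unfolding F_def using W_measurable[OF z] by measurable
  have "prob F \<le> x ^ Suc n" for n
  proof -
    have 1: "prob (W z j -` {..t} \<inter> space M) = x" for j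
    proof -
      have "W z j -` {..t} \<inter> space M = space M - {\<omega> \<in> space M. t < W z j \<omega>}" by auto
      then have "prob (W z j -` {..t} \<inter> space M) = 1 - prob {\<omega> \<in> space M. t < W z j \<omega>}"
        using W_measurable[OF z] by (simp add: prob_compl)
      then show ?thesis using exponential_distributedD_gt[OF W_exponential[OF z] t] by (simp add: x_def)
    qed
    have "prob F \<le> prob (\<Inter>i\<in>(\<lambda>j. Inr (z, j)) ` {..n}. driver i -` {..t} \<inter> space M)"
      using W_measurable[OF z] by (intro finite_measure_mono sets.finite_INT) (auto simp: F_def)
    also have "\<dots> = (\<Prod>i\<in>(\<lambda>j. Inr (z, j)) ` {..n}. prob (driver i -` {..t} \<inter> space M))"
      using z by (intro indep_varsD[OF driver_indep]) auto
    also have "\<dots> = x ^ Suc n" by (subst prod.reindex) (auto simp: inj_on_def 1)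
    finally show ?thesis .
  qed
  moreover have "(\<lambda>n. x ^ Suc n) \<longlonglongrightarrow> 0" using x by (intro LIMSEQ_Suc LIMSEQ_power_zero) auto
  ultimately have "prob F \<le> 0" by (intro LIMSEQ_le_const[of _ 0]) auto
  then have "AE \<omega> in M. \<omega> \<notin> F"
    using Fm by (intro AE_not_in) (auto simp: null_sets_def emeasure_eq_measure measure_le_0_iff)
  then have "AE \<omega> in M. \<exists>k. undisturbed t 0 (\<lambda>k. W z k \<omega>) k"
    using AE_regular AE_space
  proof eventually_elim
    case (elim \<omega>)
    then obtain j where "t < W z j \<omega>" by (auto simp: F_def not_le)
    moreover have "0 \<le> (\<Sum>i<j. W z i \<omega>)" using elim z by (intro sum_nonneg) auto
    ultimately have ex: "t < ring_time (\<lambda>k. W z k \<omega>) j" by (simp add: ring_time_split)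
    define k where "k = (LEAST j. t < ring_time (\<lambda>k. W z k \<omega>) j)"
    have "t < ring_time (\<lambda>k. W z k \<omega>) k" unfolding k_def by (rule LeastI) fact
    moreover have "\<forall>j<k. ring_time (\<lambda>k. W z k \<omega>) j \<le> t" unfolding k_def by (auto dest: not_less_Least)
    ultimately show ?case by (auto simp: undisturbed_def)
  qed
  then have "prob {\<omega> \<in> space M. \<exists>k. undisturbed t 0 (\<lambda>k. W z k \<omega>) k} = 1"
    using sets.sets_Collect_countable_Ex[OF undisturbed_event[OF z]] by (subst prob_Collect_eq_1) auto
  also have "{\<omega> \<in> space M. \<exists>k. undisturbed t 0 (\<lambda>k. W z k \<omega>) k}
      = (\<Union>k. {\<omega> \<in> space M. undisturbed t 0 (\<lambda>k. W z k \<omega>) k})" by auto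
  finally have "prob (\<Union>k. {\<omega> \<in> space M. undisturbed t 0 (\<lambda>k. W z k \<omega>) k}) = 1" .
  moreover have "(\<lambda>k. prob {\<omega> \<in> space M. undisturbed t 0 (\<lambda>k. W z k \<omega>) k})
      sums prob (\<Union>k. {\<omega> \<in> space M. undisturbed t 0 (\<lambda>k. W z k \<omega>) k})"
    using undisturbed_event[OF z] undisturbed_unique[of 0 t]
    by (intro finite_measure_UNION) (auto simp: disjoint_family_on_def)
  ultimately show ?thesis by simp
qed

definition state :: "real \<Rightarrow> real \<Rightarrow> site \<Rightarrow> 'w \<Rightarrow> int" where
  "state t e z \<omega> = trit t e (\<lambda>k. real_of_int (X z k \<omega>)) (\<lambda>k. W z k \<omega>)"

lemma state_measurable: "z \<in> even_sites \<Longrightarrow> state t e z \<in> measurable M (count_space UNIV)"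
  unfolding state_def using W_measurable X_real_measurable by (intro trit_measurable) auto

text \<open>At most one index is undisturbed, so the event is a disjoint union over k; each part has
  probability exp(-e)/2 times that of k rings up to t.\<close>

lemma state_prob_pm:
  assumes z: "z \<in> even_sites" and s: "s \<in> {-1, 1}" and e: "0 \<le> e" and t: "0 \<le> t"
  shows "prob {\<omega> \<in> space M. state t e z \<omega> = s} = exp (- e) / 2"
proof -
  let ?E = "\<lambda>k. {\<omega> \<in> space M. undisturbed t e (\<lambda>k. W z k \<omega>) k \<and> X z k \<omega> = s}"
  have m: "?E k \<in> sets M" for k
  proof -
    have "?E k = {\<omega> \<in> space M. undisturbed t e (\<lambda>k. W z k \<omega>) k} \<inter> (X z k -` {s} \<inter> space M)" by auto
    then show ?thesis using undisturbed_event[OF z] measurable_sets[OF X_measurable[OF z]] by auto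
  qed
  have "{\<omega> \<in> space M. state t e z \<omega> = s} = (\<Union>k. ?E k)"
  proof -
    have "state t e z \<omega> = s \<longleftrightarrow> (\<exists>k. undisturbed t e (\<lambda>k. W z k \<omega>) k \<and> X z k \<omega> = s)" for \<omega>
    proof (cases "\<exists>k. undisturbed t e (\<lambda>k. W z k \<omega>) k")
      case True
      then obtain k where "undisturbed t e (\<lambda>k. W z k \<omega>) k" by blast
      then have "undisturbed t e (\<lambda>k. W z k \<omega>) k' \<longleftrightarrow> k' = k" for k'
        using undisturbed_unique[OF e] by blast
      then show ?thesis using s by (auto simp: state_def trit_def)
    next
      case False
      then show ?thesis using s by (auto simp: state_def trit_def)
    qed
    then show ?thesis by auto
  qed
  moreover have "(\<lambda>k. prob (?E k)) sums prob (\<Union>k. ?E k)"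
    using m undisturbed_unique[OF e, of t]
    by (intro finite_measure_UNION) (auto simp: disjoint_family_on_def)
  moreover have "(\<lambda>k. prob (?E k)) sums (exp (- e) / 2)"
    using sums_mult[OF undisturbed_0_sums[OF z t], of "exp (- e) / 2"]
    by (simp add: undisturbed_value_prob[OF z s] undisturbed_prob[OF z e t])
  ultimately show ?thesis by (auto dest: sums_unique2)
qed

lemma state_prob:
  assumes z: "z \<in> even_sites" and v: "v \<in> trits" and e: "0 \<le> e" and t: "0 \<le> t"
  shows "prob {\<omega> \<in> space M. state t e z \<omega> = v} = (if v = 0 then 1 - exp (- e) else exp (- e) / 2)"
proof (cases "v = 0")
  case True
  have m: "{\<omega> \<in> space M. state t e z \<omega> = s} \<in> sets M" for s
  proof -
    have "state t e z -` {s} \<inter> space M \<in> sets M"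
      using measurable_sets[OF state_measurable[OF z]] by auto
    moreover have "state t e z -` {s} \<inter> space M = {\<omega> \<in> space M. state t e z \<omega> = s}" by auto
    ultimately show ?thesis by simp
  qed
  have "{\<omega> \<in> space M. state t e z \<omega> = 0}
      = space M - ({\<omega> \<in> space M. state t e z \<omega> = 1} \<union> {\<omega> \<in> space M. state t e z \<omega> = -1})"
    using trit_range unfolding state_def trits_def by auto
  then have "prob {\<omega> \<in> space M. state t e z \<omega> = 0}
      = 1 - prob ({\<omega> \<in> space M. state t e z \<omega> = 1} \<union> {\<omega> \<in> space M. state t e z \<omega> = -1})"
    using m by (simp add: prob_compl)
  also have "\<dots> = 1 - (exp (- e) / 2 + exp (- e) / 2)"
    using m state_prob_pm[OF z _ e t, of 1] state_prob_pm[OF z _ e t, of "-1"]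
    by (subst finite_measure_Union) auto
  finally show ?thesis using True by simp
next
  case False
  then show ?thesis using state_prob_pm[OF z _ e t, of v] v by (auto simp: trits_def)
qed

text \<open>The state at z is a measurable function of the variables attached to z, and these blocks
  are disjoint for different sites.\<close>

lemma state_indep: "indep_vars (\<lambda>_. count_space UNIV) (state t e) even_sites"
proof -
  define K :: "site \<Rightarrow> ((site \<times> nat) + (site \<times> nat)) set" where "K = (\<lambda>z. ({z} \<times> UNIV) <+> ({z} \<times> UNIV))"
  define G :: "site \<Rightarrow> (((site \<times> nat) + (site \<times> nat)) \<Rightarrow> real) \<Rightarrow> int"
    where "G = (\<lambda>z f. trit t e (\<lambda>k. f (Inl (z, k))) (\<lambda>k. f (Inr (z, k))))"
  have "indep_vars (\<lambda>z. PiM (K z) (\<lambda>_. borel)) (\<lambda>z \<omega>. restrict (\<lambda>i. driver i \<omega>) (K z)) even_sites"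
    by (intro indep_vars_restrict[OF driver_indep]) (auto simp: K_def disjoint_family_on_def)
  then have "indep_vars (\<lambda>_. count_space UNIV) (\<lambda>z \<omega>. G z (restrict (\<lambda>i. driver i \<omega>) (K z))) even_sites"
  proof (rule indep_vars_compose2)
    fix z
    show "G z \<in> measurable (PiM (K z) (\<lambda>_. borel)) (count_space UNIV)"
      unfolding G_def by (intro trit_measurable measurable_component_singleton) (auto simp: K_def)
  qed
  moreover have "(\<lambda>z \<omega>. G z (restrict (\<lambda>i. driver i \<omega>) (K z))) = state t e"
  proof -
    have "Inl (z, k) \<in> K z" "Inr (z, k) \<in> K z" for z k by (auto simp: K_def)
    then show ?thesis by (intro ext) (simp add: G_def state_def)
  qed
  ultimately show ?thesis by simp
qed

end

section \<open>Covering by dyadic intervals\<close>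

text \<open>\<open>H i j\<close> marks the j-th dyadic interval of level i. Level i only looks at
  the window [0, i], which grows to exhaust the unbounded half-line and adds just a factor i to the
  count.\<close>

definition dyadic_cost :: "real \<Rightarrow> (nat \<Rightarrow> nat \<Rightarrow> bool) \<Rightarrow> nat \<Rightarrow> real" where
  "dyadic_cost s H i = (\<Sum>j<i * 2 ^ i. of_bool (H i j) * 2 powr (- s * real i))"

lemma dyadic_cost_nonneg: "0 \<le> dyadic_cost s H i"
  by (auto simp: dyadic_cost_def intro: sum_nonneg)

lemma dyadic_interval:
  assumes "0 \<le> \<tau>" "\<tau> < real i"
  obtains j :: nat where "j < i * 2 ^ i" "real j / 2 ^ i \<le> \<tau>" "\<tau> \<le> real (Suc j) / 2 ^ i"
proof
  define j where "j = nat \<lfloor>\<tau> * 2 ^ i\<rfloor>"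
  have j: "real j \<le> \<tau> * 2 ^ i" "\<tau> * 2 ^ i < real j + 1"
    using assms by (auto simp: j_def of_nat_nat)
  show "real j / 2 ^ i \<le> \<tau>" "\<tau> \<le> real (Suc j) / 2 ^ i" using j by (auto simp: field_simps)
  have "real j < real i * 2 ^ i" using j(1) assms by (meson le_less_trans mult_strict_right_mono zero_less_numeral zero_less_power)
  also have "\<dots> = real (i * 2 ^ i)" by simp
  finally show "j < i * 2 ^ i" by (simp only: of_nat_less_iff)
qed

text \<open>For s = 0 the cost counts marked intervals; a summable count is eventually below 1,
  while a point of T below i contributes 1 at level i.\<close>

lemma empty_if_summable_cost:
  assumes T: "T \<subseteq> {0..}" and sm: "summable (dyadic_cost 0 H)"
    and cov: "\<And>\<tau> i j. \<tau> \<in> T \<Longrightarrow> real j / 2 ^ i \<le> \<tau> \<Longrightarrow> \<tau> \<le> real (Suc j) / 2 ^ i \<Longrightarrow> H i j"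
  shows "T = {}"
proof (rule ccontr)
  assume "T \<noteq> {}"
  then obtain \<tau> where \<tau>: "\<tau> \<in> T" "0 \<le> \<tau>" using T by auto
  have "dyadic_cost 0 H \<longlonglongrightarrow> 0" using sm by (rule summable_LIMSEQ_zero)
  then have "eventually (\<lambda>i. dyadic_cost 0 H i < 1) sequentially" by (rule order_tendstoD) simp
  moreover have "eventually (\<lambda>i. \<tau> < real i) sequentially"
    by real_asymp
  ultimately obtain i where i: "dyadic_cost 0 H i < 1" "\<tau> < real i"
    by (metis (mono_tags, lifting) eventually_conj eventually_happens sequentially_bot)
  obtain j where j: "j < i * 2 ^ i" "real j / 2 ^ i \<le> \<tau>" "\<tau> \<le> real (Suc j) / 2 ^ i"
    using dyadic_interval[OF \<tau>(2) i(2)] by blast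
  have "(1::real) = of_bool (H i j) * 2 powr (- 0 * real i)" using cov[OF \<tau>(1) j(2,3)] by simp
  also have "\<dots> \<le> dyadic_cost 0 H i" unfolding dyadic_cost_def
    using j(1) by (intro member_le_sum) auto
  finally show False using i(1) by simp
qed

text \<open>The cover uses the marked intervals of all levels from n on at once, since a point is
  caught only at levels exceeding it. Its total gauge is a tail of the convergent series.\<close>

lemma hausdorff_measure_0_if_summable_cost:
  fixes T :: "real set"
  assumes T: "T \<subseteq> {0..}" and s: "0 < s" and sm: "summable (dyadic_cost s H)"
    and cov: "\<And>\<tau> i j. \<tau> \<in> T \<Longrightarrow> real j / 2 ^ i \<le> \<tau> \<Longrightarrow> \<tau> \<le> real (Suc j) / 2 ^ i \<Longrightarrow> H i j"
  shows "hausdorff_measure s T = 0"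
proof -
  have small: "hausdorff_premeasure s \<delta> T \<le> ennreal \<epsilon>" if \<delta>: "0 < \<delta>" and \<epsilon>: "0 < \<epsilon>" for \<delta> \<epsilon>
  proof -
    obtain n1 where n1: "\<And>n. n1 \<le> n \<Longrightarrow> norm (\<Sum>i. dyadic_cost s H (i + n)) < \<epsilon>"
      using suminf_exist_split[OF \<epsilon> sm] by blast
    have "(\<lambda>n. 1 / 2 ^ n :: real) \<longlonglongrightarrow> 0" by real_asymp
    then have "eventually (\<lambda>n. 1 / 2 ^ n < \<delta>) sequentially" using \<delta> by (rule order_tendstoD)
    then obtain n2 where n2: "\<And>n. n2 \<le> n \<Longrightarrow> 1 / 2 ^ n < \<delta>" by (auto simp: eventually_sequentially)
    define n where "n = max n1 n2"
    have le: "real j / 2 ^ i \<le> real (Suc j) / 2 ^ i" for i j :: nat by (intro divide_right_mono) auto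
    have diam: "diameter {a..b} = b - a" if "a \<le> b" for a b :: real using that by simp
    define V where "V = (\<lambda>(i, j). if n \<le> i \<and> j < i * 2 ^ i \<and> H i j
      then {real j / 2 ^ i .. real (Suc j) / 2 ^ i} else {})"
    have V1: "V (i, j) = {real j / 2 ^ i .. real (Suc j) / 2 ^ i}" if "n \<le> i \<and> j < i * 2 ^ i \<and> H i j" for i j
      using that by (simp add: V_def)
    have "hausdorff_premeasure s \<delta> T \<le> (\<Sum>m. hausdorff_gauge s (V (prod_decode m)))"
      unfolding hausdorff_premeasure_def
    proof (rule INF_lower, simp, intro conjI allI)
      show "T \<subseteq> (\<Union>m. V (prod_decode m))"
      proof
        fix \<tau> assume \<tau>: "\<tau> \<in> T"
        then have "0 \<le> \<tau>" using T by auto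
        obtain i where i: "n \<le> i" "\<tau> < real i"
          by (metis le_cases less_le_trans linorder_not_le of_nat_mono reals_Archimedean2)
        obtain j where j: "j < i * 2 ^ i" "real j / 2 ^ i \<le> \<tau>" "\<tau> \<le> real (Suc j) / 2 ^ i"
          using dyadic_interval[OF \<open>0 \<le> \<tau>\<close> i(2)] by blast
        have "\<tau> \<in> V (i, j)" using i j cov[OF \<tau> j(2,3)] by (simp add: V_def)
        then have "\<tau> \<in> V (prod_decode (prod_encode (i, j)))" by simp
        then show "\<tau> \<in> (\<Union>m. V (prod_decode m))" by blast
      qed
      fix m
      obtain i j where m: "prod_decode m = (i, j)" by fastforce
      show "bounded (V (prod_decode m))" unfolding m V_def by auto
      show "diameter (V (prod_decode m)) \<le> \<delta>"
      proof (cases "n \<le> i \<and> j < i * 2 ^ i \<and> H i j")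
        case True
        then have "diameter (V (prod_decode m)) = real (Suc j) / 2 ^ i - real j / 2 ^ i"
          unfolding m by (simp only: V1 diam[OF le])
        also have "\<dots> = 1 / 2 ^ i" by (simp add: field_simps)
        also have "\<dots> < \<delta>" using True by (intro n2) (simp add: n_def)
        finally show ?thesis by simp
      next
        case False
        then have "V (prod_decode m) = {}" unfolding m V_def by auto
        then show ?thesis using \<delta> by simp
      qed
    qed
    also have "\<dots> = (\<Sum>i. \<Sum>j. hausdorff_gauge s (V (i, j)))"
      by (rule suminf_ennreal_2dimen[where f="\<lambda>p. hausdorff_gauge s (V p)"]) simp
    also have "\<dots> = (\<Sum>i. if n \<le> i then ennreal (dyadic_cost s H i) else 0)"
    proof (rule suminf_cong)
      fix i
      have gauge: "hausdorff_gauge s (V (i, j))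
        = (if n \<le> i \<and> j < i * 2 ^ i then ennreal (of_bool (H i j) * 2 powr (- s * real i)) else 0)" for j
      proof (cases "n \<le> i \<and> j < i * 2 ^ i \<and> H i j")
        case True
        have "real (Suc j) / 2 ^ i - real j / 2 ^ i = 2 powr (- real i)"
          by (simp add: field_simps powr_minus powr_realpow)
        then have "diameter (V (i, j)) = 2 powr (- real i)"
          using True by (simp only: V1 diam[OF le])
        then have "diameter (V (i, j)) powr s = 2 powr (- s * real i)"
          by (simp add: powr_powr mult.commute)
        moreover have "V (i, j) \<noteq> {}" using True le[of j i] by (simp only: V1) simp
        ultimately show ?thesis using True s by (simp add: hausdorff_gauge_def)
      next
        case False
        then have "V (i, j) = {}" by (auto simp: V_def)
        then show ?thesis using False by (auto simp: hausdorff_gauge_def)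
      qed
      have "(\<Sum>j. hausdorff_gauge s (V (i, j))) = (\<Sum>j<i * 2 ^ i. hausdorff_gauge s (V (i, j)))"
        by (intro suminf_finite) (auto simp: gauge)
      also have "\<dots> = (if n \<le> i then ennreal (dyadic_cost s H i) else 0)"
        unfolding gauge dyadic_cost_def by (auto intro!: sum_ennreal)
      finally show "(\<Sum>j. hausdorff_gauge s (V (i, j))) = (if n \<le> i then ennreal (dyadic_cost s H i) else 0)" .
    qed
    also have "\<dots> = (\<Sum>i. ennreal (dyadic_cost s H (i + n)))"
      by (subst suminf_offset[where i=n]) (auto intro: summableI)
    also have "\<dots> = ennreal (\<Sum>i. dyadic_cost s H (i + n))"
      using sm dyadic_cost_nonneg by (intro suminf_ennreal2 summable_ignore_initial_segment) auto
    also have "\<dots> \<le> ennreal \<epsilon>" using n1[of n] by (intro ennreal_leI) (auto simp: n_def)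
    finally show ?thesis .
  qed
  have "hausdorff_premeasure s \<delta> T \<le> 0" if "0 < \<delta>" for \<delta>
    by (rule ennreal_le_epsilon) (simp add: small that)
  then have "hausdorff_measure s T \<le> 0"
    unfolding hausdorff_measure_def by (intro SUP_least) simp
  then show ?thesis by simp
qed

lemma summable_linear_times_power:
  fixes \<rho> :: real assumes "0 \<le> \<rho>" "\<rho> < 1"
  shows "summable (\<lambda>i. real i * \<rho> ^ i)"
proof (rule summable_comparison_test')
  show "summable (\<lambda>i. real (Suc i) * \<rho> ^ i)"
    using geometric_deriv_sums[of \<rho>] assms by (auto simp: sums_iff)
  show "norm (real i * \<rho> ^ i) \<le> real (Suc i) * \<rho> ^ i" if "0 \<le> i" for i
    using assms by (simp add: mult_right_mono)
qed

section \<open>First moment estimate and conclusion\<close>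

context dynamical_discrete_web
begin

text \<open>Setting the field to 0 outside the box matches the convention of
  \<open>field_avg\<close>, so that the probability becomes a field average.\<close>

definition near_event :: "real \<Rightarrow> real \<Rightarrow> nat \<Rightarrow> nat \<Rightarrow> 'w set" where
  "near_event K\<^sub>L K\<^sub>R i j = {\<omega> \<in> space M. two_sided_survives K\<^sub>L K\<^sub>R (4 ^ i)
     (\<lambda>z. if z \<in> space_time_box (4 ^ i) then state (real j / 2 ^ i) (1 / 2 ^ i) z \<omega> else 0)}"

lemma near_event_decay:
  assumes K: "0 < K\<^sub>L" "0 < K\<^sub>R" and q: "0 < q\<^sub>L" "q\<^sub>L < exponent K\<^sub>L" "0 < q\<^sub>R" "q\<^sub>R < exponent K\<^sub>R"
  obtains C where "0 \<le> C" "\<And>i j. near_event K\<^sub>L K\<^sub>R i j \<in> sets M"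
    "\<And>i j. prob (near_event K\<^sub>L K\<^sub>R i j) \<le> C * 2 powr (- (q\<^sub>L + q\<^sub>R) * real i)"
proof -
  obtain C where C: "0 \<le> C" "\<And>i \<delta> w zs. trit_weights w \<Longrightarrow> w (-1) = (1 - \<delta>) / 2 \<Longrightarrow> w 1 = (1 - \<delta>) / 2 \<Longrightarrow>
      0 \<le> \<delta> \<Longrightarrow> \<delta> \<le> 1 / 2 ^ i \<Longrightarrow> set zs = space_time_box (4 ^ i) \<Longrightarrow>
      field_avg w zs (\<lambda>y. of_bool (two_sided_survives K\<^sub>L K\<^sub>R (4 ^ i) y)) \<le> C * 2 powr (- (q\<^sub>L + q\<^sub>R) * real i)"
    using two_sided_survival_decay[OF K q] by blast
  have "near_event K\<^sub>L K\<^sub>R i j \<in> sets M \<and> prob (near_event K\<^sub>L K\<^sub>R i j) \<le> C * 2 powr (- (q\<^sub>L + q\<^sub>R) * real i)" for i j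
  proof -
    obtain zs where zs: "set zs = space_time_box (4 ^ i)" "distinct zs"
      using finite_distinct_list[OF finite_space_time_box] by metis
    have even: "set zs \<subseteq> even_sites" unfolding zs by (auto simp: space_time_box_def even_sites_def)
    define e :: real where "e = 1 / 2 ^ i"
    define t where "t = real j / 2 ^ i"
    define w where "w = (\<lambda>v::int. if v = 0 then 1 - exp (- e) else exp (- e) / 2)"
    define Q where "Q = (\<lambda>y. two_sided_survives K\<^sub>L K\<^sub>R (4 ^ i) y)"
    have et: "0 \<le> e" "0 \<le> t" by (simp_all add: e_def t_def)
    interpret w: trit_weights w
      by unfold_locales (use et in \<open>auto simp: w_def trits_def\<close>)
    have law: "prob {\<omega> \<in> space M. state t e z \<omega> = v} = w v" if "z \<in> even_sites" "v \<in> trits" for z v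
      unfolding w_def by (rule state_prob[OF that et])
    have rng: "state t e z \<omega> \<in> trits" for z \<omega> unfolding state_def by (rule trit_range)
    have eq: "near_event K\<^sub>L K\<^sub>R i j = {\<omega> \<in> space M. Q (\<lambda>z. if z \<in> set zs then state t e z \<omega> else 0)}"
      unfolding near_event_def Q_def t_def e_def zs ..
    have "near_event K\<^sub>L K\<^sub>R i j \<in> sets M \<and> prob (near_event K\<^sub>L K\<^sub>R i j)
      = field_avg w zs (\<lambda>\<eta>. of_bool (Q (\<lambda>z. if z \<in> set zs then \<eta> z else 0)))"
      unfolding eq
      using field_law[where Y="state t e" and w=w and P=Q and zs=zs and J="{}" and y="\<lambda>_. 0",
          OF state_indep law rng] zs even by simp
    moreover have "field_avg w zs (\<lambda>\<eta>. of_bool (Q (\<lambda>z. if z \<in> set zs then \<eta> z else 0)))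
        = field_avg w zs (\<lambda>y. of_bool (Q y))"
      by (rule w.field_avg_vanishing[symmetric])
    moreover have "\<dots> \<le> C * 2 powr (- (q\<^sub>L + q\<^sub>R) * real i)"
      unfolding Q_def
    \<comment> \<open>The drift is the probability that an arrow is undecided, which is at most the
      length e of the interval.\<close>
    proof (rule C(2)[of w "1 - exp (- e)"])
      show "1 - exp (- e) \<le> 1 / 2 ^ i" using exp_ge_add_one_self[of "- e"] by (simp add: e_def)
    qed (use et w.trit_weights_axioms zs in \<open>auto simp: w_def\<close>)
    ultimately show ?thesis by simp
  qed
  then show ?thesis using that C(1) by blast
qed

text \<open>Level i has i 2^i intervals, each of weight 2^(-si) and marked with probability at most
  C 2^(-(\<open>q\<^sub>L\<close> + \<open>q\<^sub>R\<close>) i), so the expected cost is at most C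
  i \<rho>^i. The value s = 0 is covered when the two exponents sum to more than 1.\<close>

lemma AE_summable_cost:
  assumes K: "0 < K\<^sub>L" "0 < K\<^sub>R" and s: "1 - exponent K\<^sub>L - exponent K\<^sub>R < s"
  shows "AE \<omega> in M. summable (dyadic_cost s (\<lambda>i j. \<omega> \<in> near_event K\<^sub>L K\<^sub>R i j))"
proof -
  define \<eta> where "\<eta> = s - (1 - exponent K\<^sub>L - exponent K\<^sub>R)"
  \<comment> \<open>Giving up at most \<eta>/3 in each exponent leaves s + \<open>q\<^sub>L\<close>
    + \<open>q\<^sub>R\<close> \<ge> 1 + \<eta>/3; the second entry of the minimum keeps the
    exponents positive.\<close>
  define q\<^sub>L where "q\<^sub>L = exponent K\<^sub>L - min (\<eta> / 3) (exponent K\<^sub>L / 2)"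
  define q\<^sub>R where "q\<^sub>R = exponent K\<^sub>R - min (\<eta> / 3) (exponent K\<^sub>R / 2)"
  note pL = exponent_properties[OF K(1)] and pR = exponent_properties[OF K(2)]
  have \<eta>: "0 < \<eta>" using s by (simp add: \<eta>_def)
  have q: "0 < q\<^sub>L" "q\<^sub>L < exponent K\<^sub>L" "0 < q\<^sub>R" "q\<^sub>R < exponent K\<^sub>R"
    using pL pR \<eta> by (auto simp: q\<^sub>L_def q\<^sub>R_def min_def)
  have qs: "1 < s + q\<^sub>L + q\<^sub>R"
    using \<eta> min.cobounded1[of "\<eta> / 3" "exponent K\<^sub>L / 2"] min.cobounded1[of "\<eta> / 3" "exponent K\<^sub>R / 2"]
    unfolding q\<^sub>L_def q\<^sub>R_def by (simp add: \<eta>_def)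
  obtain C where C: "0 \<le> C" and m: "\<And>i j. near_event K\<^sub>L K\<^sub>R i j \<in> sets M"
    and b: "\<And>i j. prob (near_event K\<^sub>L K\<^sub>R i j) \<le> C * 2 powr (- (q\<^sub>L + q\<^sub>R) * real i)"
    using near_event_decay[OF K q] by metis
  define \<rho> :: real where "\<rho> = 2 powr (1 - s - q\<^sub>L - q\<^sub>R)"
  have \<rho>: "0 \<le> \<rho>" "\<rho> < 1" using qs powr_less_mono[of "1 - s - q\<^sub>L - q\<^sub>R" 0 2] by (auto simp: \<rho>_def)
  define c where "c = (\<lambda>i \<omega>. dyadic_cost s (\<lambda>i j. \<omega> \<in> near_event K\<^sub>L K\<^sub>R i j) i)"
  have c_eq: "ennreal (c i \<omega>) = (\<Sum>j<i * 2 ^ i. ennreal (2 powr (- s * real i)) * indicator (near_event K\<^sub>L K\<^sub>R i j) \<omega>)" for i \<omega>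
  proof -
    have "ennreal (c i \<omega>) = (\<Sum>j<i * 2 ^ i. ennreal (of_bool (\<omega> \<in> near_event K\<^sub>L K\<^sub>R i j) * 2 powr (- s * real i)))"
      unfolding c_def dyadic_cost_def by (rule sum_ennreal[symmetric]) simp
    also have "\<dots> = (\<Sum>j<i * 2 ^ i. ennreal (2 powr (- s * real i)) * indicator (near_event K\<^sub>L K\<^sub>R i j) \<omega>)"
      by (intro sum.cong refl) (simp add: indicator_def)
    finally show ?thesis .
  qed
  have cm: "(\<lambda>\<omega>. ennreal (c i \<omega>)) \<in> borel_measurable M" for i
    unfolding c_eq using m by measurable
  have ci: "(\<integral>\<^sup>+\<omega>. ennreal (c i \<omega>) \<partial>M) \<le> ennreal (C * (real i * \<rho> ^ i))" for i
  proof -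
    have "(\<integral>\<^sup>+\<omega>. ennreal (c i \<omega>) \<partial>M) = (\<Sum>j<i * 2 ^ i. ennreal (2 powr (- s * real i)) * emeasure M (near_event K\<^sub>L K\<^sub>R i j))"
      unfolding c_eq using m by (subst nn_integral_sum) (auto simp: nn_integral_cmult_indicator)
    also have "\<dots> \<le> (\<Sum>j<i * 2 ^ i. ennreal (2 powr (- s * real i) * (C * 2 powr (- (q\<^sub>L + q\<^sub>R) * real i))))"
      using b by (intro sum_mono) (auto simp: emeasure_eq_measure ennreal_mult'[symmetric] intro!: ennreal_leI mult_left_mono)
    also have "\<dots> = ennreal (real (i * 2 ^ i) * (2 powr (- s * real i) * (C * 2 powr (- (q\<^sub>L + q\<^sub>R) * real i))))"
      using C by (subst sum_ennreal) auto
    also have "real (i * 2 ^ i) * (2 powr (- s * real i) * (C * 2 powr (- (q\<^sub>L + q\<^sub>R) * real i)))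
        = C * (real i * \<rho> ^ i)"
    proof -
      have "\<rho> ^ i = 2 powr ((1 - s - q\<^sub>L - q\<^sub>R) * real i)" by (simp add: \<rho>_def powr_powr flip: powr_realpow)
      also have "(1 - s - q\<^sub>L - q\<^sub>R) * real i = real i + - s * real i + - (q\<^sub>L + q\<^sub>R) * real i" by (simp add: algebra_simps)
      also have "2 powr (real i + - s * real i + - (q\<^sub>L + q\<^sub>R) * real i)
          = 2 ^ i * 2 powr (- s * real i) * 2 powr (- (q\<^sub>L + q\<^sub>R) * real i)"
        by (simp only: powr_add powr_realpow zero_less_numeral)
      finally show ?thesis by simp
    qed
    finally show ?thesis .
  qed
  have "(\<integral>\<^sup>+\<omega>. (\<Sum>i. ennreal (c i \<omega>)) \<partial>M) = (\<Sum>i. \<integral>\<^sup>+\<omega>. ennreal (c i \<omega>) \<partial>M)"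
    using cm by (rule nn_integral_suminf)
  also have "\<dots> \<le> (\<Sum>i. ennreal (C * (real i * \<rho> ^ i)))"
    using ci by (intro suminf_le) (auto intro: summableI)
  also have "\<dots> = ennreal (\<Sum>i. C * (real i * \<rho> ^ i))"
    using C \<rho> summable_linear_times_power[OF \<rho>] by (intro suminf_ennreal2 summable_mult) auto
  finally have "(\<integral>\<^sup>+\<omega>. (\<Sum>i. ennreal (c i \<omega>)) \<partial>M) \<noteq> \<infinity>"
    by (auto simp: top_unique)
  then have "AE \<omega> in M. (\<Sum>i. ennreal (c i \<omega>)) \<noteq> \<infinity>"
    using cm by (intro nn_integral_PInf_AE) auto
  then show ?thesis
  proof eventually_elim
    case (elim \<omega>)
    then have "summable (\<lambda>i. c i \<omega>)"
      by (intro summable_suminf_not_top) (auto simp: c_def dyadic_cost_nonneg)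
    then show ?case by (simp add: c_def)
  qed
qed

text \<open>At a decided site the field at time \<tau> has the recorded value; at any other site,
  including those outside the box, it lies between the extreme choices. Hence the actual path is
  squeezed between the two extreme paths.\<close>

lemma near_event_covers:
  assumes reg: "\<forall>z\<in>even_sites. \<forall>k. 0 \<le> W z k \<omega> \<and> X z k \<omega> \<in> {-1, 1}" and \<omega>: "\<omega> \<in> space M"
    and K: "0 \<le> K\<^sub>L" "0 \<le> K\<^sub>R" and \<tau>: "real j / 2 ^ i \<le> \<tau>" "\<tau> \<le> real (Suc j) / 2 ^ i"
    and T: "\<tau> \<in> T1_minus (arrow X W \<omega>) K\<^sub>L \<inter> T1_plus (arrow X W \<omega>) K\<^sub>R"
  shows "\<omega> \<in> near_event K\<^sub>L K\<^sub>R i j"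
proof -
  define e :: real where "e = 1 / 2 ^ i"
  define t where "t = real j / 2 ^ i"
  define a where "a = arrow X W \<omega> \<tau>"
  define y where "y = (\<lambda>z. if z \<in> space_time_box (4 ^ i) then state t e z \<omega> else 0)"
  have t: "0 \<le> e" "t \<le> \<tau>" "\<tau> \<le> t + e" using \<tau> by (auto simp: t_def e_def add_divide_distrib)
  have arange: "a z \<in> {-1, 1}" if "z \<in> even_sites" for z
    using reg that by (simp add: a_def arrow_def)
  have frozen: "a z = X z k \<omega>" if "z \<in> even_sites" "undisturbed t e (\<lambda>k. W z k \<omega>) k" for z k
    using undisturbed_value[OF t(1) that(2) _ t(2,3)] reg that(1) by (simp add: a_def arrow_def)
  have y: "y z \<in> {-1, 1} \<Longrightarrow> a z = y z" if "z \<in> even_sites" for z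
    using frozen[OF that] by (auto simp: y_def state_def trit_def split: if_splits)
  have le: "a z \<le> extreme_field 1 y z" "extreme_field (-1) y z \<le> a z" if z: "z \<in> even_sites" for z
  proof -
    have "y z \<in> trits" using trit_range by (auto simp: y_def state_def trits_def)
    then have "y z = 0 \<or> y z \<in> {-1, 1}" by (auto simp: trits_def)
    then show "a z \<le> extreme_field 1 y z" "extreme_field (-1) y z \<le> a z"
      using arange[OF z] y[OF z] by (auto simp: extreme_field_def)
  qed
  have right: "fst (web_site a (0, 0) n) \<le> fst (web_site (extreme_field 1 y) (0, 0) n)" for n
    by (intro web_site_mono arange extreme_field_range le) auto
  have left: "fst (web_site (extreme_field (-1) y) (0, 0) n) \<le> fst (web_site a (0, 0) n)" for n
    by (intro web_site_mono arange extreme_field_range le) auto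
  have lower: "- 1 - K\<^sub>L * sqrt (real n) \<le> of_int (fst (web_site a (0, 0) n))" for n
    using T web_path_lower_iff[OF K(1), of a] by (auto simp: T1_minus_def a_def)
  have upper: "of_int (fst (web_site a (0, 0) n)) \<le> 1 + K\<^sub>R * sqrt (real n)" for n
    using T web_path_upper_iff[OF K(2), of a] by (auto simp: T1_plus_def a_def)
  have "survives 1 K\<^sub>L N 0 0 (extreme_field 1 y)" for N
    unfolding survives_def
  proof (intro allI impI)
    fix n
    have "real_of_int (fst (web_site a (0, 0) n)) \<le> of_int (fst (web_site (extreme_field 1 y) (0, 0) n))"
      using right by simp
    then show "- 1 - K\<^sub>L * sqrt (real (0 + n)) \<le> real_of_int (1 * fst (web_site (extreme_field 1 y) (0, int 0) n))"
      using lower[of n] by simp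
  qed
  moreover have "survives (-1) K\<^sub>R N 0 0 (extreme_field (-1) y)" for N
    unfolding survives_def
  proof (intro allI impI)
    fix n
    have "real_of_int (fst (web_site (extreme_field (-1) y) (0, 0) n)) \<le> of_int (fst (web_site a (0, 0) n))"
      using left by simp
    then show "- 1 - K\<^sub>R * sqrt (real (0 + n)) \<le> real_of_int (- 1 * fst (web_site (extreme_field (-1) y) (0, int 0) n))"
      using upper[of n] by simp
  qed
  ultimately show ?thesis using \<omega>
    by (simp add: near_event_def two_sided_survives_def y_def[unfolded t_def e_def, symmetric])
qed

text \<open>A negative bound means emptiness, which is obtained from the count at s = 0. Otherwise
  the values D + 1/(n+1) are positive even for D = 0, and there are only countably many null sets to
  discard.\<close>

lemma two_sided_dim_bound:
  assumes K: "0 < K\<^sub>L" "0 < K\<^sub>R"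
  shows "AE \<omega> in M. hausdorff_dim (T1_minus (arrow X W \<omega>) K\<^sub>L \<inter> T1_plus (arrow X W \<omega>) K\<^sub>R)
    \<le> ereal (1 - exponent K\<^sub>L - exponent K\<^sub>R)"
proof -
  define D where "D = 1 - exponent K\<^sub>L - exponent K\<^sub>R"
  define T where "T \<omega> = T1_minus (arrow X W \<omega>) K\<^sub>L \<inter> T1_plus (arrow X W \<omega>) K\<^sub>R" for \<omega>
  have T0: "T \<omega> \<subseteq> {0..}" for \<omega> by (auto simp: T_def T1_minus_def)
  have cov: "\<omega> \<in> near_event K\<^sub>L K\<^sub>R i j"
    if "\<forall>z\<in>even_sites. \<forall>k. 0 \<le> W z k \<omega> \<and> X z k \<omega> \<in> {-1, 1}" "\<omega> \<in> space M"
      "\<tau> \<in> T \<omega>" "real j / 2 ^ i \<le> \<tau>" "\<tau> \<le> real (Suc j) / 2 ^ i" for \<omega> \<tau> i j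
    using K that by (intro near_event_covers) (auto simp: T_def)
  show ?thesis
  proof (cases "D < 0")
    case True
    have "AE \<omega> in M. summable (dyadic_cost 0 (\<lambda>i j. \<omega> \<in> near_event K\<^sub>L K\<^sub>R i j))"
      using True by (intro AE_summable_cost K) (simp add: D_def)
    then show ?thesis using AE_regular AE_space
    proof eventually_elim
      case (elim \<omega>)
      have "T \<omega> = {}" by (rule empty_if_summable_cost[OF T0 elim(1)]) (rule cov[OF elim(2,3)])
      then show ?case unfolding T_def[symmetric] by (simp add: hausdorff_dim_def)
    qed
  next
    case False
    have "AE \<omega> in M. \<forall>n. summable (dyadic_cost (D + 1 / real (Suc n)) (\<lambda>i j. \<omega> \<in> near_event K\<^sub>L K\<^sub>R i j))"
      unfolding AE_all_countable by (intro allI AE_summable_cost K) (simp add: D_def)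
    then show ?thesis using AE_regular AE_space
    proof eventually_elim
      case (elim \<omega>)
      have bound: "hausdorff_dim (T \<omega>) \<le> ereal (D + 1 / real (Suc n))" for n
      proof -
        have s: "0 < D + 1 / real (Suc n)" using False by (intro add_nonneg_pos) auto
        have "hausdorff_measure (D + 1 / real (Suc n)) (T \<omega>) = 0"
          using elim(1) by (intro hausdorff_measure_0_if_summable_cost[OF T0 s _ cov[OF elim(2,3)]]) auto
        then have "Inf (ereal ` {s. 0 \<le> s \<and> hausdorff_measure s (T \<omega>) = 0}) \<le> ereal (D + 1 / real (Suc n))"
          using s by (intro INF_lower) simp
        then show ?thesis by (simp add: hausdorff_dim_def)
      qed
      have "hausdorff_dim (T \<omega>) \<le> ereal D + ereal \<epsilon>" if eps: "0 < \<epsilon>" for \<epsilon>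
      proof -
        obtain n where "1 / real (Suc n) < \<epsilon>"
          using reals_Archimedean[OF eps] by (auto simp: inverse_eq_divide)
        then have "ereal (D + 1 / real (Suc n)) \<le> ereal D + ereal \<epsilon>" by simp
        with bound show ?thesis by (rule order_trans)
      qed
      then show ?case unfolding T_def[symmetric] D_def[symmetric] by (rule ereal_le_epsilon2)
    qed
  qed
qed

end

theorem proposition7:
  fixes M :: "'w measure"
    and X :: "int \<times> int \<Rightarrow> nat \<Rightarrow> 'w \<Rightarrow> int"
    and W :: "int \<times> int \<Rightarrow> nat \<Rightarrow> 'w \<Rightarrow> real"
  assumes "dynamical_discrete_web M X W"
  shows "(\<forall>K\<^sub>L>0. \<forall>K\<^sub>R>0.
            (\<forall>\<omega>\<in>space M.
               T1_minus (arrow X W \<omega>) K\<^sub>L \<inter> T1_plus (arrow X W \<omega>) K\<^sub>R =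
               {\<tau>. 0 \<le> \<tau> \<and> (\<forall>t\<ge>0.
                  - 1 - K\<^sub>L * sqrt t \<le> web_path (arrow X W \<omega> \<tau>) (0, 0) t \<and>
                  web_path (arrow X W \<omega> \<tau>) (0, 0) t \<le> 1 + K\<^sub>R * sqrt t)}) \<and>
            (AE \<omega> in M.
               hausdorff_dim (T1_minus (arrow X W \<omega>) K\<^sub>L \<inter> T1_plus (arrow X W \<omega>) K\<^sub>R)
                 \<le> ereal (1 - exponent K\<^sub>L - exponent K\<^sub>R)))
       \<and> (\<forall>K>0. AE \<omega> in M.
            hausdorff_dim (T1_plusminus (arrow X W \<omega>) K) \<le> ereal (1 - 2 * exponent K))"
proof (intro conjI allI impI ballI)
  interpret dynamical_discrete_web M X W by fact
  fix K\<^sub>L K\<^sub>R :: real assume K: "0 < K\<^sub>L" "0 < K\<^sub>R"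
  show "T1_minus (arrow X W \<omega>) K\<^sub>L \<inter> T1_plus (arrow X W \<omega>) K\<^sub>R =
       {\<tau>. 0 \<le> \<tau> \<and> (\<forall>t\<ge>0.
          - 1 - K\<^sub>L * sqrt t \<le> web_path (arrow X W \<omega> \<tau>) (0, 0) t \<and>
          web_path (arrow X W \<omega> \<tau>) (0, 0) t \<le> 1 + K\<^sub>R * sqrt t)}" for \<omega>
    by (auto simp: T1_minus_def T1_plus_def)
  show "AE \<omega> in M. hausdorff_dim (T1_minus (arrow X W \<omega>) K\<^sub>L \<inter> T1_plus (arrow X W \<omega>) K\<^sub>R)
     \<le> ereal (1 - exponent K\<^sub>L - exponent K\<^sub>R)"
    by (rule two_sided_dim_bound[OF K])
next
  interpret dynamical_discrete_web M X W by fact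
  fix K :: real assume K: "0 < K"
  have "T1_plusminus \<xi> K = T1_minus \<xi> K \<inter> T1_plus \<xi> K" for \<xi>
    unfolding T1_plusminus_def T1_minus_def T1_plus_def abs_le_iff by force
  then show "AE \<omega> in M. hausdorff_dim (T1_plusminus (arrow X W \<omega>) K) \<le> ereal (1 - 2 * exponent K)"
    using two_sided_dim_bound[OF K K] by simp
qed

end
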